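(* Consider the functional (case $\gamma = 2$) \[ J(u) = \frac{a}{2} \int_\Omega |\nabla u|^2\, dx + \frac{b}{4} \left(\int_\Omega |\nabla u|^2\, dx\right)^2 - \frac{\lambda}{2} \int_\Omega u^2\, dx - \frac{1}{2^*} \int_\Omega |u|^{2^*} dx, \quad u \in H^1_0(\Omega), \] where $a \ge 0$, $b > 0$, $\lambda > 0$. Then $J$ satisfies the $(\mathrm{PS})_c$ condition for all $c < c^*$, where $c^*$ is given as follows (and $c^* = +\infty$ means that $J$ satisfies the $(\mathrm{PS})_c$ condition for all $c \in \mathbb{R}$): (i) If $N = 3$, $a, b > 0$, and $0 < \lambda \le a\lambda_1$, then $c^* = \dfrac{1}{4}\, abS^3 + \dfrac{1}{24}\, b^3 S^6 + \dfrac{1}{24} \left(4aS + b^2 S^4\right)^{3/2}$. (ii) If $N = 4$, $a > 0$, $0 < b < S^{-2}$, and $0 < \lambda < a\lambda_1$, then $c^* = \dfrac{a^2}{4\,(S^{-2} - b)}$. (iii) If $N = 4$, $a \ge 0$, and $b > S^{-2}$, then $c^* = +\infty$ for any $\lambda > 0$. (iv) If $N \ge 5$ and $a^{N-4}\, b^2 > \dfrac{4\,(N-4)^{N-4}}{(N-2)^{N-2}}\, S^{-N}$, then $c^* = +\infty$ for any $\lambda > 0$.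
   Context: $\Omega$ is a bounded domain in $\mathbb{R}^N$, $N \ge 3$, and $2^* = 2N/(N-2)$. $H^1_0(\Omega)$ is normed by $\|u\|^2 = \int_\Omega |\nabla u|^2\, dx$. $\lambda_1 > 0$ is the first Dirichlet eigenvalue of $-\Delta$ in $\Omega$. The best Sobolev constant is $S = \inf_{u \in H^1_0(\Omega) \setminus \{0\}} \int_\Omega |\nabla u|^2\, dx \big/ \left(\int_\Omega |u|^{2^*} dx\right)^{2/2^*}$. A $C^1$-functional $J$ on $H^1_0(\Omega)$ satisfies the $(\mathrm{PS})_c$ condition ($c \in \mathbb{R}$) if every sequence $(u_j)$ in $H^1_0(\Omega)$ with $J(u_j) \to c$ and $J'(u_j) \to 0$ has a strongly convergent subsequence. *)

theory Defs
  imports "HOL-Analysis.Analysis"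
begin

primrec C_k :: "nat \<Rightarrow> ('a::euclidean_space \<Rightarrow> real) \<Rightarrow> bool" where
  "C_k 0 f \<longleftrightarrow> continuous_on UNIV f"
| "C_k (Suc k) f \<longleftrightarrow> (\<forall>x. f differentiable (at x)) \<and>
     (\<forall>b\<in>Basis. C_k k (\<lambda>x. frechet_derivative f (at x) b))"

text \<open>Elements of \<open>C\<^sub>c\<^sup>\<infinity>(\<Omega>)\<close> are identified with their extensions by zero to the whole space.\<close>

definition test_functions :: "'a::euclidean_space set \<Rightarrow> ('a \<Rightarrow> real) set" where
  "test_functions \<Omega> = {\<phi>. (\<forall>k. C_k k \<phi>) \<and>
     compact (closure {x. \<phi> x \<noteq> 0}) \<and> closure {x. \<phi> x \<noteq> 0} \<subseteq> \<Omega>}"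

text \<open>
  Elements of the Lebesgue and Sobolev spaces are represented by functions on the whole space whose
  values outside \<open>\<Omega>\<close> play no role; there is no quotient by equality almost everywhere, so the
  norms below are seminorms on representatives, and \<open>u \<noteq> 0\<close> is expressed by
  \<^term>\<open>ae_nonzero\<close>.  Representatives are Borel measurable on \<open>\<Omega>\<close>.
\<close>

definition square_integrable ::
    "'a::euclidean_space set \<Rightarrow> ('a \<Rightarrow> 'b::real_normed_vector) \<Rightarrow> bool" where
  "square_integrable \<Omega> f \<longleftrightarrow>
     set_borel_measurable lborel \<Omega> f \<and> set_integrable lborel \<Omega> (\<lambda>x. (norm (f x))\<^sup>2)"

definition ae_nonzero :: "'a::euclidean_space set \<Rightarrow> ('a \<Rightarrow> real) \<Rightarrow> bool" where
  "ae_nonzero \<Omega> u \<longleftrightarrow> \<not> (AE x in lborel. x \<in> \<Omega> \<longrightarrow> u x = 0)"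

definition has_weak_gradient ::
    "'a::euclidean_space set \<Rightarrow> ('a \<Rightarrow> real) \<Rightarrow> ('a \<Rightarrow> 'a) \<Rightarrow> bool" where
  "has_weak_gradient \<Omega> u g \<longleftrightarrow> square_integrable \<Omega> u \<and> square_integrable \<Omega> g \<and>
     (\<forall>\<phi>\<in>test_functions \<Omega>. \<forall>b\<in>Basis.
        (LINT x:\<Omega>|lborel. u x * frechet_derivative \<phi> (at x) b) =
        - (LINT x:\<Omega>|lborel. (g x \<bullet> b) * \<phi> x))"

definition H1 :: "'a::euclidean_space set \<Rightarrow> ('a \<Rightarrow> real) set" where
  "H1 \<Omega> = {u. \<exists>g. has_weak_gradient \<Omega> u g}"

text \<open>The weak gradient is unique up to null sets, so the choice below is immaterial.\<close>

definition weak_gradient :: "'a::euclidean_space set \<Rightarrow> ('a \<Rightarrow> real) \<Rightarrow> 'a \<Rightarrow> 'a" where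
  "weak_gradient \<Omega> u = (SOME g. has_weak_gradient \<Omega> u g)"

definition dirichlet_energy :: "'a::euclidean_space set \<Rightarrow> ('a \<Rightarrow> real) \<Rightarrow> real" where
  "dirichlet_energy \<Omega> u = (LINT x:\<Omega>|lborel. (norm (weak_gradient \<Omega> u x))\<^sup>2)"

definition H1_norm :: "'a::euclidean_space set \<Rightarrow> ('a \<Rightarrow> real) \<Rightarrow> real" where
  "H1_norm \<Omega> u = sqrt ((LINT x:\<Omega>|lborel. (u x)\<^sup>2) + dirichlet_energy \<Omega> u)"

text \<open>\<open>H\<^sub>0\<^sup>1(\<Omega>)\<close>: the closure of \<open>C\<^sub>c\<^sup>\<infinity>(\<Omega>)\<close> in \<open>H\<^sup>1(\<Omega>)\<close>.\<close>

definition H01 :: "'a::euclidean_space set \<Rightarrow> ('a \<Rightarrow> real) set" where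
  "H01 \<Omega> = {u \<in> H1 \<Omega>. \<exists>\<phi>. (\<forall>k. \<phi> k \<in> test_functions \<Omega>) \<and>
     (\<lambda>k::nat. H1_norm \<Omega> (\<lambda>x. u x - \<phi> k x)) \<longlonglongrightarrow> 0}"

definition H01_norm :: "'a::euclidean_space set \<Rightarrow> ('a \<Rightarrow> real) \<Rightarrow> real" where
  "H01_norm \<Omega> u = sqrt (dirichlet_energy \<Omega> u)"

text \<open>Eigenvalues of \<open>-\<Delta>\<close> with zero boundary values, in the usual weak sense.\<close>

definition dirichlet_eigenvalue :: "'a::euclidean_space set \<Rightarrow> real \<Rightarrow> bool" where
  "dirichlet_eigenvalue \<Omega> \<mu> \<longleftrightarrow> (\<exists>u\<in>H01 \<Omega>. ae_nonzero \<Omega> u \<and>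
     (\<forall>v\<in>H01 \<Omega>. (LINT x:\<Omega>|lborel. weak_gradient \<Omega> u x \<bullet> weak_gradient \<Omega> v x) =
        \<mu> * (LINT x:\<Omega>|lborel. u x * v x)))"

definition first_dirichlet_eigenvalue :: "'a::euclidean_space set \<Rightarrow> real" where
  "first_dirichlet_eigenvalue \<Omega> = (LEAST \<mu>. dirichlet_eigenvalue \<Omega> \<mu>)"

definition critical_exponent :: "'a::euclidean_space itself \<Rightarrow> real" where
  "critical_exponent _ = 2 * real DIM('a) / (real DIM('a) - 2)"

definition critical_integral :: "'a::euclidean_space set \<Rightarrow> ('a \<Rightarrow> real) \<Rightarrow> real" where
  "critical_integral \<Omega> u = (LINT x:\<Omega>|lborel. \<bar>u x\<bar> powr critical_exponent TYPE('a))"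

definition sobolev_constant :: "'a::euclidean_space set \<Rightarrow> real" where
  "sobolev_constant \<Omega> = (INF u\<in>{u \<in> H01 \<Omega>. ae_nonzero \<Omega> u}.
     dirichlet_energy \<Omega> u / critical_integral \<Omega> u powr (2 / critical_exponent TYPE('a)))"

definition H01_bounded_linear ::
    "'a::euclidean_space set \<Rightarrow> (('a \<Rightarrow> real) \<Rightarrow> real) \<Rightarrow> bool" where
  "H01_bounded_linear \<Omega> L \<longleftrightarrow>
     (\<forall>u\<in>H01 \<Omega>. \<forall>v\<in>H01 \<Omega>. L (\<lambda>x. u x + v x) = L u + L v) \<and>
     (\<forall>u\<in>H01 \<Omega>. \<forall>r. L (\<lambda>x. r * u x) = r * L u) \<and>
     (\<exists>C. \<forall>u\<in>H01 \<Omega>. \<bar>L u\<bar> \<le> C * H01_norm \<Omega> u)"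

definition H01_dual_norm :: "'a::euclidean_space set \<Rightarrow> (('a \<Rightarrow> real) \<Rightarrow> real) \<Rightarrow> real" where
  "H01_dual_norm \<Omega> L = (SUP v\<in>{v \<in> H01 \<Omega>. H01_norm \<Omega> v \<le> 1}. \<bar>L v\<bar>)"

text \<open>Frechet derivative of a functional on \<open>H\<^sub>0\<^sup>1(\<Omega>)\<close> at \<open>u\<close>.\<close>

definition H01_has_derivative :: "'a::euclidean_space set \<Rightarrow> (('a \<Rightarrow> real) \<Rightarrow> real) \<Rightarrow>
    (('a \<Rightarrow> real) \<Rightarrow> real) \<Rightarrow> ('a \<Rightarrow> real) \<Rightarrow> bool" where
  "H01_has_derivative \<Omega> J L u \<longleftrightarrow> H01_bounded_linear \<Omega> L \<and>
     (\<forall>\<epsilon>>0. \<exists>\<delta>>0. \<forall>h\<in>H01 \<Omega>. H01_norm \<Omega> h < \<delta> \<longrightarrow>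
        \<bar>J (\<lambda>x. u x + h x) - J u - L h\<bar> \<le> \<epsilon> * H01_norm \<Omega> h)"

text \<open>\<open>J\<close> is a \<open>C\<^sup>1\<close>-functional on \<open>H\<^sub>0\<^sup>1(\<Omega>)\<close> with derivative \<open>J'\<close>.\<close>

definition H01_C1 :: "'a::euclidean_space set \<Rightarrow> (('a \<Rightarrow> real) \<Rightarrow> real) \<Rightarrow>
    (('a \<Rightarrow> real) \<Rightarrow> ('a \<Rightarrow> real) \<Rightarrow> real) \<Rightarrow> bool" where
  "H01_C1 \<Omega> J J' \<longleftrightarrow> (\<forall>u\<in>H01 \<Omega>. H01_has_derivative \<Omega> J (J' u) u) \<and>
     (\<forall>u\<in>H01 \<Omega>. \<forall>\<epsilon>>0. \<exists>\<delta>>0. \<forall>v\<in>H01 \<Omega>. H01_norm \<Omega> (\<lambda>x. v x - u x) < \<delta> \<longrightarrow>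
        H01_dual_norm \<Omega> (\<lambda>h. J' v h - J' u h) < \<epsilon>)"

text \<open>
  The Palais--Smale condition is a property of \<open>C\<^sup>1\<close>-functionals; the derivative \<open>J'\<close> is determined
  on \<^term>\<open>H01 \<Omega>\<close> by \<open>J\<close>.
\<close>

definition satisfies_PS ::
    "'a::euclidean_space set \<Rightarrow> (('a \<Rightarrow> real) \<Rightarrow> real) \<Rightarrow> real \<Rightarrow> bool" where
  "satisfies_PS \<Omega> J c \<longleftrightarrow> (\<exists>J'. H01_C1 \<Omega> J J' \<and>
     (\<forall>U :: nat \<Rightarrow> 'a \<Rightarrow> real.
        (\<forall>j. U j \<in> H01 \<Omega>) \<and> (\<lambda>j. J (U j)) \<longlonglongrightarrow> c \<and> (\<lambda>j. H01_dual_norm \<Omega> (J' (U j))) \<longlonglongrightarrow> 0 \<longrightarrow>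
        (\<exists>u\<in>H01 \<Omega>. \<exists>r. strict_mono r \<and> (\<lambda>j. H01_norm \<Omega> (\<lambda>x. U (r j) x - u x)) \<longlonglongrightarrow> 0)))"

definition kirchhoff_functional ::
    "'a::euclidean_space set \<Rightarrow> real \<Rightarrow> real \<Rightarrow> real \<Rightarrow> ('a \<Rightarrow> real) \<Rightarrow> real" where
  "kirchhoff_functional \<Omega> a b \<mu> u =
     a / 2 * dirichlet_energy \<Omega> u + b / 4 * (dirichlet_energy \<Omega> u)\<^sup>2
     - \<mu> / 2 * (LINT x:\<Omega>|lborel. (u x)\<^sup>2)
     - 1 / critical_exponent TYPE('a) * critical_integral \<Omega> u"

end

theory Submission
  imports Defs "HOL-Library.Function_Algebras" "HOL-Library.Diagonal_Subsequence"
begin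

text \<open>
  Let \<open>u\<close> be the weak limit of a bounded Palais--Smale sequence \<open>U\<^sub>j\<close> and let \<open>\<tau>\<close> be the limit of the
  energies of \<open>v\<^sub>j = U\<^sub>j - u\<close>.  Since \<open>v\<^sub>j\<close> tends to zero in \<open>L\<^sup>2\<close>, testing \<open>J'(U\<^sub>j)\<close> with \<open>v\<^sub>j\<close> gives
  \<open>(a + b A) \<tau> = lim \<integral>|v\<^sub>j|\<^sup>p \<le> (\<tau> / S)\<^bsup>p/2\<^esup>\<close>, where \<open>p\<close> is the critical exponent and
  \<open>A\<close> is the limit of the energies of \<open>U\<^sub>j\<close>; testing with \<open>U\<^sub>j\<close> expresses the level \<open>c\<close> through
  \<open>A\<close> and \<open>\<integral>u\<^sup>2\<close>.  If \<open>\<tau> > 0\<close>, the inequality bounds \<open>\<tau>\<close> from below, hence \<open>c \<ge> c\<^sup>*\<close>, or is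
  contradictory outright.

  The analysis rests on the translation estimate
  \<open>\<integral>|v(x + h) - v(x)|\<^sup>2 dx \<le> |h|\<^sup>2 \<integral>|\<nabla>v|\<^sup>2\<close>.  For long \<open>h\<close> it is the Poincare inequality;
  averaged over a ball it yields the compactness of the embedding into \<open>L\<^sup>2\<close>, and, applied to
  truncations of \<open>u\<close> between the levels \<open>t\<close> and \<open>2t\<close>, a decay estimate for the distribution function
  of \<open>u\<close> whose sum over dyadic levels is the Sobolev inequality.
\<close>

section \<open>Semi-inner product spaces\<close>

text \<open>Functions are not identified almost everywhere, so every space is a seminormed space of
  representatives, and weak gradients agree only up to null sets. The thresholds involve the exact
  constant \<open>S\<close>, an infimum; a Sobolev inequality with a crude constant serves
  integrability and \<open>0 < S\<close>, after which the sharp inequality is the definition of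
  \<open>S\<close>.

  The usual route shows that the weak limit \<open>u\<close> solves a limiting equation. It is
  bypassed: \<open>J'(U j)\<close> is tested only with \<open>U j\<close> and
  \<open>U j - u\<close>, and the coefficient \<open>a + b A\<close> keeps the full limit energy
  \<open>A\<close> instead of the energy of \<open>u\<close>. Since \<open>\<tau> \<le> A\<close>,
  the loss inequality implies \<open>(a + b \<tau>) \<tau> \<le> (\<tau> / S)^(p/2)\<close>, a
  condition on one number. The exponent \<open>p/2\<close> is 3, 2 or below 2 for
  \<open>N = 3\<close>, \<open>N = 4\<close>, \<open>N \<ge> 5\<close>, against the quadratic term
  \<open>b \<tau>^2\<close> on the left: for 3 a root bounds \<tau> from below, for 2 everything
  depends on \<open>b\<close> versus \<open>1/S^2\<close>, and below 2 a weighted mean inequality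
  excludes \<tau> altogether.\<close>

instantiation "fun" :: (type, real_vector) real_vector
begin

definition scaleR_fun_def: "r *\<^sub>R f = (\<lambda>x. r *\<^sub>R f x)"

instance
  by standard (simp_all add: scaleR_fun_def fun_eq_iff algebra_simps)

end

lemma scaleR_fun_apply [simp]: "(r *\<^sub>R f) x = r *\<^sub>R f x"
  by (simp add: scaleR_fun_def)

text \<open>A parabola through the origin that never becomes negative has slope zero there. This is
  the first-order condition at a minimiser, both in the Riesz representation and for the Rayleigh
  quotient.\<close>

lemma nonneg_quadratic_linear_term_zero:
  fixes \<alpha> \<beta> :: real
  assumes "\<And>t. 0 \<le> t\<^sup>2 * \<alpha> + 2 * t * \<beta>"
  shows "\<beta> = 0"
proof (rule ccontr)
  assume "\<beta> \<noteq> 0"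
  have \<alpha>: "\<alpha> \<ge> 0" using assms[of 1] assms[of "-1"] by simp
  \<comment> \<open>The denominator \<open>\<alpha> + 1\<close> keeps the witness meaningful when
    \<open>\<alpha> = 0\<close>.\<close>
  define t where "t = - \<beta> / (\<alpha> + 1)"
  have t: "t * (\<alpha> + 1) = - \<beta>" using \<alpha> by (simp add: t_def)
  have "t\<^sup>2 * \<alpha> + 2 * t * \<beta> = t\<^sup>2 * \<alpha> - 2 * t * (t * (\<alpha> + 1))" using t by simp
  also have "\<dots> = - (t\<^sup>2 * (\<alpha> + 2))" by (simp add: power2_eq_square algebra_simps)
  also have "\<dots> < 0" using \<alpha> \<open>\<beta> \<noteq> 0\<close> by (simp add: t_def)
  finally show False using assms[of t] by simp
qed

text \<open>\<open>B\<close> may be degenerate: representatives that agree almost everywhere are at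
  distance zero without being equal. The laws are demanded only on \<open>V\<close>, because the
  integral of a non-integrable function is 0 by default and additivity may fail outside
  \<open>V\<close>.\<close>

locale semi_inner =
  fixes V :: "'v::real_vector set" and B :: "'v \<Rightarrow> 'v \<Rightarrow> real"
  assumes subspace: "subspace V"
    and add_left: "\<lbrakk>u \<in> V; v \<in> V; w \<in> V\<rbrakk> \<Longrightarrow> B (u + v) w = B u w + B v w"
    and scale_left: "\<lbrakk>u \<in> V; w \<in> V\<rbrakk> \<Longrightarrow> B (r *\<^sub>R u) w = r * B u w"
    and sym: "\<lbrakk>u \<in> V; w \<in> V\<rbrakk> \<Longrightarrow> B u w = B w u"
    and nonneg: "u \<in> V \<Longrightarrow> 0 \<le> B u u"
begin

definition nrm :: "'v \<Rightarrow> real" where "nrm u = sqrt (B u u)"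

lemma mem_add: "\<lbrakk>u \<in> V; v \<in> V\<rbrakk> \<Longrightarrow> u + v \<in> V"
  and mem_scale: "u \<in> V \<Longrightarrow> r *\<^sub>R u \<in> V"
  and mem_diff: "\<lbrakk>u \<in> V; v \<in> V\<rbrakk> \<Longrightarrow> u - v \<in> V"
  and mem_zero: "0 \<in> V"
  and mem_neg: "u \<in> V \<Longrightarrow> - u \<in> V"
  using subspace by (auto intro: subspace_add subspace_scale subspace_diff subspace_0 subspace_neg)

lemmas mems = mem_add mem_scale mem_diff mem_zero mem_neg

lemma add_right: "\<lbrakk>u \<in> V; v \<in> V; w \<in> V\<rbrakk> \<Longrightarrow> B w (u + v) = B w u + B w v"
  using sym add_left mem_add by metis

lemma scale_right: "\<lbrakk>u \<in> V; w \<in> V\<rbrakk> \<Longrightarrow> B w (r *\<^sub>R u) = r * B w u"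
  using sym scale_left mem_scale by metis

lemma neg_left: "\<lbrakk>u \<in> V; w \<in> V\<rbrakk> \<Longrightarrow> B (- u) w = - B u w"
  using scale_left[of u w "-1"] by simp

lemma neg_right: "\<lbrakk>u \<in> V; w \<in> V\<rbrakk> \<Longrightarrow> B w (- u) = - B w u"
  using scale_right[of u w "-1"] by simp

lemma diff_left: "\<lbrakk>u \<in> V; v \<in> V; w \<in> V\<rbrakk> \<Longrightarrow> B (u - v) w = B u w - B v w"
  using add_left[of u "-v" w] neg_left[of v w] mem_neg by simp

lemma diff_right: "\<lbrakk>u \<in> V; v \<in> V; w \<in> V\<rbrakk> \<Longrightarrow> B w (u - v) = B w u - B w v"
  using add_right[of u "-v" w] neg_right[of v w] mem_neg by simp

lemmas bilin = add_left add_right scale_left scale_right neg_left neg_right diff_left diff_right mems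

lemma nrm_nonneg: "u \<in> V \<Longrightarrow> 0 \<le> nrm u"
  by (simp add: nrm_def nonneg)

lemma nrm_sq: "u \<in> V \<Longrightarrow> (nrm u)\<^sup>2 = B u u"
  by (simp add: nrm_def nonneg)

lemma B_zero: "u \<in> V \<Longrightarrow> B 0 u = 0" "u \<in> V \<Longrightarrow> B u 0 = 0"
  using scale_left[of u u 0] scale_right[of u u 0] by simp_all

lemma nrm_zero: "nrm 0 = 0"
  using B_zero(1)[OF mem_zero] by (simp add: nrm_def)

lemma quad_expand:
  assumes "u \<in> V" "v \<in> V"
  shows "B (u + t *\<^sub>R v) (u + t *\<^sub>R v) = B u u + 2 * t * B u v + t\<^sup>2 * B v v"
  using assms sym[of u v] by (simp add: bilin power2_eq_square algebra_simps)

lemma Cauchy_Schwarz: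
  assumes "u \<in> V" "v \<in> V"
  shows "\<bar>B u v\<bar> \<le> nrm u * nrm v"
proof (cases "B v v = 0")
  case True
  have "B u v = 0"
  proof (rule ccontr)
    assume ne: "B u v \<noteq> 0"
    \<comment> \<open>A null vector need not be zero, so this case is genuine: the squared norm of
      \<open>u + t v\<close> is affine in \<open>t\<close>, and this \<open>t\<close> gives it the
      value -1.\<close>
    define t where "t = - (B u u + 1) / (2 * B u v)"
    have "0 \<le> B u u + 2 * t * B u v"
      using nonneg[of "u + t *\<^sub>R v"] quad_expand[OF assms, of t] True assms by (simp add: mems)
    moreover have "2 * t * B u v = - (B u u + 1)" using ne by (simp add: t_def)
    ultimately show False by simp
  qed
  then show ?thesis using assms by (simp add: nrm_nonneg)
next
  case False
  then have pos: "B v v > 0" using nonneg[OF assms(2)] by simp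
  define t where "t = - B u v / B v v"
  have tv: "t * B v v = - B u v" using pos by (simp add: t_def)
  have "0 \<le> B u u + 2 * t * B u v + t\<^sup>2 * B v v"
    using nonneg[of "u + t *\<^sub>R v"] quad_expand[OF assms, of t] assms by (simp add: mems)
  also have "\<dots> = B u u + t * B u v" using tv by (simp add: power2_eq_square algebra_simps)
  finally have "0 \<le> (B u u + t * B u v) * B v v" using pos by simp
  also have "\<dots> = B u u * B v v + (t * B v v) * B u v" by (simp add: algebra_simps)
  also have "\<dots> = B u u * B v v - (B u v)\<^sup>2" by (simp add: tv power2_eq_square)
  finally have "(B u v)\<^sup>2 \<le> (nrm u * nrm v)\<^sup>2" using assms by (simp add: power_mult_distrib nrm_sq)
  then show ?thesis using assms by (subst (asm) power2_le_iff_abs_le) (auto simp: nrm_nonneg)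
qed

lemma nrm_triangle:
  assumes "u \<in> V" "v \<in> V"
  shows "nrm (u + v) \<le> nrm u + nrm v"
proof (rule power2_le_imp_le)
  have "B u v \<le> nrm u * nrm v" using Cauchy_Schwarz[OF assms] by simp
  then show "(nrm (u + v))\<^sup>2 \<le> (nrm u + nrm v)\<^sup>2"
    using assms sym[of u v] by (simp add: nrm_sq bilin power2_sum)
qed (use assms in \<open>simp add: nrm_nonneg\<close>)

lemma nrm_scale: "u \<in> V \<Longrightarrow> nrm (r *\<^sub>R u) = \<bar>r\<bar> * nrm u"
  by (simp add: nrm_def bilin real_sqrt_mult flip: mult.assoc)

lemma nrm_neg: "u \<in> V \<Longrightarrow> nrm (- u) = nrm u"
  using nrm_scale[of u "-1"] by simp

lemma nrm_minus_commute: "\<lbrakk>u \<in> V; v \<in> V\<rbrakk> \<Longrightarrow> nrm (u - v) = nrm (v - u)"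
  using nrm_neg[of "u - v"] by (simp add: mems)

lemma nrm_triangle_diff: "\<lbrakk>u \<in> V; v \<in> V\<rbrakk> \<Longrightarrow> nrm (u - v) \<le> nrm u + nrm v"
  using nrm_triangle[of u "-v"] by (simp add: nrm_neg mems)

lemma nrm_triangle_le:
  assumes "u \<in> V" "v \<in> V" "w \<in> V"
  shows "nrm (u - w) \<le> nrm (u - v) + nrm (v - w)"
  using nrm_triangle[of "u - v" "v - w"] assms by (simp add: mems)

lemma nrm_reverse_triangle: 
  assumes "u \<in> V" "v \<in> V" 
  shows "\<bar>nrm u - nrm v\<bar> \<le> nrm (u - v)"
  using nrm_triangle[of "u - v" v] nrm_triangle[of "v - u" u] nrm_minus_commute[of u v] assms
  by (simp add: mems)

lemma nrm_LIMSEQ: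
  assumes "\<And>n. U n \<in> V" "u \<in> V" "(\<lambda>n. nrm (U n - u)) \<longlonglongrightarrow> 0"
  shows "(\<lambda>n. nrm (U n)) \<longlonglongrightarrow> nrm u"
proof -
  have "(\<lambda>n. nrm (U n) - nrm u) \<longlonglongrightarrow> 0"
    by (rule Lim_null_comparison[OF _ assms(3)]) (use assms nrm_reverse_triangle in auto)
  then show ?thesis by (simp add: LIM_zero_iff)
qed

lemma B_LIMSEQ:
  assumes "\<And>n. U n \<in> V" "u \<in> V" "(\<lambda>n. nrm (U n - u)) \<longlonglongrightarrow> 0" "v \<in> V"
  shows "(\<lambda>n. B (U n) v) \<longlonglongrightarrow> B u v"
proof -
  have "(\<lambda>n. B (U n) v - B u v) \<longlonglongrightarrow> 0"
  proof (rule Lim_null_comparison)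
    show "\<forall>\<^sub>F n in sequentially. norm (B (U n) v - B u v) \<le> nrm (U n - u) * nrm v"
      using assms Cauchy_Schwarz[of "U _ - u" v] by (intro always_eventually) (simp add: bilin)
    show "(\<lambda>n. nrm (U n - u) * nrm v) \<longlonglongrightarrow> 0" using tendsto_mult_left_zero[OF assms(3)] .
  qed
  then show ?thesis by (simp add: LIM_zero_iff)
qed

text \<open>Each pairing with a fixed vector is a bounded real sequence. Only the countably many
  pairings with the members of the sequence itself are made to converge, by a diagonal argument;
  \<open>weakly_compact\<close> passes from these to all vectors.\<close>

lemma weak_diagonal_subseq:
  fixes U :: "nat \<Rightarrow> 'v"
  assumes U: "\<And>n. U n \<in> V" and bd: "\<And>n. nrm (U n) \<le> M"
  obtains r where "strict_mono r" "\<And>i. convergent (\<lambda>n. B (U (r n)) (U i))"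
proof -
  interpret subseqs "\<lambda>i s. convergent (\<lambda>n. B (U (s n)) (U i))"
  proof
    fix i and s :: "nat \<Rightarrow> nat" assume "strict_mono s"
    have "\<bar>B (U (s n)) (U i)\<bar> \<le> M * nrm (U i)" for n
      using Cauchy_Schwarz[OF U U, of "s n" i] mult_right_mono[OF bd nrm_nonneg[OF U], of "s n" i]
      by linarith
    then have "bounded (range (\<lambda>n. B (U (s n)) (U i)))" by (auto simp: bounded_iff)
    from bounded_imp_convergent_subsequence[OF this]
    obtain l r where "strict_mono r" "((\<lambda>n. B (U (s n)) (U i)) \<circ> r) \<longlonglongrightarrow> l" by auto
    then show "\<exists>r. strict_mono r \<and> convergent (\<lambda>n. B (U ((s \<circ> r) n)) (U i))"
      by (auto simp: convergent_def o_def)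
  qed
  have "convergent (\<lambda>n. B (U (diagseq n)) (U i))" for i
  proof -
    \<comment> \<open>The diagonal sequence is a subsequence of the \<open>i\<close>-th refinement
      only after its first \<open>Suc i\<close> terms, hence the shift.\<close>
    have "convergent (\<lambda>n. B (U ((diagseq \<circ> (+) (Suc i)) n)) (U i))"
    proof (rule diagseq_holds)
      fix i and r s :: "nat \<Rightarrow> nat" assume "strict_mono s" "convergent (\<lambda>n. B (U (r n)) (U i))"
      then show "convergent (\<lambda>n. B (U ((r \<circ> s) n)) (U i))"
        using convergent_subseq_convergent[of "\<lambda>n. B (U (r n)) (U i)" s] by (simp add: o_def)
    qed
    then have "convergent (\<lambda>n. B (U (diagseq (n + Suc i))) (U i))" by (simp add: o_def add.commute)
    then show ?thesis
      using convergent_ignore_initial_segment[of "\<lambda>n. B (U (diagseq n)) (U i)" "Suc i"] by simp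
  qed
  then show ?thesis using that[OF subseq_diagseq] by blast
qed

end

section \<open>Hilbert spaces: Riesz representation and weak compactness\<close>

locale semi_hilbert = semi_inner +
  assumes complete: "\<lbrakk>\<And>n. U n \<in> V; \<And>e. 0 < e \<Longrightarrow> \<exists>K. \<forall>m\<ge>K. \<forall>n\<ge>K. sqrt (B (U m - U n) (U m - U n)) < e\<rbrakk>
     \<Longrightarrow> \<exists>u\<in>V. (\<lambda>n. sqrt (B (U n - u) (U n - u))) \<longlonglongrightarrow> 0"
begin

text \<open>Direct method: the representing vector minimises \<open>F v = B v v - 2 * L v\<close>.
  The parallelogram identity makes a minimising sequence Cauchy, and the first variation of
  \<open>F\<close> at the minimiser \<open>w\<close> is twice \<open>B w v - L v\<close>. Neither
  orthogonal complements nor a quotient by null vectors enter.\<close>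

lemma riesz:
  assumes Ladd: "\<And>u v. \<lbrakk>u \<in> V; v \<in> V\<rbrakk> \<Longrightarrow> L (u + v) = L u + L v"
    and Lscale: "\<And>u r. u \<in> V \<Longrightarrow> L (r *\<^sub>R u) = r * L u"
    and Lbd: "\<And>u. u \<in> V \<Longrightarrow> \<bar>L u\<bar> \<le> C * nrm u"
  shows "\<exists>w\<in>V. \<forall>v\<in>V. L v = B w v"
proof -
  define F where "F v = B v v - 2 * L v" for v
  have F_bd: "- C\<^sup>2 \<le> F v" if "v \<in> V" for v
  proof -
    have "0 \<le> (nrm v - C)\<^sup>2" by simp
    then have "- C\<^sup>2 \<le> (nrm v)\<^sup>2 - 2 * (C * nrm v)" by (simp add: power2_diff algebra_simps)
    also have "\<dots> \<le> F v" using Lbd[OF that] that by (simp add: F_def nrm_sq)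
    finally show ?thesis .
  qed
  define I where "I = Inf (F ` V)"
  have bdd: "bdd_below (F ` V)" using F_bd by (auto intro!: bdd_belowI)
  have I_le: "I \<le> F v" if "v \<in> V" for v unfolding I_def by (rule cInf_lower) (use that bdd in auto)
  have "\<exists>v\<in>V. F v < I + 1 / real (Suc n)" for n
  proof -
    have "\<exists>x\<in>F ` V. x < I + 1 / real (Suc n)"
      by (rule cInf_lessD) (use mem_zero in \<open>auto simp: I_def\<close>)
    then show ?thesis by auto
  qed
  then obtain W where W: "\<And>n. W n \<in> V" "\<And>n. F (W n) < I + 1 / real (Suc n)" by metis
  have par: "(nrm (u - v))\<^sup>2 \<le> 2 * (F u - I) + 2 * (F v - I)" if uv: "u \<in> V" "v \<in> V" for u v
  proof -
    have "(nrm (u - v))\<^sup>2 = 2 * F u + 2 * F v - 4 * F ((1/2) *\<^sub>R (u + v))"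
      using uv sym[of u v] by (simp add: nrm_sq F_def bilin Ladd Lscale algebra_simps)
    moreover have "I \<le> F ((1/2) *\<^sub>R (u + v))" by (rule I_le) (simp add: uv mems)
    ultimately show ?thesis by simp
  qed
  have "\<exists>u\<in>V. (\<lambda>n. sqrt (B (W n - u) (W n - u))) \<longlonglongrightarrow> 0"
  proof (rule complete)
    fix e :: real assume "0 < e"
    obtain K where K: "inverse (real (Suc K)) < e\<^sup>2 / 4"
      using reals_Archimedean[of "e\<^sup>2 / 4"] \<open>0 < e\<close> by auto
    have "sqrt (B (W m - W n) (W m - W n)) < e" if "m \<ge> K" "n \<ge> K" for m n
    proof -
      have F1: "F (W k) - I < e\<^sup>2 / 4" if "k \<ge> K" for k
      proof -
        have "1 / real (Suc k) \<le> inverse (real (Suc K))" using that by (simp add: field_simps)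
        then show ?thesis using W(2)[of k] K by linarith
      qed
      have "(nrm (W m - W n))\<^sup>2 < e\<^sup>2"
      proof -
        have "2 * (F (W m) - I) + 2 * (F (W n) - I) < 2 * (e\<^sup>2 / 4) + 2 * (e\<^sup>2 / 4)"
          by (intro add_strict_mono mult_strict_left_mono F1 that) auto
        then show ?thesis using par[OF W(1) W(1), of m n] by simp
      qed
      then show ?thesis using \<open>0 < e\<close> unfolding nrm_def[symmetric] by (metis less_imp_le power2_less_imp_less)
    qed
    then show "\<exists>K. \<forall>m\<ge>K. \<forall>n\<ge>K. sqrt (B (W m - W n) (W m - W n)) < e" by blast
  qed (rule W)
  then obtain w where w: "w \<in> V" "(\<lambda>n. nrm (W n - w)) \<longlonglongrightarrow> 0" by (auto simp: nrm_def)
  have LW: "(\<lambda>n. L (W n)) \<longlonglongrightarrow> L w"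
  proof -
    have "(\<lambda>n. L (W n) - L w) \<longlonglongrightarrow> 0"
    proof (rule Lim_null_comparison)
      have "L (W n - w) = L (W n) - L w" for n
        using Ladd[of "W n" "- w"] Lscale[of w "-1"] W w by (simp add: mems)
      then show "\<forall>\<^sub>F n in sequentially. norm (L (W n) - L w) \<le> C * nrm (W n - w)"
        using Lbd[of "W _ - w"] W w by (intro always_eventually) (simp add: mems)
      show "(\<lambda>n. C * nrm (W n - w)) \<longlonglongrightarrow> 0" using tendsto_mult_right_zero[OF w(2)] .
    qed
    then show ?thesis by (simp add: LIM_zero_iff)
  qed
  have "(\<lambda>n. F (W n)) \<longlonglongrightarrow> (nrm w)\<^sup>2 - 2 * L w"
    unfolding F_def nrm_sq[OF W(1), symmetric]
    by (intro tendsto_intros LW nrm_LIMSEQ W w)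
  moreover have "(\<lambda>n. F (W n)) \<longlonglongrightarrow> I"
  proof (rule tendsto_sandwich[of "\<lambda>_. I"])
    show "(\<lambda>n. I + 1 / real (Suc n)) \<longlonglongrightarrow> I"
      using tendsto_add[OF tendsto_const LIMSEQ_inverse_real_of_nat, of I] by (simp add: field_simps)
  qed (auto intro!: always_eventually I_le W less_imp_le[OF W(2)[simplified]])
  ultimately have "(nrm w)\<^sup>2 - 2 * L w = I" by (rule LIMSEQ_unique)
  then have FI: "F w = I" using w(1) by (simp add: F_def nrm_sq)
  have "L v = B w v" if v: "v \<in> V" for v
  proof -
    have "0 \<le> t\<^sup>2 * B v v + 2 * t * (B w v - L v)" for t
    proof -
      have "F w \<le> F (w + t *\<^sub>R v)" unfolding FI by (rule I_le) (simp add: w v mems)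
      also have "\<dots> = F w + t\<^sup>2 * B v v + 2 * t * (B w v - L v)"
        unfolding F_def quad_expand[OF w(1) v] using w v by (simp add: Ladd Lscale mems algebra_simps)
      finally show ?thesis by simp
    qed
    from nonneg_quadratic_linear_term_zero[OF this] show ?thesis by simp
  qed
  then show ?thesis using w(1) by (intro bexI[of _ w] ballI)
qed

text \<open>Every vector pairs with the sequence as its Riesz representative in the closed subspace \<open>W\<close>
  of those vectors for which the pairing converges; hence \<open>W\<close> is everything.\<close>

lemma weakly_compact:
  fixes U :: "nat \<Rightarrow> 'a"
  assumes U: "\<And>n. U n \<in> V" and bd: "\<And>n. nrm (U n) \<le> M"
  shows "\<exists>w\<in>V. \<exists>r. strict_mono r \<and> (\<forall>v\<in>V. (\<lambda>n. B (U (r n)) v) \<longlonglongrightarrow> B w v)"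
proof -
  obtain r :: "nat \<Rightarrow> nat" where r: "strict_mono r" "\<And>i. convergent (\<lambda>n. B (U (r n)) (U i))"
    using weak_diagonal_subseq[of U M, OF U bd] by blast
  have M: "0 \<le> M" using bd[of 0] nrm_nonneg[OF U, of 0] by linarith
  define W where "W = {v\<in>V. convergent (\<lambda>n. B (U (r n)) v)}"
  have WV: "W \<subseteq> V" by (auto simp: W_def)
  have subW: "subspace W"
    unfolding subspace_def W_def
    by (auto simp: bilin U B_zero convergent_const intro!: convergent_add convergent_mult)
  \<comment> \<open>\<open>W\<close> is closed: the bound \<open>M\<close> makes the pairings of the
    sequence with \<open>X k\<close> and with \<open>u\<close> uniformly close, so the Cauchy
    property passes to the limit. The denominators use \<open>M + 1\<close> because \<open>M\<close>
    may be 0.\<close>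
  have clW: "u \<in> W" if X: "\<And>n. X n \<in> W" and u: "u \<in> V" and lim: "(\<lambda>n. nrm (X n - u)) \<longlonglongrightarrow> 0" for X u
  proof -
    have XV: "X n \<in> V" for n using X WV by auto
    have "Cauchy (\<lambda>n. B (U (r n)) u)"
    proof (rule metric_CauchyI)
      fix e :: real assume e: "0 < e"
      have "\<forall>\<^sub>F k in sequentially. nrm (X k - u) < e / (4 * (M + 1))"
        by (rule order_tendstoD[OF lim]) (use e M in auto)
      then obtain k where k: "nrm (X k - u) < e / (4 * (M + 1))" by (auto simp: eventually_sequentially)
      have cl: "\<bar>B (U n) (X k) - B (U n) u\<bar> < e / 3" for n
      proof -
        have "\<bar>B (U n) (X k) - B (U n) u\<bar> \<le> nrm (U n) * nrm (X k - u)"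
          using Cauchy_Schwarz[of "U n" "X k - u"] U XV u by (simp add: bilin)
        also have "\<dots> \<le> (M + 1) * nrm (X k - u)"
          using bd[of n] by (intro mult_right_mono) (auto intro!: nrm_nonneg simp: mems XV u)
        also have "\<dots> < (M + 1) * (e / (4 * (M + 1)))" using mult_strict_left_mono[OF k, of "M + 1"] M by simp
        also have "\<dots> < e / 3" using M e by (simp add: field_simps add_pos_nonneg)
        finally show ?thesis .
      qed
      have "Cauchy (\<lambda>n. B (U (r n)) (X k))" using X[of k] by (simp add: W_def Cauchy_convergent_iff)
      then obtain K where K: "\<And>m n. m \<ge> K \<Longrightarrow> n \<ge> K \<Longrightarrow> \<bar>B (U (r m)) (X k) - B (U (r n)) (X k)\<bar> < e / 3"
        using e unfolding Cauchy_def dist_real_def by (metis divide_pos_pos zero_less_numeral)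
      have "dist (B (U (r m)) u) (B (U (r n)) u) < e" if "m \<ge> K" "n \<ge> K" for m n
        using K[OF that] cl[of "r m"] cl[of "r n"] unfolding dist_real_def by linarith
      then show "\<exists>K. \<forall>m\<ge>K. \<forall>n\<ge>K. dist (B (U (r m)) u) (B (U (r n)) u) < e" by blast
    qed
    then show ?thesis using u by (simp add: W_def Cauchy_convergent_iff)
  qed
  interpret W: semi_hilbert W B
  proof
    fix X :: "nat \<Rightarrow> 'a"
    assume X: "\<And>n. X n \<in> W"
      and C: "\<And>e. 0 < e \<Longrightarrow> \<exists>K. \<forall>m\<ge>K. \<forall>n\<ge>K. sqrt (B (X m - X n) (X m - X n)) < e"
    have "\<exists>u\<in>V. (\<lambda>n. sqrt (B (X n - u) (X n - u))) \<longlonglongrightarrow> 0"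
      by (rule complete) (use X WV C in auto)
    then obtain u where u: "u \<in> V" "(\<lambda>n. sqrt (B (X n - u) (X n - u))) \<longlonglongrightarrow> 0" by blast
    moreover have "u \<in> W" by (rule clW[OF X u(1)]) (use u in \<open>simp add: nrm_def\<close>)
    ultimately show "\<exists>u\<in>W. (\<lambda>n. sqrt (B (X n - u) (X n - u))) \<longlonglongrightarrow> 0" by blast
  qed (use WV in \<open>auto intro!: subW add_left scale_left nonneg intro: sym\<close>)
  have "v \<in> W" if v: "v \<in> V" for v
  proof -
    have "\<exists>p\<in>W. \<forall>m\<in>W. B v m = B p m"
      by (rule W.riesz[where C = "nrm v"])
        (use WV v Cauchy_Schwarz[OF v] in \<open>auto simp: bilin W.nrm_def nrm_def subset_iff\<close>)
    then obtain p where p: "p \<in> W" "\<And>m. m \<in> W \<Longrightarrow> B v m = B p m" by blast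
    have "U n \<in> W" for n using U r by (simp add: W_def)
    then have "B (U (r n)) v = B (U (r n)) p" for n
      using p U v WV by (metis subsetD sym)
    then show ?thesis using v p by (simp add: W_def)
  qed
  then have conv: "convergent (\<lambda>n. B (U (r n)) v)" if "v \<in> V" for v using that by (auto simp: W_def)
  define L where "L v = lim (\<lambda>n. B (U (r n)) v)" for v
  have L: "(\<lambda>n. B (U (r n)) v) \<longlonglongrightarrow> L v" if "v \<in> V" for v
    unfolding L_def using conv[OF that] by (simp add: convergent_LIMSEQ_iff)
  have "\<exists>w\<in>V. \<forall>v\<in>V. L v = B w v"
  proof (rule riesz[where C = M])
    fix u v assume uv: "u \<in> V" "v \<in> V"
    have "(\<lambda>n. B (U (r n)) (u + v)) \<longlonglongrightarrow> L u + L v"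
      using tendsto_add[OF L[OF uv(1)] L[OF uv(2)]] uv by (simp add: bilin U)
    then show "L (u + v) = L u + L v" using L[of "u + v"] uv LIMSEQ_unique by (auto simp: mems)
  next
    fix u t assume u: "u \<in> V"
    have "(\<lambda>n. B (U (r n)) (t *\<^sub>R u)) \<longlonglongrightarrow> t * L u"
      using tendsto_mult[OF tendsto_const L[OF u], of t] u by (simp add: bilin U)
    then show "L (t *\<^sub>R u) = t * L u" using L[of "t *\<^sub>R u"] u LIMSEQ_unique by (auto simp: mems)
  next
    fix u assume u: "u \<in> V"
    show "\<bar>L u\<bar> \<le> M * nrm u"
    proof (rule LIMSEQ_le_const2[OF tendsto_rabs[OF L[OF u]]])
      have "\<bar>B (U (r n)) u\<bar> \<le> M * nrm u" for n
        using Cauchy_Schwarz[OF U u, of "r n"] mult_right_mono[OF bd nrm_nonneg[OF u], of "r n"] by linarith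
      then show "\<exists>N. \<forall>n\<ge>N. \<bar>B (U (r n)) u\<bar> \<le> M * nrm u" by blast
    qed
  qed
  then obtain w where "w \<in> V" "\<forall>v\<in>V. L v = B w v" by blast
  then show ?thesis using L r(1) by metis
qed

end

section \<open>Square-integrable functions\<close>

definition L2 :: "'x measure \<Rightarrow> ('x \<Rightarrow> 'b::euclidean_space) set" where
  "L2 M = {f. f \<in> borel_measurable M \<and> integrable M (\<lambda>x. (norm (f x))\<^sup>2)}"

definition L2_inner :: "'x measure \<Rightarrow> ('x \<Rightarrow> 'b::euclidean_space) \<Rightarrow> ('x \<Rightarrow> 'b) \<Rightarrow> real" where
  "L2_inner M f g = (LINT x|M. f x \<bullet> g x)"

definition L2_norm :: "'x measure \<Rightarrow> ('x \<Rightarrow> 'b::euclidean_space) \<Rightarrow> real" where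
  "L2_norm M f = sqrt (LINT x|M. (norm (f x))\<^sup>2)"

lemma L2_measurable: "f \<in> L2 M \<Longrightarrow> f \<in> borel_measurable M"
  and L2_integrable: "f \<in> L2 M \<Longrightarrow> integrable M (\<lambda>x. (norm (f x))\<^sup>2)"
  by (auto simp: L2_def)

lemma norm_add_power2_le:
  fixes x y :: "'b::real_inner"
  shows "(norm (x + y))\<^sup>2 \<le> 2 * (norm x)\<^sup>2 + 2 * (norm y)\<^sup>2"
proof -
  have "(norm (x + y))\<^sup>2 + (norm (x - y))\<^sup>2 = 2 * (norm x)\<^sup>2 + 2 * (norm y)\<^sup>2"
    by (simp add: power2_norm_eq_inner inner_add inner_diff inner_commute)
  then show ?thesis by (smt (verit) zero_le_power2)
qed

lemma L2_mult_integrable: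
  assumes "f \<in> L2 M" "g \<in> L2 M"
  shows "integrable M (\<lambda>x. f x \<bullet> g x)"
proof (rule Bochner_Integration.integrable_bound)
  show "integrable M (\<lambda>x. (norm (f x))\<^sup>2 + (norm (g x))\<^sup>2)" using assms by (simp add: L2_def)
  show "AE x in M. norm (f x \<bullet> g x) \<le> norm ((norm (f x))\<^sup>2 + (norm (g x))\<^sup>2)"
  proof (rule AE_I2)
    fix x
    have "norm (f x \<bullet> g x) \<le> norm (f x) * norm (g x)" using Cauchy_Schwarz_ineq2 by simp
    also have "\<dots> \<le> (norm (f x))\<^sup>2 + (norm (g x))\<^sup>2"
      using sum_squares_bound[of "norm (f x)" "norm (g x)"] mult_nonneg_nonneg[OF norm_ge_zero norm_ge_zero, of "f x" "g x"]
      by linarith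
    finally show "norm (f x \<bullet> g x) \<le> norm ((norm (f x))\<^sup>2 + (norm (g x))\<^sup>2)" by simp
  qed
  show "(\<lambda>x. f x \<bullet> g x) \<in> borel_measurable M"
    using assms by (auto simp: L2_def intro: borel_measurable_inner)
qed

lemma subspace_L2: "subspace (L2 M :: ('x \<Rightarrow> 'b::euclidean_space) set)"
proof (rule subspaceI)
  fix f g :: "'x \<Rightarrow> 'b" assume fg: "f \<in> L2 M" "g \<in> L2 M"
  have "integrable M (\<lambda>x. (norm (f x + g x))\<^sup>2)"
  proof (rule Bochner_Integration.integrable_bound)
    show "integrable M (\<lambda>x. 2 * (norm (f x))\<^sup>2 + 2 * (norm (g x))\<^sup>2)" using fg by (simp add: L2_def)
  qed (use fg norm_add_power2_le[of "f _" "g _"] in \<open>auto simp: L2_def intro!: AE_I2\<close>)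
  then show "f + g \<in> L2 M" using fg by (auto simp: L2_def plus_fun_def)
qed (auto simp: L2_def scaleR_fun_def zero_fun_def power_mult_distrib)

lemma L2_inner_self: "L2_inner M f f = (LINT x|M. (norm (f x))\<^sup>2)"
  by (simp add: L2_inner_def power2_norm_eq_inner)

interpretation L2: semi_inner "L2 M :: ('x \<Rightarrow> 'b::euclidean_space) set" "L2_inner M"
  rewrites "semi_inner.nrm (L2_inner M) = L2_norm M"
  for M :: "'x measure"
proof -
  show "semi_inner (L2 M) (L2_inner M :: ('x \<Rightarrow> 'b) \<Rightarrow> ('x \<Rightarrow> 'b) \<Rightarrow> real)"
  proof
    show "subspace (L2 M :: ('x \<Rightarrow> 'b) set)" by (rule subspace_L2)
  qed (auto simp: L2_inner_def L2_mult_integrable inner_add_left, simp add: inner_commute)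
  then interpret semi_inner "L2 M" "L2_inner M :: ('x \<Rightarrow> 'b) \<Rightarrow> ('x \<Rightarrow> 'b) \<Rightarrow> real" .
  show "nrm = (L2_norm M :: ('x \<Rightarrow> 'b) \<Rightarrow> real)"
    by (simp add: fun_eq_iff nrm_def L2_norm_def L2_inner_self)
qed

lemma L2_norm_sq: "(L2_norm M f)\<^sup>2 = (LINT x|M. (norm (f x))\<^sup>2)"
  by (simp add: L2_norm_def)

lemma L2_norm_nonneg [simp]: "0 \<le> L2_norm M f"
  by (simp add: L2_norm_def)

lemma L2_norm_eq_0_iff: "f \<in> L2 M \<Longrightarrow> L2_norm M f = 0 \<longleftrightarrow> (AE x in M. f x = 0)"
  by (simp add: L2_norm_def L2_def integral_nonneg_eq_0_iff_AE)

lemma L2_norm_cong_AE: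
  assumes "f \<in> borel_measurable M" "g \<in> borel_measurable M" "AE x in M. f x = g x"
  shows "L2_norm M f = L2_norm M g"
  unfolding L2_norm_def by (intro arg_cong[where f = sqrt] integral_cong_AE) (use assms in auto)

lemma L2_inner_cong_AE:
  assumes "f \<in> borel_measurable M" "f' \<in> borel_measurable M" "g \<in> borel_measurable M" "g' \<in> borel_measurable M"
    and "AE x in M. f x = f' x" "AE x in M. g x = g' x"
  shows "L2_inner M f g = L2_inner M f' g'"
  unfolding L2_inner_def by (intro integral_cong_AE) (use assms in \<open>auto intro: borel_measurable_inner\<close>)

text \<open>Fatou's lemma for Bochner integrals. Integrability of the limit is part of the
  conclusion, and the bound \<open>C\<close> is required only eventually, which lets it be any
  number above a limit of bounds.\<close>

lemma Fatou_integral_le: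
  fixes f :: "nat \<Rightarrow> 'x \<Rightarrow> real"
  assumes int: "\<And>n. integrable M (f n)" and nn: "\<And>n x. 0 \<le> f n x" and meas: "g \<in> borel_measurable M"
    and lim: "AE x in M. (\<lambda>n. f n x) \<longlonglongrightarrow> g x" and bd: "\<forall>\<^sub>F n in sequentially. (LINT x|M. f n x) \<le> C"
  shows "integrable M g" "(LINT x|M. g x) \<le> C"
proof -
  have nng: "AE x in M. 0 \<le> g x"
    using lim by eventually_elim (rule LIMSEQ_le_const, use nn in auto)
  obtain n where "(LINT x|M. f n x) \<le> C" using bd by (auto simp: eventually_sequentially)
  moreover have "0 \<le> (LINT x|M. f n x)" by (intro integral_nonneg_AE AE_I2 nn)
  ultimately have C: "0 \<le> C" by linarith
  have [measurable]: "f n \<in> borel_measurable M" for n using int by auto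
  have "(\<integral>\<^sup>+x. ennreal (g x) \<partial>M) = (\<integral>\<^sup>+x. liminf (\<lambda>n. ennreal (f n x)) \<partial>M)"
    by (rule nn_integral_cong_AE) (use lim in \<open>eventually_elim, metis lim_imp_Liminf sequentially_bot tendsto_ennrealI\<close>)
  also have "\<dots> \<le> liminf (\<lambda>n. \<integral>\<^sup>+x. ennreal (f n x) \<partial>M)" by (rule nn_integral_liminf) measurable
  also have "\<dots> = liminf (\<lambda>n. ennreal (LINT x|M. f n x))"
    by (simp add: nn_integral_eq_integral int nn)
  also have "\<dots> \<le> liminf (\<lambda>n. ennreal C)"
    by (rule Liminf_mono) (use bd in \<open>auto elim: eventually_mono intro: ennreal_leI\<close>)
  finally have le: "(\<integral>\<^sup>+x. ennreal (g x) \<partial>M) \<le> ennreal C" by (simp add: Liminf_const)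
  show "integrable M g"
  proof (rule integrableI_bounded[OF meas])
    have "(\<integral>\<^sup>+x. ennreal (norm (g x)) \<partial>M) = (\<integral>\<^sup>+x. ennreal (g x) \<partial>M)"
      by (rule nn_integral_cong_AE) (use nng in auto)
    then show "(\<integral>\<^sup>+x. ennreal (norm (g x)) \<partial>M) < \<infinity>" using le by (simp add: le_less_trans)
  qed
  then show "(LINT x|M. g x) \<le> C"
    using le nng C by (simp add: nn_integral_eq_integral)
qed

text \<open>Cauchy-Schwarz against the constant 1, which is square integrable because the measure is
  finite.\<close>

lemma (in finite_measure) L2_integral_norm_le:
  assumes "f \<in> L2 M"
  shows "integrable M f" "(LINT x|M. norm (f x)) \<le> sqrt (measure M (space M)) * L2_norm M f"
proof -
  have *: "(\<lambda>x. norm (f x)) \<in> L2 M" "(\<lambda>x. 1::real) \<in> L2 M"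
    using assms by (auto simp: L2_def)
  have "integrable M (\<lambda>x. norm (f x))" using L2_mult_integrable[OF *] by simp
  then show "integrable M f" using assms by (auto simp: L2_def intro: integrable_norm_cancel)
  show "(LINT x|M. norm (f x)) \<le> sqrt (measure M (space M)) * L2_norm M f"
    using L2.Cauchy_Schwarz[OF *] by (simp add: L2_norm_def L2_inner_def mult.commute)
qed

text \<open>On a finite measure space the increments have geometrically decaying L1 norms, so the
  sum of their absolute values is finite almost everywhere and the telescoping series converges
  there.\<close>

lemma (in finite_measure) L2_fast_Cauchy_AE_convergent:
  fixes G :: "nat \<Rightarrow> 'a \<Rightarrow> 'b::euclidean_space"
  assumes G: "\<And>n. G n \<in> L2 M" and fast: "\<And>n. L2_norm M (G (Suc n) - G n) \<le> (1/2)^n"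
  shows "AE x in M. convergent (\<lambda>n. G n x)"
proof -
  define d where "d n = G (Suc n) - G n" for n
  define c where "c = sqrt (measure M (space M))"
  have d: "d n \<in> L2 M" for n unfolding d_def by (intro L2.mems G)
  have [measurable]: "d n \<in> borel_measurable M" for n using d by (simp add: L2_def)
  have c: "0 \<le> c" by (simp add: c_def)
  have nn: "(\<integral>\<^sup>+x. ennreal (norm (d n x)) \<partial>M) \<le> ennreal (c * (1/2)^n)" for n
  proof -
    have "(\<integral>\<^sup>+x. ennreal (norm (d n x)) \<partial>M) = ennreal (LINT x|M. norm (d n x))"
      using L2_integral_norm_le(1)[OF d, of n] by (intro nn_integral_eq_integral) auto
    also have "\<dots> \<le> ennreal (c * (1/2)^n)"
      using L2_integral_norm_le(2)[OF d, of n] fast[of n] mult_left_mono[OF fast[of n] c]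
      by (intro ennreal_leI) (simp add: c_def d_def)
    finally show ?thesis .
  qed
  have "(\<integral>\<^sup>+x. (\<Sum>n. ennreal (norm (d n x))) \<partial>M) = (\<Sum>n. \<integral>\<^sup>+x. ennreal (norm (d n x)) \<partial>M)"
    by (rule nn_integral_suminf) measurable
  also have "\<dots> \<le> (\<Sum>n. ennreal (c * (1/2)^n))" by (intro suminf_le nn) auto
  also have "\<dots> = ennreal (\<Sum>n. c * (1/2)^n)"
    by (rule suminf_ennreal2) (use c in \<open>auto intro!: summable_mult summable_geometric\<close>)
  finally have "(\<integral>\<^sup>+x. (\<Sum>n. ennreal (norm (d n x))) \<partial>M) \<noteq> \<infinity>"
    by (metis ennreal_neq_top infinity_ennreal_def top.extremum_unique)
  then have "AE x in M. (\<Sum>n. ennreal (norm (d n x))) \<noteq> \<infinity>"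
    by (intro nn_integral_PInf_AE) auto
  then show ?thesis
  proof eventually_elim
    case (elim x)
    have "summable (\<lambda>n. norm (d n x))"
      by (rule summable_suminf_not_top) (use elim in auto)
    then have "summable (\<lambda>n. d n x)" by (rule summable_norm_cancel)
    then have "convergent (\<lambda>n. G 0 x + (\<Sum>i<n. d i x))"
      by (intro convergent_add convergent_const) (simp add: summable_iff_convergent)
    moreover have "G 0 x + (\<Sum>i<n. d i x) = G n x" for n
      using sum_lessThan_telescope[of "\<lambda>n. G n x" n] by (simp add: d_def)
    ultimately show ?case by simp
  qed
qed

text \<open>Riesz-Fischer. A fast subsequence has a pointwise limit \<open>f\<close>; Fatou's lemma
  in the second index of the Cauchy condition then bounds \<open>F n - f\<close>, which also shows
  that \<open>f\<close> is square integrable.\<close>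

lemma (in finite_measure) L2_complete:
  fixes F :: "nat \<Rightarrow> 'a \<Rightarrow> 'b::euclidean_space"
  assumes F: "\<And>n. F n \<in> L2 M"
    and C: "\<And>e. 0 < e \<Longrightarrow> \<exists>K. \<forall>m\<ge>K. \<forall>n\<ge>K. L2_norm M (F m - F n) < e"
  shows "\<exists>f\<in>L2 M. (\<lambda>n. L2_norm M (F n - f)) \<longlonglongrightarrow> 0"
proof -
  have "\<exists>K. \<forall>m\<ge>K. \<forall>n\<ge>K. L2_norm M (F m - F n) < (1/2)^k" for k by (rule C) simp
  then obtain K where K: "\<And>k m n. m \<ge> K k \<Longrightarrow> n \<ge> K k \<Longrightarrow> L2_norm M (F m - F n) < (1/2)^k" by metis
  \<comment> \<open>Summing makes \<open>s k\<close> dominate \<open>K i\<close> for every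
    \<open>i \<le> k\<close>, so both indices in a step from \<open>s n\<close> to
    \<open>s (Suc n)\<close> lie beyond \<open>K n\<close>.\<close>
  define s where "s k = sum K {..k}" for k
  have s: "K i \<le> s k" if "i \<le> k" for i k
    unfolding s_def by (rule member_le_sum) (use that in auto)
  have "AE x in M. convergent (\<lambda>n. F (s n) x)"
  proof (rule L2_fast_Cauchy_AE_convergent)
    show "L2_norm M (F (s (Suc n)) - F (s n)) \<le> (1/2)^n" for n
      by (rule less_imp_le, rule K) (auto intro: s)
  qed (rule F)
  define f where "f x = lim (\<lambda>n. F (s n) x)" for x
  have [measurable]: "F n \<in> borel_measurable M" for n using F by (simp add: L2_def)
  have f[measurable]: "f \<in> borel_measurable M" unfolding f_def by (rule borel_measurable_lim_metric) measurable
  have lim: "AE x in M. (\<lambda>n. F (s n) x) \<longlonglongrightarrow> f x"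
    using \<open>AE x in M. convergent _\<close> by eventually_elim (simp add: f_def convergent_LIMSEQ_iff)
  have Fat: "integrable M (\<lambda>x. (norm (F n x - f x))\<^sup>2)" "(LINT x|M. (norm (F n x - f x))\<^sup>2) \<le> ((1/2)^k)\<^sup>2"
    if n: "n \<ge> K k" for n k
  proof -
    have 1: "integrable M (\<lambda>x. (norm (F n x - F (s j) x))\<^sup>2)" for j
      using L2_integrable[OF L2.mem_diff[OF F F], of n "s j"] by simp
    have 2: "AE x in M. (\<lambda>j. (norm (F n x - F (s j) x))\<^sup>2) \<longlonglongrightarrow> (norm (F n x - f x))\<^sup>2"
      using lim by eventually_elim (intro tendsto_intros)
    have 3: "\<forall>\<^sub>F j in sequentially. (LINT x|M. (norm (F n x - F (s j) x))\<^sup>2) \<le> ((1/2)^k)\<^sup>2"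
    proof -
      have "(LINT x|M. (norm (F n x - F (s j) x))\<^sup>2) \<le> ((1/2)^k)\<^sup>2" if "j \<ge> k" for j
        using power_mono[OF less_imp_le[OF K[OF n s[OF that]]], of 2] by (simp add: L2_norm_sq)
      then show ?thesis by (auto simp: eventually_sequentially)
    qed
    show "integrable M (\<lambda>x. (norm (F n x - f x))\<^sup>2)" "(LINT x|M. (norm (F n x - f x))\<^sup>2) \<le> ((1/2)^k)\<^sup>2"
      using Fatou_integral_le[OF 1 _ _ 2 3] by simp_all
  qed
  have "F (K 0) - f \<in> L2 M" using Fat(1)[of 0 "K 0"] by (simp add: L2_def fun_diff_def)
  from L2.mem_diff[OF F this, of "K 0"] have fL: "f \<in> L2 M" by simp
  moreover have "(\<lambda>n. L2_norm M (F n - f)) \<longlonglongrightarrow> 0"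
  proof (rule LIMSEQ_I)
    fix e :: real assume "0 < e"
    then obtain k where k: "(1/2)^k < e" using real_arch_pow_inv[of e "1/2"] by auto
    have "norm (L2_norm M (F n - f) - 0) < e" if "n \<ge> K k" for n
    proof -
      have "L2_norm M (F n - f) \<le> sqrt (((1/2)^k)\<^sup>2)"
        unfolding L2_norm_def using Fat(2)[OF that] by (intro real_sqrt_le_mono) simp
      then show ?thesis using k by simp
    qed
    then show "\<exists>no. \<forall>n\<ge>no. norm (L2_norm M (F n - f) - 0) < e" by blast
  qed
  ultimately show ?thesis by blast
qed

lemma L2_AE_subseq:
  assumes "\<And>n. F n \<in> L2 M" "f \<in> L2 M" "(\<lambda>n. L2_norm M (F n - f)) \<longlonglongrightarrow> 0"
  shows "\<exists>r::nat\<Rightarrow>nat. strict_mono r \<and> (AE x in M. (\<lambda>n. F (r n) x) \<longlonglongrightarrow> f x)"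
proof -
  have "\<exists>r::nat\<Rightarrow>nat. strict_mono r \<and> (AE x in M. (\<lambda>n. (norm (F (r n) x - f x))\<^sup>2) \<longlonglongrightarrow> 0)"
  proof (rule tendsto_L1_AE_subseq)
    show "integrable M (\<lambda>x. (norm (F n x - f x))\<^sup>2)" for n
      using L2_integrable[OF L2.mem_diff[OF assms(1,2)], of n] by simp
    show "(\<lambda>n. LINT x|M. norm ((norm (F n x - f x))\<^sup>2)) \<longlonglongrightarrow> 0"
      using tendsto_power[OF assms(3), of 2] by (simp add: L2_norm_sq)
  qed
  then obtain r :: "nat \<Rightarrow> nat" where r: "strict_mono r"
    and lim: "AE x in M. (\<lambda>n. (norm (F (r n) x - f x))\<^sup>2) \<longlonglongrightarrow> 0" by blast
  have "AE x in M. (\<lambda>n. F (r n) x) \<longlonglongrightarrow> f x"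
    using lim
  proof eventually_elim
    case (elim x)
    from tendsto_real_sqrt[OF this] have "(\<lambda>n. norm (F (r n) x - f x)) \<longlonglongrightarrow> 0" by simp
    then show ?case by (simp add: tendsto_norm_zero_iff LIM_zero_iff)
  qed
  then show ?thesis using r by blast
qed

section \<open>Test functions\<close>

text \<open>The function \<open>exp (-1/t) / t^m\<close>, extended by 0. The power \<open>m\<close>
  is carried along because derivatives remain combinations of members of this family.\<close>

definition flat :: "nat \<Rightarrow> real \<Rightarrow> real" where
  "flat m t = (if t > 0 then exp (- inverse t) * inverse t ^ m else 0)"

lemma flat_at_right_0: "(flat m \<longlongrightarrow> 0) (at_right 0)"
proof -
  have "((\<lambda>t. (inverse t) ^ m / exp (inverse t)) \<longlongrightarrow> (0::real)) (at_right 0)"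
    by (rule filterlim_compose[OF tendsto_power_div_exp_0 filterlim_inverse_at_top_right])
  then show ?thesis
  proof (rule Lim_transform_eventually)
    show "\<forall>\<^sub>F t in at_right 0. (inverse t) ^ m / exp (inverse t) = flat m (t::real)"
      unfolding eventually_at_right_field
      by (intro exI[of _ 1]) (auto simp: flat_def exp_minus field_simps)
  qed
qed

lemma flat_has_derivative:
  "(flat m has_real_derivative (flat (m + 2) t - real m * flat (m + 1) t)) (at t)"
proof -
  consider "t > 0" | "t < 0" | "t = 0" by linarith
  then show ?thesis
  proof cases
    case 1
    have "((\<lambda>t. exp (- inverse t) * inverse t ^ m) has_real_derivative (flat (m + 2) t - real m * flat (m + 1) t)) (at t)"
    proof (rule DERIV_cong)
      show "((\<lambda>t. exp (- inverse t) * inverse t ^ m) has_real_derivative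
          (exp (- inverse t) * (real m * inverse t ^ (m - 1) * - (inverse t * inverse t)) +
           exp (- inverse t) * (inverse t * inverse t) * inverse t ^ m)) (at t)"
        using 1 by (auto intro!: derivative_eq_intros simp: algebra_simps)
      have "real m * inverse t ^ (m - 1) * inverse t = real m * inverse t ^ m"
        by (cases m) auto
      then show "exp (- inverse t) * (real m * inverse t ^ (m - 1) * - (inverse t * inverse t)) +
           exp (- inverse t) * (inverse t * inverse t) * inverse t ^ m = flat (m + 2) t - real m * flat (m + 1) t"
        using 1 by (auto simp add: flat_def power2_eq_square algebra_simps)
    qed
    then show ?thesis
      by (rule has_field_derivative_transform_within_open[of _ _ _ "{0<..}"]) (use 1 in \<open>auto simp: flat_def\<close>)
  next
    case 2
    have "((\<lambda>t. 0) has_real_derivative 0) (at t)" by simp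
    then have "(flat m has_real_derivative 0) (at t)"
      by (rule has_field_derivative_transform_within_open[of _ _ _ "{..<0}"]) (use 2 in \<open>auto simp: flat_def\<close>)
    then show ?thesis using 2 by (simp add: flat_def)
  next
    case 3
    \<comment> \<open>At the origin the right difference quotient of \<open>flat m\<close> is
      \<open>flat (m + 1)\<close> itself, which tends to 0; on the left everything vanishes.\<close>
    have "((\<lambda>t. (flat m t - flat m 0) / (t - 0)) \<longlongrightarrow> 0) (at 0)"
    proof (rule filterlim_split_at)
      have "\<forall>\<^sub>F t in at_left 0. 0 = (flat m t - flat m 0) / (t - 0)"
        unfolding eventually_at_left_field by (intro exI[of _ "-1"]) (auto simp: flat_def)
      then show "((\<lambda>t. (flat m t - flat m 0) / (t - 0)) \<longlongrightarrow> 0) (at_left 0)"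
        by (rule Lim_transform_eventually[OF tendsto_const])
      have "\<forall>\<^sub>F t in at_right 0. flat (m + 1) t = (flat m t - flat m 0) / (t - 0)"
        unfolding eventually_at_right_field by (intro exI[of _ 1]) (auto simp: flat_def divide_inverse)
      then show "((\<lambda>t. (flat m t - flat m 0) / (t - 0)) \<longlongrightarrow> 0) (at_right 0)"
        by (rule Lim_transform_eventually[OF flat_at_right_0])
    qed
    then show ?thesis using 3 by (simp add: has_field_derivative_iff flat_def)
  qed
qed

text \<open>An algebra of functions closed under directional derivatives. Smoothness of all orders
  then follows from one induction on \<open>k\<close> in \<open>flat_algebra_C_k\<close>, with no
  Leibniz formula for higher derivatives.\<close>

inductive_set flat_algebra :: "('a::euclidean_space \<Rightarrow> real) set" where
  const: "(\<lambda>x. c) \<in> flat_algebra"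
| flat: "(\<lambda>x. flat m (x \<bullet> b - l)) \<in> flat_algebra"
| add: "\<lbrakk>f \<in> flat_algebra; g \<in> flat_algebra\<rbrakk> \<Longrightarrow> (\<lambda>x. f x + g x) \<in> flat_algebra"
| mult: "\<lbrakk>f \<in> flat_algebra; g \<in> flat_algebra\<rbrakk> \<Longrightarrow> (\<lambda>x. f x * g x) \<in> flat_algebra"

lemma flat_algebra_derivative:
  assumes "f \<in> flat_algebra"
  shows "\<exists>D. (\<forall>x. (f has_derivative D x) (at x)) \<and> (\<forall>b. (\<lambda>x. D x b) \<in> flat_algebra)"
  using assms
proof induction
  case (const c)
  show ?case
    by (intro exI[of _ "\<lambda>x h. 0"]) (auto intro: flat_algebra.const)
next
  case (flat m b l)
  define D where "D x h = (flat (m + 2) (x \<bullet> b - l) + (- real m) * flat (m + 1) (x \<bullet> b - l)) * (h \<bullet> b)" for x h :: 'a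
  have "((\<lambda>x. flat m (x \<bullet> b - l)) has_derivative D x) (at x)" for x
  proof -
    have "((\<lambda>x. x \<bullet> b - l) has_derivative (\<lambda>h. h \<bullet> b)) (at x)"
      by (auto intro!: derivative_eq_intros)
    from has_derivative_compose[OF this flat_has_derivative[unfolded has_field_derivative_def]]
    show ?thesis by (simp add: D_def[abs_def] mult.commute)
  qed
  moreover have "(\<lambda>x. D x h) \<in> flat_algebra" for h
    unfolding D_def by (intro flat_algebra.intros)
  ultimately show ?case by blast
next
  case (add f g)
  then obtain D E where "\<And>x. (f has_derivative D x) (at x)" "\<And>b. (\<lambda>x. D x b) \<in> flat_algebra"
    "\<And>x. (g has_derivative E x) (at x)" "\<And>b. (\<lambda>x. E x b) \<in> flat_algebra" by metis
  then show ?case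
    by (intro exI[of _ "\<lambda>x h. D x h + E x h"]) (auto intro: has_derivative_add flat_algebra.add)
next
  case (mult f g)
  then obtain D E where "\<And>x. (f has_derivative D x) (at x)" "\<And>b. (\<lambda>x. D x b) \<in> flat_algebra"
    "\<And>x. (g has_derivative E x) (at x)" "\<And>b. (\<lambda>x. E x b) \<in> flat_algebra" by metis
  then show ?case using mult
    by (intro exI[of _ "\<lambda>x h. f x * E x h + D x h * g x"])
      (auto intro!: has_derivative_mult flat_algebra.add flat_algebra.mult)
qed

lemma flat_algebra_C_k: "f \<in> flat_algebra \<Longrightarrow> C_k k f"
proof (induction k arbitrary: f)
  case 0
  from flat_algebra_derivative[OF 0] obtain D where "\<And>x. (f has_derivative D x) (at x)" by blast
  then show ?case by (auto intro: has_derivative_continuous_on)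
next
  case (Suc k)
  from flat_algebra_derivative[OF Suc.prems] obtain D
    where D: "\<And>x. (f has_derivative D x) (at x)" "\<And>b. (\<lambda>x. D x b) \<in> flat_algebra" by blast
  have "frechet_derivative f (at x) = D x" for x using frechet_derivative_at[OF D(1)] by simp
  then show ?case using D Suc.IH by (auto simp: differentiable_def)
qed

lemma flat_algebra_prod:
  assumes "finite I" "\<And>i. i \<in> I \<Longrightarrow> f i \<in> flat_algebra"
  shows "(\<lambda>x. \<Prod>i\<in>I. f i x) \<in> flat_algebra"
  using assms by (induction I rule: finite_induct) (auto intro: flat_algebra.intros)

lemma flat_algebra_power: "f \<in> flat_algebra \<Longrightarrow> (\<lambda>x. f x ^ n) \<in> flat_algebra"
  by (induction n) (auto intro: flat_algebra.intros)

lemma flat_0_bounds: "0 \<le> flat 0 t" "flat 0 t \<le> 1" "flat 0 t > 0 \<longleftrightarrow> t > 0"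
  by (auto simp: flat_def)

lemma flat_0_less_1: "flat 0 t < 1"
  by (auto simp: flat_def)

text \<open>Positive exactly on the open box. The second factor is
  \<open>flat 0 (b \<bullet> i - x \<bullet> i)\<close>, written in the form
  \<open>x \<bullet> c - l\<close> of the generators of \<open>flat_algebra\<close>.\<close>

definition bump :: "'a::euclidean_space \<Rightarrow> 'a \<Rightarrow> 'a \<Rightarrow> real" where
  "bump a b x = (\<Prod>i\<in>Basis. flat 0 (x \<bullet> i - a \<bullet> i) * flat 0 (x \<bullet> (- i) - (- (b \<bullet> i))))"

lemma bump_flat_algebra: "bump a b \<in> flat_algebra"
  unfolding bump_def[abs_def] by (intro flat_algebra_prod flat_algebra.intros) simp

lemma bump_bounds:
  fixes a b x :: "'a::euclidean_space"
  shows "0 \<le> bump a b x" "bump a b x < 1" "x \<in> box a b \<Longrightarrow> 0 < bump a b x" "x \<notin> box a b \<Longrightarrow> bump a b x = 0"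
proof -
  let ?f = "\<lambda>i. flat 0 (x \<bullet> i - a \<bullet> i) * flat 0 (x \<bullet> (- i) - (- (b \<bullet> i)))"
  have f: "0 \<le> ?f i" "?f i < 1" for i
  proof -
    show "0 \<le> ?f i" by (simp add: flat_0_bounds)
    have "?f i \<le> flat 0 (x \<bullet> i - a \<bullet> i) * 1" by (intro mult_left_mono) (auto simp: flat_0_bounds)
    then show "?f i < 1" using flat_0_less_1[of "x \<bullet> i - a \<bullet> i"] by simp
  qed
  show "0 \<le> bump a b x" unfolding bump_def by (intro prod_nonneg) (use f in auto)
  obtain i0 :: 'a where i0: "i0 \<in> Basis" using nonempty_Basis by blast
  have "bump a b x = ?f i0 * (\<Prod>i\<in>Basis - {i0}. ?f i)"
    unfolding bump_def using i0 by (subst prod.remove[of _ i0]) auto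
  also have "\<dots> \<le> ?f i0 * 1"
    by (intro mult_left_mono prod_le_1) (use f less_imp_le in auto)
  finally show "bump a b x < 1" using f(2)[of i0] by simp
  show "0 < bump a b x" if "x \<in> box a b"
    unfolding bump_def using that by (intro prod_pos mult_pos_pos) (auto simp: flat_0_bounds mem_box)
  show "bump a b x = 0" if out: "x \<notin> box a b"
  proof -
    obtain i where i: "i \<in> Basis" "\<not> (a \<bullet> i < x \<bullet> i \<and> x \<bullet> i < b \<bullet> i)"
      using out unfolding mem_box by blast
    then have "x \<bullet> i - a \<bullet> i \<le> 0 \<or> x \<bullet> (- i) - (- (b \<bullet> i)) \<le> 0" by auto
    then have "?f i = 0" by (auto simp: flat_def)
    then show ?thesis unfolding bump_def using i(1) by (intro prod_zero) auto
  qed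
qed

text \<open>Powers of one bump function take the place of mollification; these are the test
  functions on which the fundamental lemma rests.\<close>

lemma test_functions_box_approx:
  fixes a b :: "'a::euclidean_space"
  assumes "cbox a b \<subseteq> \<Omega>"
  obtains \<phi> :: "nat \<Rightarrow> 'a \<Rightarrow> real" where "\<And>n. \<phi> n \<in> test_functions \<Omega>" "\<And>n x. 0 \<le> \<phi> n x \<and> \<phi> n x \<le> indicator (box a b) x"
    "\<And>x. (\<lambda>n. \<phi> n x) \<longlonglongrightarrow> indicator (box a b) x"
proof
  \<comment> \<open>Where \<open>0 < bump < 1\<close> the power of \<open>1 - bump\<close> decays to
    0, and outside the box it stays 1. The odd form uses only the sums and products under which
    \<open>flat_algebra\<close> is closed.\<close>
  define \<phi> where "\<phi> n x = 1 + (-1) * (1 + (-1) * bump a b x) ^ n" for n x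
  have "\<phi> n \<in> flat_algebra" for n
    unfolding \<phi>_def[abs_def] by (intro flat_algebra.add flat_algebra.mult flat_algebra.const flat_algebra_power bump_flat_algebra)
  moreover have "closure {x. \<phi> n x \<noteq> 0} \<subseteq> cbox a b" for n
  proof (rule closure_minimal)
    show "{x. \<phi> n x \<noteq> 0} \<subseteq> cbox a b"
    proof
      fix x assume "x \<in> {x. \<phi> n x \<noteq> 0}"
      then have "bump a b x \<noteq> 0" by (auto simp: \<phi>_def)
      then show "x \<in> cbox a b" using bump_bounds(4)[of x a b] box_subset_cbox[of a b] by blast
    qed
  qed (rule closed_cbox)
  ultimately show "\<phi> n \<in> test_functions \<Omega>" for n
    using assms unfolding test_functions_def
    by (auto intro!: flat_algebra_C_k compact_closure[THEN iffD2] bounded_subset[OF bounded_cbox order_trans[OF closure_subset]])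
  show "0 \<le> \<phi> n x \<and> \<phi> n x \<le> indicator (box a b) x" for n x
    using bump_bounds[where a=a and b=b and x=x] by (cases "x \<in> box a b") (auto simp: \<phi>_def intro!: power_le_one zero_le_power)
  show "(\<lambda>n. \<phi> n x) \<longlonglongrightarrow> indicator (box a b) x" for x
  proof (cases "x \<in> box a b")
    case True
    have "(\<lambda>n. (1 - bump a b x) ^ n) \<longlonglongrightarrow> 0"
      by (rule LIMSEQ_realpow_zero) (use bump_bounds[where a=a and b=b and x=x] True in auto)
    from tendsto_diff[OF tendsto_const this, of 1] show ?thesis using True by (simp add: \<phi>_def)
  qed (simp add: \<phi>_def bump_bounds)
qed

lemma C_k_linear: "\<lbrakk>C_k k f; C_k k g\<rbrakk> \<Longrightarrow> C_k k (\<lambda>x. r * f x + g x)"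
proof (induction k arbitrary: f g)
  case 0
  then show ?case by (auto intro!: continuous_intros)
next
  case (Suc k)
  have f: "(f has_derivative frechet_derivative f (at x)) (at x)" and g: "(g has_derivative frechet_derivative g (at x)) (at x)" for x
    using Suc.prems by (auto simp: frechet_derivative_works[symmetric])
  have D: "((\<lambda>x. r * f x + g x) has_derivative (\<lambda>h. r * frechet_derivative f (at x) h + frechet_derivative g (at x) h)) (at x)" for x
    by (intro has_derivative_add has_derivative_mult_right f g)
  have "frechet_derivative (\<lambda>x. r * f x + g x) (at x) = (\<lambda>h. r * frechet_derivative f (at x) h + frechet_derivative g (at x) h)" for x
    using frechet_derivative_at[OF D] by simp
  then show ?case using D Suc by (auto simp: differentiable_def)
qed

lemma subspace_test_functions: "subspace (test_functions (\<Omega> :: 'a::euclidean_space set))"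
proof -
  have lin: "(\<lambda>x. r * f x + g x) \<in> test_functions \<Omega>" if fg: "f \<in> test_functions \<Omega>" "g \<in> test_functions \<Omega>" for r f g
  proof -
    let ?h = "\<lambda>x. r * f x + g x"
    have "closure {x. ?h x \<noteq> 0} \<subseteq> closure ({x. f x \<noteq> 0} \<union> {x. g x \<noteq> 0})" by (rule closure_mono) auto
    then have sub: "closure {x. ?h x \<noteq> 0} \<subseteq> closure {x. f x \<noteq> 0} \<union> closure {x. g x \<noteq> 0}" by (simp add: closure_Un)
    have "compact (closure {x. f x \<noteq> 0} \<union> closure {x. g x \<noteq> 0})"
      using fg by (auto simp: test_functions_def)
    then have "compact (closure {x. ?h x \<noteq> 0})" using sub
      by (meson bounded_subset closed_closure compact_eq_bounded_closed)
    then show ?thesis using sub fg by (auto simp: test_functions_def intro: C_k_linear)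
  qed
  have "C_k k (\<lambda>x::'a. 0)" for k by (rule flat_algebra_C_k[OF flat_algebra.const])
  then have zero: "(\<lambda>x. 0) \<in> test_functions \<Omega>" by (simp add: test_functions_def)
  show ?thesis
    using lin[of _ _ 1] lin[OF _ zero] zero
    by (auto simp: subspace_def plus_fun_def scaleR_fun_def zero_fun_def)
qed

section \<open>Compactly supported \<open>C\<^sup>1\<close> functions\<close>

text \<open>The class is wider than \<open>test_functions\<close>, because the truncations used for
  the Sobolev inequality are only once differentiable; the gradient is carried as an explicit
  argument.\<close>

definition C1c :: "('a::euclidean_space \<Rightarrow> real) \<Rightarrow> ('a \<Rightarrow> 'a) \<Rightarrow> bool" where
  "C1c v G \<longleftrightarrow> (\<forall>x. (v has_derivative (\<lambda>h. G x \<bullet> h)) (at x)) \<and> continuous_on UNIV G \<and>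
     (\<exists>R. \<forall>x. R < norm x \<longrightarrow> v x = 0)"

definition grad :: "('a::euclidean_space \<Rightarrow> real) \<Rightarrow> 'a \<Rightarrow> 'a" where
  "grad \<phi> x = (\<Sum>b\<in>Basis. frechet_derivative \<phi> (at x) b *\<^sub>R b)"

lemma C1c_derivative: "C1c v G \<Longrightarrow> (v has_derivative (\<lambda>h. G x \<bullet> h)) (at x)"
  by (simp add: C1c_def)

lemma C1c_continuous: "C1c v G \<Longrightarrow> continuous_on UNIV v"
  by (rule has_derivative_continuous_on[of _ _ "\<lambda>x h. G x \<bullet> h"]) (auto simp: C1c_def)

lemma C1c_measurable: 
  assumes "C1c v G" 
  shows "v \<in> borel_measurable borel" "G \<in> borel_measurable borel"
  using C1c_continuous[OF assms] assms by (auto simp: C1c_def intro: borel_measurable_continuous_onI)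

lemma C1c_gradient_zero:
  assumes "C1c v G" "open A" "\<And>x. x \<in> A \<Longrightarrow> v x = 0" "x \<in> A"
  shows "G x = 0"
proof -
  have "((\<lambda>x. 0) has_derivative (\<lambda>h. G x \<bullet> h)) (at x)"
    by (rule has_derivative_transform_within_open[OF C1c_derivative[OF assms(1)] assms(2,4)]) (use assms in auto)
  then have "(\<lambda>h. G x \<bullet> h) = (\<lambda>h. 0)" using has_derivative_unique has_derivative_const by blast
  then have "G x \<bullet> G x = 0" by metis
  then show ?thesis by simp
qed

lemma C1c_bounds:
  assumes "C1c v G"
  obtains R K where "0 < R" "0 \<le> K" "\<And>x. R < norm x \<Longrightarrow> v x = 0" "\<And>x. R < norm x \<Longrightarrow> G x = 0"
    "\<And>x. norm (G x) \<le> K" "\<And>x. \<bar>v x\<bar> \<le> K"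
proof -
  obtain R0 where R0: "\<And>x. R0 < norm x \<Longrightarrow> v x = 0" using assms by (auto simp: C1c_def)
  define R where "R = max 1 R0"
  have R: "0 < R" "\<And>x. R < norm x \<Longrightarrow> v x = 0" using R0 by (auto simp: R_def)
  have "open {x::'a. R < norm x}" by (intro open_Collect_less continuous_intros)
  then have G0: "G x = 0" if "R < norm x" for x
    using C1c_gradient_zero[OF assms, of "{x. R < norm x}"] R that by auto
  have "bounded (G ` cball 0 R)"
    using assms by (intro compact_imp_bounded compact_continuous_image) (auto simp: C1c_def intro: continuous_on_subset)
  moreover have "bounded (v ` cball 0 R)"
    using C1c_continuous[OF assms] by (intro compact_imp_bounded compact_continuous_image) (auto intro: continuous_on_subset)
  ultimately obtain K1 K2 where K: "\<And>x. norm x \<le> R \<Longrightarrow> norm (G x) \<le> K1" "\<And>x. norm x \<le> R \<Longrightarrow> norm (v x) \<le> K2"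
    by (fastforce simp: bounded_iff)
  have 1: "norm (G x) \<le> max 0 (max K1 K2)" for x using K(1)[of x] G0[of x] by (cases "norm x \<le> R") auto
  have 2: "\<bar>v x\<bar> \<le> max 0 (max K1 K2)" for x using K(2)[of x] R(2)[of x] by (cases "norm x \<le> R") auto
  show thesis by (rule that[of R "max 0 (max K1 K2)"]) (use R G0 1 2 in auto)
qed

lemma integrable_indicator_cball:
  "integrable lborel (\<lambda>x. c * indicator (cball (a::'a::euclidean_space) R) x :: real)"
  by (intro integrable_mult_right integrable_real_indicator emeasure_bounded_finite) auto

lemma integrable_bounded_support:
  fixes f :: "'a::euclidean_space \<Rightarrow> 'b::euclidean_space"
  assumes "f \<in> borel_measurable borel" "\<And>x. R < norm x \<Longrightarrow> f x = 0" "\<And>x. norm (f x) \<le> K"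
  shows "integrable lborel f"
proof (rule Bochner_Integration.integrable_bound)
  show "integrable lborel (\<lambda>x. K * indicator (cball 0 R) x :: real)"
    by (rule integrable_indicator_cball)
  have "norm (f x) \<le> norm (K * indicator (cball 0 R) x :: real)" for x
    using assms(2)[of x] assms(3)[of x] by (cases "norm x \<le> R") auto
  then show "AE x in lborel. norm (f x) \<le> norm (K * indicator (cball 0 R) x :: real)" by simp
qed (use assms in simp)

lemma inner_power2_le: "((x::'b::real_inner) \<bullet> h)\<^sup>2 \<le> (norm h)\<^sup>2 * (norm x)\<^sup>2"
  using Cauchy_Schwarz_ineq2[of x h]
  by (simp add: power_mult_distrib[symmetric] mult.commute abs_le_square_iff[symmetric])

lemma C1c_integrable:
  assumes "C1c v G"
  shows "integrable lborel v" "integrable lborel (\<lambda>x. (v x)\<^sup>2)" "integrable lborel G" "integrable lborel (\<lambda>x. (norm (G x))\<^sup>2)"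
    "integrable lborel (\<lambda>x. (G x \<bullet> h)\<^sup>2)"
proof -
  note [measurable] = C1c_measurable[OF assms]
  obtain R K where K: "0 < R" "0 \<le> K" "\<And>x. R < norm x \<Longrightarrow> v x = 0" "\<And>x. R < norm x \<Longrightarrow> G x = 0"
    "\<And>x. norm (G x) \<le> K" "\<And>x. \<bar>v x\<bar> \<le> K" using C1c_bounds[OF assms] by blast
  show "integrable lborel v" "integrable lborel G"
    by (rule integrable_bounded_support[of _ R K]; use K in simp)+
  show "integrable lborel (\<lambda>x. (v x)\<^sup>2)" "integrable lborel (\<lambda>x. (norm (G x))\<^sup>2)"
    by (rule integrable_bounded_support[of _ R "K\<^sup>2"];
        use K in \<open>simp add: power_mono abs_le_square_iff[symmetric]\<close>)+
  show "integrable lborel (\<lambda>x. (G x \<bullet> h)\<^sup>2)"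
  proof (rule Bochner_Integration.integrable_bound)
    show "integrable lborel (\<lambda>x. (norm h)\<^sup>2 * (norm (G x))\<^sup>2)" 
      using \<open>integrable lborel (\<lambda>x. (norm (G x))\<^sup>2)\<close> by simp
    show "AE x in lborel. norm ((G x \<bullet> h)\<^sup>2) \<le> norm ((norm h)\<^sup>2 * (norm (G x))\<^sup>2)"
      by (simp add: inner_power2_le)
  qed measurable
qed

lemma C1c_difference_quotient_bound:
  assumes "C1c v G" "\<And>x. norm (G x) \<le> K"
  shows "\<bar>v (x + h) - v x\<bar> \<le> K * norm h"
proof -
  have "norm (v (x + h) - v x) \<le> K * norm (x + h - x)"
  proof (rule differentiable_bound[of UNIV v "\<lambda>x h. G x \<bullet> h"])
    fix y
    show "onorm ((\<bullet>) (G y)) \<le> K"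
      using assms(2)[of y] Cauchy_Schwarz_ineq2[of "G y"] mult_right_mono[OF assms(2)[of y] norm_ge_zero]
      by (intro onorm_le) (auto intro: order_trans)
  qed (use assms in \<open>auto simp: C1c_def\<close>)
  then show ?thesis by simp
qed

lemma C1c_difference_quotient_tendsto:
  assumes "C1c v G"
  shows "(\<lambda>n. real (Suc n) * (v (x + (1 / real (Suc n)) *\<^sub>R h) - v x)) \<longlonglongrightarrow> G x \<bullet> h"
proof -
  have "((\<lambda>t. v (x + t *\<^sub>R h)) has_derivative (\<lambda>t. G x \<bullet> (t *\<^sub>R h))) (at 0)"
    by (rule has_derivative_compose[of "\<lambda>t. x + t *\<^sub>R h" _ _ _ v])
      (use C1c_derivative[OF assms, of x] in \<open>auto intro!: derivative_eq_intros\<close>)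
  then have "((\<lambda>t. v (x + t *\<^sub>R h)) has_field_derivative (G x \<bullet> h)) (at 0)"
    by (simp add: has_field_derivative_def mult.commute[of "G x \<bullet> h"] mult_commute_abs)
  then have lim: "((\<lambda>t. (v (x + t *\<^sub>R h) - v x) / t) \<longlongrightarrow> G x \<bullet> h) (at 0)"
    by (simp add: has_field_derivative_iff)
  have "filterlim (\<lambda>n. 1 / real (Suc n)) (at 0) sequentially"
    by (rule filterlim_atI[OF LIMSEQ_inverse_real_of_nat[unfolded inverse_eq_divide]]) simp
  from filterlim_compose[OF lim this] show ?thesis by (simp add: field_simps)
qed

lemma lborel_integral_translation:
  fixes f :: "'a::euclidean_space \<Rightarrow> 'b::euclidean_space"
  assumes "f \<in> borel_measurable borel"
  shows "(LINT x|lborel. f (x + h)) = (LINT x|lborel. f x)"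
    "integrable lborel (\<lambda>x. f (x + h)) \<longleftrightarrow> integrable lborel f"
proof -
  have *: "f \<in> borel_measurable (distr lborel borel ((+) h))" using assms by simp
  show "(LINT x|lborel. f (x + h)) = (LINT x|lborel. f x)"
    using integral_distr[of "(+) h" lborel borel f] assms by (simp add: lborel_distr_plus add.commute)
  show "integrable lborel (\<lambda>x. f (x + h)) \<longleftrightarrow> integrable lborel f"
    using integrable_distr_eq[of "(+) h" lborel borel f] assms by (simp add: lborel_distr_plus add.commute)
qed

text \<open>A single integrable majorant for all difference quotients: the steps
  \<open>1 / (n + 1)\<close> are at most 1, so the supports stay in one ball, and the mean value
  bound is uniform. It feeds dominated convergence twice below.\<close>

lemma C1c_difference_quotient_dominated:
  assumes "C1c v G"
  obtains K R where "\<And>n x. \<bar>real (Suc n) * (v (x + (1 / real (Suc n)) *\<^sub>R h) - v x)\<bar> \<le> K * indicator (cball 0 R) x"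
proof -
  obtain R K where K: "0 < R" "0 \<le> K" "\<And>x. R < norm x \<Longrightarrow> v x = 0" "\<And>x. R < norm x \<Longrightarrow> G x = 0"
    "\<And>x. norm (G x) \<le> K" "\<And>x. \<bar>v x\<bar> \<le> K" using C1c_bounds[OF assms] by blast
  show thesis
  proof (rule that[of "K * norm h" "R + norm h"])
    fix n x
    define s where "s = real (Suc n)"
    have s: "1 \<le> s" "0 < s" by (auto simp: s_def)
    show "\<bar>real (Suc n) * (v (x + (1 / real (Suc n)) *\<^sub>R h) - v x)\<bar> \<le> (K * norm h) * indicator (cball 0 (R + norm h)) x"
    proof (cases "norm x \<le> R + norm h")
      case True
      have "s * \<bar>v (x + (1 / s) *\<^sub>R h) - v x\<bar> \<le> s * (K * norm ((1 / s) *\<^sub>R h))"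
        by (intro mult_left_mono C1c_difference_quotient_bound[OF assms K(5)]) (use s in auto)
      also have "\<dots> = K * norm h" using s by simp
      finally show ?thesis unfolding s_def[symmetric] using True s by (simp add: abs_mult)
    next
      case False
      have "norm ((1 / s) *\<^sub>R h) \<le> norm h" using s by (simp add: divide_le_eq mult_le_cancel_left1)
      then have "R < norm (x + (1 / s) *\<^sub>R h)" using False norm_diff_ineq[of x "(1 / s) *\<^sub>R h"] by linarith
      moreover have "R < norm x" using False norm_ge_zero[of h] by linarith
      ultimately show ?thesis unfolding s_def[symmetric] using K(3) False by simp
    qed
  qed
qed

text \<open>By translation invariance every difference quotient has integral 0, and dominated
  convergence carries this to the derivative. It is the source of integration by parts.\<close>

lemma C1c_integral_derivative_zero:
  assumes "C1c v G"
  shows "(LINT x|lborel. G x \<bullet> h) = 0"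
proof -
  note [measurable] = C1c_measurable[OF assms]
  obtain K R where K: "\<And>n x. \<bar>real (Suc n) * (v (x + (1 / real (Suc n)) *\<^sub>R h) - v x)\<bar> \<le> K * indicator (cball 0 R) x"
    using C1c_difference_quotient_dominated[OF assms, of h] by blast
  have "(\<lambda>n. LINT x|lborel. real (Suc n) * (v (x + (1 / real (Suc n)) *\<^sub>R h) - v x)) \<longlonglongrightarrow> (LINT x|lborel. G x \<bullet> h)"
  proof (rule integral_dominated_convergence[where w = "\<lambda>x. K * indicator (cball 0 R) x"])
    show "integrable lborel (\<lambda>x. K * indicator (cball 0 R) x :: real)"
      by (rule integrable_indicator_cball)
  qed (use K C1c_difference_quotient_tendsto[OF assms] in auto)
  moreover have "(LINT x|lborel. real (Suc n) * (v (x + (1 / real (Suc n)) *\<^sub>R h) - v x)) = 0" for n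
    using C1c_integrable(1)[OF assms] by (simp add: lborel_integral_translation)
  ultimately have "(\<lambda>n::nat. 0) \<longlonglongrightarrow> (LINT x|lborel. G x \<bullet> h)" by (simp only:)
  then show ?thesis by (simp add: LIMSEQ_const_iff)
qed

text \<open>The shift by \<open>h\<close> is split into \<open>n + 1\<close> shifts by
  \<open>h / (n + 1)\<close>. Cauchy-Schwarz for the telescoping sum costs a factor
  \<open>n + 1\<close>, translation invariance makes the summands equal, and together they give the
  integral of the squared difference quotient, which converges to that of
  \<open>(G x \<bullet> h)^2\<close>.\<close>

lemma C1c_translation:
  assumes "C1c v G"
  shows "integrable lborel (\<lambda>x. (v (x + h) - v x)\<^sup>2)"
    "(LINT x|lborel. (v (x + h) - v x)\<^sup>2) \<le> (norm h)\<^sup>2 * (LINT x|lborel. (norm (G x))\<^sup>2)"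
proof -
  note [measurable] = C1c_measurable[OF assms]
  note int = C1c_integrable[OF assms]
  have intd: "integrable lborel (\<lambda>x. (v (x + h) - v x)\<^sup>2)" for h
  proof (rule Bochner_Integration.integrable_bound)
    show "integrable lborel (\<lambda>x. 2 * (v (x + h))\<^sup>2 + 2 * (v x)\<^sup>2)"
      using int(2) lborel_integral_translation(2)[of "\<lambda>x. (v x)\<^sup>2" h] by simp
    show "AE x in lborel. norm ((v (x + h) - v x)\<^sup>2) \<le> norm (2 * (v (x + h))\<^sup>2 + 2 * (v x)\<^sup>2)"
      using norm_add_power2_le[of "v (_ + h)" "- v _"] by (auto intro!: AE_I2)
  qed measurable
  then show "integrable lborel (\<lambda>x. (v (x + h) - v x)\<^sup>2)" .
  have step: "(LINT x|lborel. (v (x + h) - v x)\<^sup>2)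
      \<le> (LINT x|lborel. (real (Suc n) * (v (x + (1 / real (Suc n)) *\<^sub>R h) - v x))\<^sup>2)" for n
  proof -
    define s where "s = real (Suc n)"
    have s: "s > 0" by (simp add: s_def)
    define k where "k = (1 / s) *\<^sub>R h"
    define d where "d i x = v (x + real (Suc i) *\<^sub>R k) - v (x + real i *\<^sub>R k)" for i x
    have d_eq: "d i x = (\<lambda>y. v (y + k) - v y) (x + real i *\<^sub>R k)" for i x
      by (simp add: d_def algebra_simps)
    have "real (Suc n) *\<^sub>R k = h" using s unfolding s_def[symmetric] by (simp add: k_def)
    then have tel: "v (x + h) - v x = (\<Sum>i<Suc n. d i x)" for x
      using sum_lessThan_telescope[of "\<lambda>i. v (x + real i *\<^sub>R k)" "Suc n"]
      by (simp add: d_def del: of_nat_Suc sum.lessThan_Suc)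
    have "(v (x + h) - v x)\<^sup>2 \<le> s * (\<Sum>i<Suc n. (d i x)\<^sup>2)" for x
      using Cauchy_Schwarz_ineq_sum[of "\<lambda>_. 1" "\<lambda>i. d i x" "{..<Suc n}"] unfolding tel
      by (simp add: s_def)
    moreover have intdi: "integrable lborel (\<lambda>x. (d i x)\<^sup>2)" for i
      unfolding d_eq using lborel_integral_translation(2)[of "\<lambda>x. (v (x + k) - v x)\<^sup>2" "real i *\<^sub>R k"] intd[of k] by simp
    ultimately have "(LINT x|lborel. (v (x + h) - v x)\<^sup>2) \<le> (LINT x|lborel. s * (\<Sum>i<Suc n. (d i x)\<^sup>2))"
      using intd by (intro integral_mono integrable_mult_right integrable_sum) auto
    also have "\<dots> = s * (\<Sum>i<Suc n. LINT x|lborel. (d i x)\<^sup>2)"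
      using intdi by (simp del: sum.lessThan_Suc)
    also have "\<dots> = s * (\<Sum>i<Suc n. LINT x|lborel. (v (x + k) - v x)\<^sup>2)"
      unfolding d_eq using lborel_integral_translation(1)[of "\<lambda>x. (v (x + k) - v x)\<^sup>2"] by simp
    also have "\<dots> = s\<^sup>2 * (LINT x|lborel. (v (x + k) - v x)\<^sup>2)"
      by (simp add: s_def power2_eq_square algebra_simps)
    also have "\<dots> = (LINT x|lborel. (s * (v (x + k) - v x))\<^sup>2)"
      by (simp add: power_mult_distrib)
    finally show ?thesis by (simp add: k_def s_def)
  qed
  obtain K R where K: "\<And>n x. \<bar>real (Suc n) * (v (x + (1 / real (Suc n)) *\<^sub>R h) - v x)\<bar> \<le> K * indicator (cball 0 R) x"
    using C1c_difference_quotient_dominated[OF assms, of h] by blast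
  have "(\<lambda>n. LINT x|lborel. (real (Suc n) * (v (x + (1 / real (Suc n)) *\<^sub>R h) - v x))\<^sup>2) \<longlonglongrightarrow> (LINT x|lborel. (G x \<bullet> h)\<^sup>2)"
  proof (rule integral_dominated_convergence[where w = "\<lambda>x. K\<^sup>2 * indicator (cball 0 R) x"])
    show "integrable lborel (\<lambda>x. K\<^sup>2 * indicator (cball 0 R) x :: real)"
      by (rule integrable_indicator_cball)
    show "AE x in lborel. norm ((real (Suc n) * (v (x + (1 / real (Suc n)) *\<^sub>R h) - v x))\<^sup>2) \<le> K\<^sup>2 * indicator (cball 0 R) x" for n
    proof (rule AE_I2)
      fix x
      have "\<bar>real (Suc n) * (v (x + (1 / real (Suc n)) *\<^sub>R h) - v x)\<bar>\<^sup>2 \<le> (K * indicator (cball 0 R) x)\<^sup>2"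
        by (intro power_mono K) simp
      also have "\<dots> = K\<^sup>2 * indicator (cball 0 R) x" by (simp add: indicator_def)
      finally show "norm ((real (Suc n) * (v (x + (1 / real (Suc n)) *\<^sub>R h) - v x))\<^sup>2) \<le> K\<^sup>2 * indicator (cball 0 R) x" 
        by (simp only: power2_abs real_norm_def abs_power2)
    qed
  qed (use C1c_difference_quotient_tendsto[OF assms] in \<open>auto intro!: tendsto_power\<close>)
  then have "(LINT x|lborel. (v (x + h) - v x)\<^sup>2) \<le> (LINT x|lborel. (G x \<bullet> h)\<^sup>2)"
    by (rule LIMSEQ_le_const) (use step in blast)
  also have "\<dots> \<le> (LINT x|lborel. (norm h)\<^sup>2 * (norm (G x))\<^sup>2)"
    using int by (intro integral_mono) (auto simp: inner_power2_le)
  finally show "(LINT x|lborel. (v (x + h) - v x)\<^sup>2) \<le> (norm h)\<^sup>2 * (LINT x|lborel. (norm (G x))\<^sup>2)" by simp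
qed

lemma C1c_mult:
  assumes "C1c u F" "C1c v G"
  shows "C1c (\<lambda>x. u x * v x) (\<lambda>x. u x *\<^sub>R G x + v x *\<^sub>R F x)"
  unfolding C1c_def
proof (intro conjI allI)
  fix x
  have "((\<lambda>x. u x * v x) has_derivative (\<lambda>h. u x * (G x \<bullet> h) + (F x \<bullet> h) * v x)) (at x)"
    by (rule has_derivative_mult) (use assms in \<open>auto simp: C1c_def\<close>)
  then show "((\<lambda>x. u x * v x) has_derivative (\<bullet>) (u x *\<^sub>R G x + v x *\<^sub>R F x)) (at x)"
    by (rule has_derivative_eq_rhs) (simp add: inner_add_left fun_eq_iff)
  show "continuous_on UNIV (\<lambda>x. u x *\<^sub>R G x + v x *\<^sub>R F x)"
    using assms by (intro continuous_intros) (auto simp: C1c_def intro: C1c_continuous[OF assms(1)] C1c_continuous[OF assms(2)])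
  show "\<exists>R. \<forall>x. R < norm x \<longrightarrow> u x * v x = 0" using assms by (fastforce simp: C1c_def)
qed

lemma C1c_integration_by_parts:
  assumes "C1c u F" "C1c v G"
  shows "(LINT x|lborel. u x * (G x \<bullet> b)) = - (LINT x|lborel. (F x \<bullet> b) * v x)"
proof -
  note [measurable] = C1c_measurable[OF assms(1)] C1c_measurable[OF assms(2)]
  have L: "u \<in> L2 lborel" "v \<in> L2 lborel" "(\<lambda>x. F x \<bullet> b) \<in> L2 lborel" "(\<lambda>x. G x \<bullet> b) \<in> L2 lborel"
    using C1c_integrable[OF assms(1)] C1c_integrable[OF assms(2)] by (auto simp: L2_def)
  have "0 = (LINT x|lborel. (u x *\<^sub>R G x + v x *\<^sub>R F x) \<bullet> b)"
    using C1c_integral_derivative_zero[OF C1c_mult[OF assms]] by simp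
  also have "\<dots> = (LINT x|lborel. u x * (G x \<bullet> b) + (F x \<bullet> b) * v x)"
    by (simp add: inner_add_left mult.commute)
  also have "\<dots> = (LINT x|lborel. u x * (G x \<bullet> b)) + (LINT x|lborel. (F x \<bullet> b) * v x)"
    using L2_mult_integrable[OF L(1,4)] L2_mult_integrable[OF L(3,2)] by simp
  finally show ?thesis by simp
qed

lemma test_C1c:
  assumes "\<phi> \<in> test_functions \<Omega>"
  shows "C1c \<phi> (grad \<phi>)"
proof -
  have C: "C_k 1 \<phi>" and cpt: "compact (closure {x. \<phi> x \<noteq> 0})" using assms by (auto simp: test_functions_def)
  have D: "(\<phi> has_derivative frechet_derivative \<phi> (at x)) (at x)" for x
    using C by (simp add: frechet_derivative_works[symmetric])
  have "frechet_derivative \<phi> (at x) h = grad \<phi> x \<bullet> h" for x h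
  proof -
    interpret linear "frechet_derivative \<phi> (at x)" using D has_derivative_linear by blast
    have "frechet_derivative \<phi> (at x) h = frechet_derivative \<phi> (at x) (\<Sum>b\<in>Basis. (h \<bullet> b) *\<^sub>R b)"
      by (simp add: euclidean_representation)
    also have "\<dots> = grad \<phi> x \<bullet> h"
      by (simp add: sum scale grad_def inner_sum_left mult.commute) (simp add: inner_commute)
    finally show ?thesis .
  qed
  then have "frechet_derivative \<phi> (at x) = (\<lambda>h. grad \<phi> x \<bullet> h)" for x by (rule ext)
  then have "(\<phi> has_derivative (\<lambda>h. grad \<phi> x \<bullet> h)) (at x)" for x using D[of x] by simp
  moreover have "continuous_on UNIV (grad \<phi>)"
    unfolding grad_def[abs_def] using C by (intro continuous_intros) auto
  moreover obtain R where "\<And>x. \<phi> x \<noteq> 0 \<Longrightarrow> norm x \<le> R"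
    using bounded_subset[OF compact_imp_bounded[OF cpt] closure_subset] by (auto simp: bounded_iff)
  ultimately show ?thesis unfolding C1c_def by (metis not_less)
qed

lemma test_frechet:
  assumes "\<phi> \<in> test_functions \<Omega>"
  shows "frechet_derivative \<phi> (at x) h = grad \<phi> x \<bullet> h"
  using frechet_derivative_at[OF C1c_derivative[OF test_C1c[OF assms]], of x] by metis

lemma test_zero_outside:
  assumes "\<phi> \<in> test_functions \<Omega>" "x \<notin> \<Omega>"
  shows "\<phi> x = 0" "grad \<phi> x = 0"
proof -
  have x: "x \<notin> closure {x. \<phi> x \<noteq> 0}" using assms by (auto simp: test_functions_def)
  then show "\<phi> x = 0" using closure_subset[of "{x. \<phi> x \<noteq> 0}"] by blast
  show "grad \<phi> x = 0"
    by (rule C1c_gradient_zero[OF test_C1c[OF assms(1)], of "- closure {x. \<phi> x \<noteq> 0}"])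
      (use x closure_subset[of "{x. \<phi> x \<noteq> 0}"] in auto)
qed

section \<open>The fundamental lemma and weak gradients\<close>

locale bounded_domain =
  fixes \<Omega> :: "'a::euclidean_space set"
  assumes open_dom: "open \<Omega>" and bounded_dom: "bounded \<Omega>" and nonempty_dom: "\<Omega> \<noteq> {}"
begin

abbreviation "M \<equiv> restrict_space lborel \<Omega>"

lemma dom_sets: "\<Omega> \<in> sets borel" "\<Omega> \<inter> space lborel \<in> sets lborel"
  using open_dom by auto

lemma finite_M: "finite_measure M"
  by (intro finite_measureI)
    (use dom_sets emeasure_bounded_finite[OF bounded_dom] in \<open>simp add: emeasure_restrict_space space_restrict_space\<close>)

sublocale M: finite_measure M by (rule finite_M)

lemma space_M: "space M = \<Omega>"
  by (simp add: space_restrict_space)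

lemma borel_measurable_M: "f \<in> borel_measurable borel \<Longrightarrow> f \<in> borel_measurable M"
  by (intro measurable_restrict_space1) simp

lemma set_integral_M:
  fixes f :: "'a \<Rightarrow> 'b::euclidean_space"
  shows "(LINT x:\<Omega>|lborel. f x) = (LINT x|M. f x)"
  by (simp add: set_lebesgue_integral_def integral_restrict_space[OF dom_sets(2)])

lemma square_integrable_iff_L2: "square_integrable \<Omega> f \<longleftrightarrow> f \<in> L2 M"
  unfolding square_integrable_def L2_def set_integrable_def set_borel_measurable_def
  by (simp add: integrable_restrict_space[OF dom_sets(2)] borel_measurable_restrict_space_iff[OF dom_sets(2)])

lemma test_M:
  assumes "\<phi> \<in> test_functions \<Omega>"
  shows "\<phi> \<in> L2 M" "grad \<phi> \<in> L2 M" "(\<lambda>x. grad \<phi> x \<bullet> b) \<in> L2 M" "(\<lambda>x. \<phi> x *\<^sub>R b) \<in> L2 M"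
    "L2_norm M (grad \<phi>) = L2_norm lborel (grad \<phi>)" "L2_norm M \<phi> = L2_norm lborel \<phi>"
proof -
  note C = test_C1c[OF assms]
  have ind: "indicator \<Omega> x * (norm (grad \<phi> x))\<^sup>2 = (norm (grad \<phi> x))\<^sup>2"
    "indicator \<Omega> x * (\<phi> x)\<^sup>2 = (\<phi> x)\<^sup>2" for x
    using test_zero_outside[OF assms, of x] by (auto simp: indicator_def)
  note meas = borel_measurable_M[OF C1c_measurable(1)[OF C]] borel_measurable_M[OF C1c_measurable(2)[OF C]]
  note int = C1c_integrable(2,4)[OF C]
  show 1: "\<phi> \<in> L2 M" "grad \<phi> \<in> L2 M"
    using meas int by (simp_all add: L2_def integrable_restrict_space[OF dom_sets(2)] ind)
  note [measurable] = meas
  show "(\<lambda>x. grad \<phi> x \<bullet> b) \<in> L2 M"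
  proof -
    have "integrable M (\<lambda>x. (grad \<phi> x \<bullet> b)\<^sup>2)"
    proof (rule Bochner_Integration.integrable_bound)
      show "integrable M (\<lambda>x. (norm b)\<^sup>2 * (norm (grad \<phi> x))\<^sup>2)" using 1 by (simp add: L2_def)
    qed (auto simp: inner_power2_le)
    then show ?thesis by (simp add: L2_def)
  qed
  show "(\<lambda>x. \<phi> x *\<^sub>R b) \<in> L2 M" using 1(1) by (simp add: L2_def power_mult_distrib)
  show "L2_norm M (grad \<phi>) = L2_norm lborel (grad \<phi>)" "L2_norm M \<phi> = L2_norm lborel \<phi>"
    by (simp_all add: L2_norm_def integral_restrict_space[OF dom_sets(2)] ind)
qed

lemma has_weak_gradient_iff:
  "has_weak_gradient \<Omega> u g \<longleftrightarrow> u \<in> L2 M \<and> g \<in> L2 M \<and>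
    (\<forall>\<phi>\<in>test_functions \<Omega>. \<forall>b\<in>Basis. L2_inner M u (\<lambda>x. grad \<phi> x \<bullet> b) = - L2_inner M g (\<lambda>x. \<phi> x *\<^sub>R b))"
proof -
  have "((LINT x:\<Omega>|lborel. u x * frechet_derivative \<phi> (at x) b) = - (LINT x:\<Omega>|lborel. (g x \<bullet> b) * \<phi> x))
      \<longleftrightarrow> (L2_inner M u (\<lambda>x. grad \<phi> x \<bullet> b) = - L2_inner M g (\<lambda>x. \<phi> x *\<^sub>R b))" 
    if "\<phi> \<in> test_functions \<Omega>" for \<phi> b
    unfolding set_integral_M L2_inner_def test_frechet[OF that] by (simp add: mult.commute)
  then show ?thesis unfolding has_weak_gradient_def square_integrable_iff_L2 by blast
qed

lemma integral_box_zero: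
  fixes f :: "'a \<Rightarrow> real"
  assumes f: "integrable M f" and zero: "\<And>\<phi>. \<phi> \<in> test_functions \<Omega> \<Longrightarrow> (LINT x|M. f x * \<phi> x) = 0"
    and sub: "cbox a b \<subseteq> \<Omega>"
  shows "(LINT x|M. f x * indicator (box a b) x) = 0"
proof -
  obtain \<phi> :: "nat \<Rightarrow> 'a \<Rightarrow> real" where \<phi>: "\<And>n. \<phi> n \<in> test_functions \<Omega>"
    "\<And>n x. 0 \<le> \<phi> n x \<and> \<phi> n x \<le> indicator (box a b) x" "\<And>x. (\<lambda>n. \<phi> n x) \<longlonglongrightarrow> indicator (box a b) x"
    using test_functions_box_approx[OF sub] by metis
  have [measurable]: "f \<in> borel_measurable M" "\<phi> n \<in> borel_measurable M" "indicator (box a b) \<in> borel_measurable M" for n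
    using f test_M(1)[OF \<phi>(1)] by (auto simp: L2_def intro!: borel_measurable_M)
  have "(\<lambda>n. LINT x|M. f x * \<phi> n x) \<longlonglongrightarrow> (LINT x|M. f x * indicator (box a b) x)"
  proof (rule integral_dominated_convergence[where w = "\<lambda>x. norm (f x)"])
    show "AE x in M. norm (f x * \<phi> n x) \<le> norm (f x)" for n
    proof (rule AE_I2)
      fix x
      have "\<bar>\<phi> n x\<bar> \<le> 1" using \<phi>(2)[of n x] by (cases "x \<in> box a b") auto
      then show "norm (f x * \<phi> n x) \<le> norm (f x)" by (simp add: abs_mult mult_left_le)
    qed
  qed (use f \<phi>(3) in \<open>auto intro!: tendsto_mult\<close>)
  then show ?thesis using zero[OF \<phi>(1)] by (simp add: LIMSEQ_const_iff)
qed

text \<open>Restricted to the box, the positive and negative parts of \<open>f\<close> are densities of finite measures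
  that agree on all boxes and therefore coincide.\<close>

lemma AE_zero_on_box:
  fixes f :: "'a \<Rightarrow> real"
  assumes f: "integrable M f" and zero: "\<And>\<phi>. \<phi> \<in> test_functions \<Omega> \<Longrightarrow> (LINT x|M. f x * \<phi> x) = 0"
    and sub: "cbox c d \<subseteq> \<Omega>"
  shows "AE x in lborel. x \<in> cbox c d \<longrightarrow> f x = 0"
proof -
  define F where "F x = indicator (box c d) x * f x" for x
  have Feq: "F x = indicator (box c d) x * (indicator \<Omega> x *\<^sub>R f x)" for x
    using sub box_subset_cbox[of c d] by (auto simp: F_def indicator_def)
  have f': "integrable lborel (\<lambda>x. indicator \<Omega> x *\<^sub>R f x)" using f by (simp add: integrable_restrict_space[OF dom_sets(2)])
  have F: "integrable lborel F"
    using integrable_mult_indicator[OF _ f', of "box c d"] by (simp add: Feq[abs_def])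
  then have [measurable]: "F \<in> borel_measurable borel" by simp
  \<comment> \<open>Boxes are closed under intersection, so an arbitrary box is reduced to one
    inside \<open>box c d\<close>, whose closure lies in \<Omega>; an empty intersection is set
    apart because \<open>closure_box\<close> is about nonempty boxes.\<close>
  have boxF: "(LINT x|lborel. F x * indicator (box a b) x) = 0" for a b
  proof -
    have "\<exists>a' b'. box a b \<inter> box c d = box a' b'" unfolding box_Int_box by blast
    then obtain a' b' where ab: "box a b \<inter> box c d = box a' b'" by blast
    have "(LINT x|M. f x * indicator (box a' b') x) = 0"
    proof (cases "box a' b' = {}")
      case False
      have "closure (box a' b') \<subseteq> closure (box c d)" using ab by (intro closure_mono) auto
      then have "cbox a' b' \<subseteq> cbox c d"
        using False ab by (metis closure_box inf_bot_right)
      then show ?thesis using integral_box_zero[OF f zero] sub by blast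
    qed simp
    also have "(LINT x|M. f x * indicator (box a' b') x) = (LINT x|lborel. indicator \<Omega> x *\<^sub>R (f x * indicator (box a' b') x))"
      by (rule integral_restrict_space[OF dom_sets(2)])
    also have "\<dots> = (LINT x|lborel. F x * indicator (box a b) x)"
      unfolding ab[symmetric] Feq by (intro Bochner_Integration.integral_cong) (auto simp: indicator_def)
    finally show ?thesis .
  qed
  let ?P = "\<lambda>x. ennreal (F x)" and ?N = "\<lambda>x. ennreal (- F x)"
  have eq: "emeasure (density lborel ?P) (box a b) = emeasure (density lborel ?N) (box a b)"
    and fin: "emeasure (density lborel ?P) (box a b) \<noteq> \<infinity>" for a b
  proof -
    have intb: "integrable lborel (\<lambda>x. F x * indicator (box a b) x)"
      using integrable_mult_indicator[OF _ F, of "box a b"] by (simp add: mult.commute)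
    have 1: "emeasure (density lborel ?P) (box a b) = (\<integral>\<^sup>+x. ennreal (F x * indicator (box a b) x) \<partial>lborel)"
      by (subst emeasure_density) (auto intro!: nn_integral_cong simp: indicator_def)
    have 2: "emeasure (density lborel ?N) (box a b) = (\<integral>\<^sup>+x. ennreal (- (F x * indicator (box a b) x)) \<partial>lborel)"
      by (subst emeasure_density) (auto intro!: nn_integral_cong simp: indicator_def)
    let ?A = "\<integral>\<^sup>+x. ennreal (F x * indicator (box a b) x) \<partial>lborel"
    let ?B = "\<integral>\<^sup>+x. ennreal (- (F x * indicator (box a b) x)) \<partial>lborel"
    have AB: "?A \<noteq> \<infinity>" "?B \<noteq> \<infinity>" using intb unfolding real_integrable_def by auto
    have "enn2real ?A = enn2real ?B" using boxF[of a b] unfolding real_lebesgue_integral_def[OF intb] by simp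
    moreover have fixA: "ennreal (enn2real ?A) = ?A" "ennreal (enn2real ?B) = ?B"
      by (rule ennreal_enn2real, use AB in \<open>simp only: infinity_ennreal_def less_top\<close>)+
    ultimately have "ennreal (enn2real ?A) = ennreal (enn2real ?B)" by (intro arg_cong[where f = ennreal])
    then have "?A = ?B" unfolding fixA .
    then show "emeasure (density lborel ?P) (box a b) = emeasure (density lborel ?N) (box a b)"
      "emeasure (density lborel ?P) (box a b) \<noteq> \<infinity>"
      using AB 1 2 by simp_all
  qed
  have "density lborel ?P = density lborel ?N"
  proof (rule measure_eqI_generator_eq)
    let ?E = "range (\<lambda>(a, b). box a b::'a set)"
    let ?A = "\<lambda>n::nat. box (- (real n *\<^sub>R One)) (real n *\<^sub>R One) :: 'a set"
    show "Int_stable ?E" by (auto simp: Int_stable_def box_Int_box)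
    show "?E \<subseteq> Pow UNIV" "sets (density lborel ?P) = sigma_sets UNIV ?E" "sets (density lborel ?N) = sigma_sets UNIV ?E"
      by (simp_all add: borel_eq_box)
    show "range ?A \<subseteq> ?E" "(\<Union>i. ?A i) = UNIV" unfolding UN_box_eq_UNIV by auto
  qed (use eq fin in auto)
  then have "AE x in lborel. ?P x = ?N x"
    by (intro sigma_finite_measure.density_unique[OF sigma_finite_lborel]) auto
  then have "AE x in lborel. F x = 0"
  proof eventually_elim
    case (elim x)
    then show ?case by (cases "0 \<le> F x") (auto simp: ennreal_neg ennreal_eq_0_iff)
  qed
  moreover have "AE x in lborel. x \<notin> cbox c d - box c d"
  proof (rule AE_not_in, rule null_setsI)
    have "emeasure lborel (cbox c d - box c d) = emeasure lborel (cbox c d) - emeasure lborel (box c d)"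
      by (rule emeasure_Diff) (use box_subset_cbox[of c d] emeasure_bounded_finite[OF bounded_box, of c d] in auto)
    also have "\<dots> = 0" by (simp add: emeasure_lborel_cbox_eq emeasure_lborel_box_eq)
    finally show "emeasure lborel (cbox c d - box c d) = 0" .
  qed simp
  ultimately show ?thesis by eventually_elim (auto simp: F_def)
qed

text \<open>An open set is a countable union of closed boxes, so the statement on one box
  suffices.\<close>

lemma fundamental_lemma:
  fixes f :: "'a \<Rightarrow> real"
  assumes f: "integrable M f" and zero: "\<And>\<phi>. \<phi> \<in> test_functions \<Omega> \<Longrightarrow> (LINT x|M. f x * \<phi> x) = 0"
  shows "AE x in M. f x = 0"
proof -
  obtain D where D: "countable D" "D \<subseteq> Pow \<Omega>" "\<And>X. X \<in> D \<Longrightarrow> \<exists>a b. X = cbox a b" "\<Union> D = \<Omega>"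
    using open_countable_Union_open_cbox[OF open_dom] by metis
  have "AE x in lborel. x \<in> X \<longrightarrow> f x = 0" if X: "X \<in> D" for X
  proof -
    obtain a b where "X = cbox a b" using D(3)[OF X] by blast
    then show ?thesis using AE_zero_on_box[OF f zero, of a b] X D(2) by blast
  qed
  then have "AE x in lborel. \<forall>X\<in>D. x \<in> X \<longrightarrow> f x = 0" by (subst AE_ball_countable[OF D(1)]) auto
  then have "AE x in lborel. x \<in> \<Omega> \<longrightarrow> f x = 0" by eventually_elim (use D(4) in blast)
  then show ?thesis by (simp add: AE_restrict_space_iff[OF dom_sets(2)])
qed

text \<open>This makes the choice in \<open>weak_gradient\<close> harmless: norms and inner products
  may be computed with any weak gradient at hand.\<close>

lemma has_weak_gradient_unique:
  assumes "has_weak_gradient \<Omega> u g" "has_weak_gradient \<Omega> u g'"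
  shows "AE x in M. g x = g' x"
proof -
  have L: "g \<in> L2 M" "g' \<in> L2 M" using assms by (auto simp: has_weak_gradient_iff)
  define w where "w = g - g'"
  have w: "w \<in> L2 M" using L unfolding w_def by (intro L2.mems)
  have "AE x in M. w x \<bullet> b = 0" if b: "b \<in> Basis" for b
  proof (rule fundamental_lemma)
    show "integrable M (\<lambda>x. w x \<bullet> b)" using M.L2_integral_norm_le(1)[OF w] by simp
    fix \<phi> assume \<phi>: "\<phi> \<in> test_functions \<Omega>"
    have "L2_inner M w (\<lambda>x. \<phi> x *\<^sub>R b) = L2_inner M g (\<lambda>x. \<phi> x *\<^sub>R b) - L2_inner M g' (\<lambda>x. \<phi> x *\<^sub>R b)"
      unfolding w_def by (rule L2.diff_left[OF L test_M(4)[OF \<phi>]])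
    also have "\<dots> = 0" using assms \<phi> b unfolding has_weak_gradient_iff by force
    finally show "(LINT x|M. (w x \<bullet> b) * \<phi> x) = 0" by (simp add: L2_inner_def mult.commute)
  qed
  then have "AE x in M. \<forall>b\<in>Basis. w x \<bullet> b = 0" by (simp add: AE_finite_all)
  then show ?thesis
  proof eventually_elim
    case (elim x)
    then have "w x = 0" by (simp add: euclidean_all_zero_iff)
    then show ?case by (simp add: w_def)
  qed
qed

lemma has_weak_gradient_weak_gradient: "u \<in> H1 \<Omega> \<Longrightarrow> has_weak_gradient \<Omega> u (weak_gradient \<Omega> u)"
  by (auto simp: some_eq_ex weak_gradient_def H1_def)

lemma weak_gradient_AE_eq: "has_weak_gradient \<Omega> u g \<Longrightarrow> AE x in M. weak_gradient \<Omega> u x = g x"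
  by (rule has_weak_gradient_unique[OF has_weak_gradient_weak_gradient]) (auto simp: H1_def)

lemma H1_L2: "u \<in> H1 \<Omega> \<Longrightarrow> u \<in> L2 M"
  and weak_gradient_L2: "u \<in> H1 \<Omega> \<Longrightarrow> weak_gradient \<Omega> u \<in> L2 M"
  using has_weak_gradient_weak_gradient by (auto simp: has_weak_gradient_iff)

lemma has_weak_gradient_add:
  assumes "has_weak_gradient \<Omega> u g" "has_weak_gradient \<Omega> v h"
  shows "has_weak_gradient \<Omega> (u + v) (g + h)"
  using assms by (auto simp: has_weak_gradient_iff L2.bilin test_M)

lemma has_weak_gradient_scale:
  assumes "has_weak_gradient \<Omega> u g"
  shows "has_weak_gradient \<Omega> (r *\<^sub>R u) (r *\<^sub>R g)"
  using assms by (auto simp: has_weak_gradient_iff L2.bilin test_M)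

lemma has_weak_gradient_diff:
  assumes "has_weak_gradient \<Omega> u g" "has_weak_gradient \<Omega> v h"
  shows "has_weak_gradient \<Omega> (u - v) (g - h)"
  using has_weak_gradient_add[OF assms(1) has_weak_gradient_scale[OF assms(2), of "-1"]] by simp

lemma has_weak_gradient_test:
  assumes \<phi>: "\<phi> \<in> test_functions \<Omega>"
  shows "has_weak_gradient \<Omega> \<phi> (grad \<phi>)"
proof -
  have "L2_inner M \<phi> (\<lambda>x. grad \<psi> x \<bullet> b) = - L2_inner M (grad \<phi>) (\<lambda>x. \<psi> x *\<^sub>R b)"
    if \<psi>: "\<psi> \<in> test_functions \<Omega>" for \<psi> b
  proof -
    have "L2_inner M \<phi> (\<lambda>x. grad \<psi> x \<bullet> b) = (LINT x|lborel. \<phi> x * (grad \<psi> x \<bullet> b))"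
      unfolding L2_inner_def integral_restrict_space[OF dom_sets(2)]
      by (intro Bochner_Integration.integral_cong) (use test_zero_outside[OF \<phi>] in \<open>auto simp: indicator_def\<close>)
    also have "\<dots> = - (LINT x|lborel. (grad \<phi> x \<bullet> b) * \<psi> x)"
      by (rule C1c_integration_by_parts) (use \<phi> \<psi> test_C1c in auto)
    also have "(LINT x|lborel. (grad \<phi> x \<bullet> b) * \<psi> x) = L2_inner M (grad \<phi>) (\<lambda>x. \<psi> x *\<^sub>R b)"
      unfolding L2_inner_def integral_restrict_space[OF dom_sets(2)]
      by (intro Bochner_Integration.integral_cong) (use test_zero_outside[OF \<phi>] in \<open>auto simp: indicator_def\<close>)
    finally show ?thesis .
  qed
  then show ?thesis by (simp add: has_weak_gradient_iff test_M[OF \<phi>])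
qed

text \<open>The weak gradient is a closed operator, since both sides of its defining identity are
  L2-continuous. The completeness of \<open>H01\<close> rests on this.\<close>

lemma has_weak_gradient_limit:
  assumes U: "\<And>n. has_weak_gradient \<Omega> (U n) (G n)" and u: "u \<in> L2 M" "g \<in> L2 M"
    and lim: "(\<lambda>n. L2_norm M (U n - u)) \<longlonglongrightarrow> 0" "(\<lambda>n. L2_norm M (G n - g)) \<longlonglongrightarrow> 0"
  shows "has_weak_gradient \<Omega> u g"
proof -
  have UL: "U n \<in> L2 M" "G n \<in> L2 M" for n using U[of n] by (auto simp: has_weak_gradient_iff)
  have "L2_inner M u (\<lambda>x. grad \<phi> x \<bullet> b) = - L2_inner M g (\<lambda>x. \<phi> x *\<^sub>R b)"
    if \<phi>: "\<phi> \<in> test_functions \<Omega>" and b: "b \<in> Basis" for \<phi> b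
  proof (rule LIMSEQ_unique)
    show "(\<lambda>n. L2_inner M (U n) (\<lambda>x. grad \<phi> x \<bullet> b)) \<longlonglongrightarrow> L2_inner M u (\<lambda>x. grad \<phi> x \<bullet> b)"
      by (rule L2.B_LIMSEQ[OF UL(1) u(1) lim(1) test_M(3)[OF \<phi>]])
    have "(\<lambda>n. - L2_inner M (G n) (\<lambda>x. \<phi> x *\<^sub>R b)) \<longlonglongrightarrow> - L2_inner M g (\<lambda>x. \<phi> x *\<^sub>R b)"
      by (intro tendsto_minus L2.B_LIMSEQ[OF UL(2) u(2) lim(2) test_M(4)[OF \<phi>]])
    then show "(\<lambda>n. L2_inner M (U n) (\<lambda>x. grad \<phi> x \<bullet> b)) \<longlonglongrightarrow> - L2_inner M g (\<lambda>x. \<phi> x *\<^sub>R b)"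
      using U \<phi> b unfolding has_weak_gradient_iff by simp
  qed
  then show ?thesis using u by (auto simp: has_weak_gradient_iff)
qed

end

section \<open>The Sobolev inequality\<close>

lemma max_0_power2_derivative: "((\<lambda>t. (max 0 t)\<^sup>2) has_real_derivative 2 * max 0 t) (at t)"
proof -
  consider "t > 0" | "t < 0" | "t = 0" by linarith
  then show ?thesis
  proof cases
    case 1
    have "((\<lambda>t. t\<^sup>2) has_real_derivative 2 * max 0 t) (at t)"
      using 1 by (auto intro!: derivative_eq_intros)
    then show ?thesis
      by (rule has_field_derivative_transform_within_open[of _ _ _ "{0<..}"]) (use 1 in auto)
  next
    case 2
    have "((\<lambda>t. 0) has_real_derivative 2 * max 0 t) (at t)" using 2 by simp
    then show ?thesis
      by (rule has_field_derivative_transform_within_open[of _ _ _ "{..<0}"]) (use 2 in auto)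
  next
    case 3
    have "((\<lambda>h. ((max 0 (0 + h))\<^sup>2 - (max 0 0)\<^sup>2) / h) \<longlongrightarrow> 0) (at (0::real))"
    proof (rule Lim_null_comparison)
      show "\<forall>\<^sub>F h in at (0::real). norm (((max 0 (0 + h))\<^sup>2 - (max 0 0)\<^sup>2) / h) \<le> \<bar>h\<bar>"
        by (intro always_eventually) (auto simp: max_def power2_eq_square abs_mult)
      show "((\<lambda>h::real. \<bar>h\<bar>) \<longlongrightarrow> 0) (at 0)" by (intro tendsto_rabs_zero tendsto_ident_at)
    qed
    then show ?thesis using 3 by (simp add: DERIV_def)
  qed
qed

text \<open>A once differentiable, piecewise quadratic step from 0 at \<open>t = 0\<close> to 1 at
  \<open>t = 1\<close>; its derivative is the tent with peak 2 at \<open>1/2\<close>.\<close>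

definition step :: "real \<Rightarrow> real" where
  "step t = 2 * (max 0 t)\<^sup>2 - 4 * (max 0 (t - 1/2))\<^sup>2 + 2 * (max 0 (t - 1))\<^sup>2"

definition step' :: "real \<Rightarrow> real" where
  "step' t = 4 * max 0 t - 8 * max 0 (t - 1/2) + 4 * max 0 (t - 1)"

lemma step_derivative: "(step has_real_derivative step' t) (at t)"
proof -
  have shift: "((\<lambda>t. (max 0 (t - c))\<^sup>2) has_real_derivative 2 * max 0 (t - c)) (at t)" for c :: real
  proof -
    have "((\<lambda>t. t - c) has_real_derivative 1) (at t)" by (auto intro!: derivative_eq_intros)
    from DERIV_chain2[OF max_0_power2_derivative this] show ?thesis by simp
  qed
  show ?thesis
    unfolding step_def[abs_def]
    by (rule DERIV_cong, (rule DERIV_add DERIV_diff DERIV_cmult shift max_0_power2_derivative)+) (simp add: step'_def)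
qed

lemma step_values:
  "t \<le> 0 \<Longrightarrow> step t = 0" "1 \<le> t \<Longrightarrow> step t = 1"
  "t \<le> 0 \<Longrightarrow> step' t = 0" "1 \<le> t \<Longrightarrow> step' t = 0" "\<bar>step' t\<bar> \<le> 2"
  by (auto simp: step_def step'_def max_def power2_eq_square algebra_simps abs_if)

lemma C1c_truncation:
  fixes u :: "'a::euclidean_space \<Rightarrow> real"
  assumes u: "C1c u G" and t: "0 < t"
  obtains w H where "C1c w H" "\<And>x. \<bar>u x\<bar> \<le> t \<Longrightarrow> w x = 0" "\<And>x. 2 * t \<le> \<bar>u x\<bar> \<Longrightarrow> w x = 1"
    "\<And>x. (norm (H x))\<^sup>2 \<le> 9 / t\<^sup>2 * (indicator {x. t < \<bar>u x\<bar> \<and> \<bar>u x\<bar> < 2 * t} x * (norm (G x))\<^sup>2)"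
proof
  \<comment> \<open>Working with the square of \<open>u\<close> keeps \<open>z\<close>
    differentiable where \<open>u\<close> changes sign. The denominator \<open>3 * t\<^sup>2\<close>
    is the gap between the squares of \<open>2 t\<close> and \<open>t\<close>, so \<open>z\<close>
    runs from 0 to 1 between these levels.\<close>
  define z where "z x = ((u x)\<^sup>2 - t\<^sup>2) / (3 * t\<^sup>2)" for x
  define w where "w x = step (z x)" for x
  define H where "H x = (step' (z x) * (2 * u x / (3 * t\<^sup>2))) *\<^sub>R G x" for x
  have z_le: "z x \<le> 0 \<longleftrightarrow> \<bar>u x\<bar> \<le> t" for x
    using t power2_le_iff_abs_le[of t "u x"] by (simp add: z_def divide_le_0_iff)
  have z_ge: "1 \<le> z x \<longleftrightarrow> 2 * t \<le> \<bar>u x\<bar>" for x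
    using t abs_le_square_iff[of "2 * t" "u x"] by (simp add: z_def field_simps power_mult_distrib)
  show w0: "w x = 0" if "\<bar>u x\<bar> \<le> t" for x using that z_le[of x] by (simp add: w_def step_values)
  show "w x = 1" if "2 * t \<le> \<bar>u x\<bar>" for x using that z_ge[of x] by (simp add: w_def step_values)
  have cu: "continuous_on UNIV u" by (rule C1c_continuous[OF u])
  show "C1c w H"
    unfolding C1c_def
  proof (intro conjI allI)
    fix x
    have "((\<lambda>x. u x * u x) has_derivative (\<lambda>h. u x * (G x \<bullet> h) + (G x \<bullet> h) * u x)) (at x)"
      by (intro has_derivative_mult C1c_derivative[OF u])
    then have "((\<lambda>x. (u x * u x - t\<^sup>2) * (1 / (3 * t\<^sup>2))) has_derivative 
        (\<lambda>h. (u x * (G x \<bullet> h) + (G x \<bullet> h) * u x - 0) * (1 / (3 * t\<^sup>2)))) (at x)"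
      by (intro has_derivative_mult_left has_derivative_diff has_derivative_const)
    then have "(z has_derivative (\<lambda>h. (u x * (G x \<bullet> h) + (G x \<bullet> h) * u x - 0) * (1 / (3 * t\<^sup>2)))) (at x)"
      by (simp add: z_def[abs_def] power2_eq_square)
    from has_derivative_compose[OF this step_derivative[unfolded has_field_derivative_def]]
    show "(w has_derivative (\<lambda>h. H x \<bullet> h)) (at x)"
      unfolding w_def[abs_def]
      by (rule has_derivative_eq_rhs) (auto simp: H_def fun_eq_iff)
    have "continuous_on UNIV step'" unfolding step'_def[abs_def] by (intro continuous_intros)
    moreover have "continuous_on UNIV z"
      unfolding z_def[abs_def] using t by (intro continuous_intros cu) auto
    ultimately have "continuous_on UNIV (\<lambda>x. step' (z x))" by (rule continuous_on_compose2) auto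
    then show "continuous_on UNIV H"
      unfolding H_def[abs_def] using t u by (intro continuous_intros cu) (auto simp: C1c_def)
    obtain R where "\<And>x. R < norm x \<Longrightarrow> u x = 0" using u by (auto simp: C1c_def)
    then show "\<exists>R. \<forall>x. R < norm x \<longrightarrow> w x = 0" using w0 t by (intro exI[of _ R]) auto
  qed
  show "(norm (H x))\<^sup>2 \<le> 9 / t\<^sup>2 * (indicator {x. t < \<bar>u x\<bar> \<and> \<bar>u x\<bar> < 2 * t} x * (norm (G x))\<^sup>2)" for x
  proof (cases "t < \<bar>u x\<bar> \<and> \<bar>u x\<bar> < 2 * t")
    case True
    have "\<bar>step' (z x) * (2 * u x / (3 * t\<^sup>2))\<bar> = \<bar>step' (z x)\<bar> * (2 * \<bar>u x\<bar> / (3 * t\<^sup>2))"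
      by (simp add: abs_mult)
    also have "\<dots> \<le> 2 * (2 * (2 * t) / (3 * t\<^sup>2))"
      using True step_values(5)[of "z x"] t by (intro mult_mono divide_right_mono) auto
    \<comment> \<open>The left side is \<open>8 / (3 t)\<close>; rounded up to \<open>3 / t\<close>,
      it squares to the constant \<open>9 / t\<^sup>2\<close>.\<close>
    also have "\<dots> \<le> 3 / t" using t by (simp add: field_simps power2_eq_square)
    finally have "\<bar>step' (z x) * (2 * u x / (3 * t\<^sup>2))\<bar> * norm (G x) \<le> 3 / t * norm (G x)"
      by (rule mult_right_mono) simp
    then have "norm (H x) \<le> 3 / t * norm (G x)" by (simp add: H_def)
    then have "(norm (H x))\<^sup>2 \<le> (3 / t * norm (G x))\<^sup>2" by (intro power_mono) auto
    then show ?thesis using True by (simp add: power_mult_distrib power_divide)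
  next
    case False
    then have "step' (z x) = 0" using z_le[of x] z_ge[of x] step_values(3,4)[of "z x"] by linarith
    then show ?thesis by (simp add: H_def)
  qed
qed

lemma C1c_support_fmeasurable:
  assumes "C1c w H"
  shows "{x. w x \<noteq> 0} \<in> fmeasurable lborel" "{x. w x = 1} \<in> fmeasurable lborel"
proof -
  have [measurable]: "w \<in> borel_measurable borel" by (rule C1c_measurable[OF assms])
  obtain R where R: "\<And>x. R < norm x \<Longrightarrow> w x = 0" using assms by (auto simp: C1c_def)
  have sub: "{x. w x \<noteq> 0} \<subseteq> cball 0 R" using R by force
  then have sub: "{x. w x \<noteq> 0} \<subseteq> cball 0 R" "{x. w x = 1} \<subseteq> cball 0 R" by auto
  have "{x. w x \<noteq> 0} \<in> sets borel" "{x. w x = 1} \<in> sets borel" by measurable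
  then show "{x. w x \<noteq> 0} \<in> fmeasurable lborel" "{x. w x = 1} \<in> fmeasurable lborel"
    using emeasure_bounded_finite[OF bounded_subset[OF bounded_cball sub(1)]]
      emeasure_bounded_finite[OF bounded_subset[OF bounded_cball sub(2)]]
    by (auto intro!: fmeasurableI)
qed

text \<open>For a point where \<open>w = 1\<close>, at least half of the translates by vectors of the ball
  leave the support of \<open>w\<close>; average the translation estimate over the ball.\<close>

lemma C1c_capacity_estimate:
  fixes w :: "'a::euclidean_space \<Rightarrow> real"
  assumes w: "C1c w H" and r: "0 \<le> r"
    and ball: "2 * measure lborel {x. w x \<noteq> 0} \<le> measure lborel (ball (0::'a) r)"
  shows "measure lborel {x. w x = 1} \<le> 2 * r\<^sup>2 * (LINT x|lborel. (norm (H x))\<^sup>2)"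
proof -
  note wm[measurable] = C1c_measurable[OF w]
  define P where "P = {x. w x = 1}"
  define Z where "Z = {x. w x \<noteq> 0}"
  define A where "A = ball (0::'a) r"
  define \<beta> where "\<beta> = measure lborel A"
  define E where "E = (LINT x|lborel. (norm (H x))\<^sup>2)"
  have PZ: "P \<in> fmeasurable lborel" "Z \<in> fmeasurable lborel"
    using C1c_support_fmeasurable[OF w] by (auto simp: P_def Z_def)
  then have [measurable]: "P \<in> sets borel" "Z \<in> sets borel" by (auto simp: fmeasurable_def)
  have A: "A \<in> fmeasurable lborel" by (auto simp: A_def intro!: fmeasurableI emeasure_bounded_finite)
  then have [measurable]: "A \<in> sets borel" by (auto simp: fmeasurable_def)
  have E: "0 \<le> E" by (simp add: E_def)
  have Z\<beta>: "2 * measure lborel Z \<le> \<beta>" using ball by (simp only: Z_def \<beta>_def A_def)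
  show ?thesis
  \<comment> \<open>A ball of measure zero (\<open>r = 0\<close>) forces the support of
    \<open>w\<close> to be null and the estimate is trivial; otherwise \<open>\<beta>\<close> can be
    cancelled at the end.\<close>
  proof (cases "\<beta> = 0")
    case True
    then have "measure lborel Z \<le> 0" using Z\<beta> by simp
    moreover have "measure lborel P \<le> measure lborel Z"
      by (rule measure_mono_fmeasurable) (use PZ in \<open>auto simp: P_def Z_def\<close>)
    ultimately have "measure lborel P \<le> 0" by linarith
    also have "0 \<le> 2 * r\<^sup>2 * E" using E by simp
    finally show ?thesis by (simp only: P_def E_def)
  next
    case False
    then have \<beta>: "0 < \<beta>" by (simp add: \<beta>_def zero_less_measure_iff)
    \<comment> \<open>The double integral of \<open>f\<close> is estimated from below by integrating
      over \<open>h\<close> first and from above by integrating over \<open>x\<close> first.\<close>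
    define f where "f x h = ennreal (indicator A h * (w (x + h) - w x)\<^sup>2)" for x h
    have fm[measurable]: "(\<lambda>(x, h). f x h) \<in> borel_measurable (lborel \<Otimes>\<^sub>M lborel)"
      unfolding f_def by measurable
    have low: "ennreal (\<beta> / 2) * indicator P x \<le> (\<integral>\<^sup>+h. f x h \<partial>lborel)" for x
    proof (cases "x \<in> P")
      case True
      define Y where "Y = {h. x + h \<in> Z}"
      have [measurable]: "Y \<in> sets borel" unfolding Y_def by measurable
      have "emeasure lborel Y = emeasure (distr lborel borel ((+) x)) Z"
        by (subst emeasure_distr) (auto simp: Y_def vimage_def)
      then have "emeasure lborel Y = emeasure lborel Z" by (simp add: lborel_distr_plus)
      then have Y: "Y \<in> fmeasurable lborel" "measure lborel Y = measure lborel Z"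
        using PZ(2) by (auto simp: fmeasurable_def measure_def)
      have "\<beta> \<le> measure lborel ((A - Y) \<union> Y)"
        unfolding \<beta>_def by (rule measure_mono_fmeasurable) (use A Y in \<open>auto intro!: fmeasurable.Un fmeasurable_Diff\<close>)
      also have "\<dots> \<le> measure lborel (A - Y) + measure lborel Y"
        by (rule measure_Un_le) (use A Y in auto)
      finally have "\<beta> / 2 \<le> measure lborel (A - Y)" using Z\<beta> Y(2) by linarith
      then have "ennreal (\<beta> / 2) \<le> ennreal (measure lborel (A - Y))" by (rule ennreal_leI)
      also have "\<dots> = emeasure lborel (A - Y)"
        using A Y by (intro emeasure_eq_measure2[symmetric]) (auto intro: fmeasurable_Diff)
      also have "\<dots> = (\<integral>\<^sup>+h. indicator (A - Y) h \<partial>lborel)" by simp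
      also have "\<dots> \<le> (\<integral>\<^sup>+h. f x h \<partial>lborel)"
        using True by (intro nn_integral_mono) (auto simp: f_def Y_def Z_def P_def indicator_def)
      finally show ?thesis using True by simp
    qed simp
    have up: "(\<integral>\<^sup>+x. f x h \<partial>lborel) \<le> ennreal (r\<^sup>2 * E) * indicator A h" for h
    proof (cases "h \<in> A")
      case True
      then have "norm h \<le> r" by (simp add: A_def)
      have "(\<integral>\<^sup>+x. f x h \<partial>lborel) = ennreal (LINT x|lborel. (w (x + h) - w x)\<^sup>2)"
        using True by (simp add: f_def nn_integral_eq_integral C1c_translation[OF w])
      also have "\<dots> \<le> ennreal ((norm h)\<^sup>2 * E)"
        unfolding E_def by (intro ennreal_leI C1c_translation[OF w])
      also have "\<dots> \<le> ennreal (r\<^sup>2 * E)"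
        using \<open>norm h \<le> r\<close> E by (intro ennreal_leI mult_right_mono power_mono) auto
      finally show ?thesis using True by simp
    qed (simp add: f_def)
    have "ennreal (\<beta> / 2 * measure lborel P) = (\<integral>\<^sup>+x. ennreal (\<beta> / 2) * indicator P x \<partial>lborel)"
      using PZ(1) \<beta> by (simp add: nn_integral_cmult emeasure_eq_measure2 flip: ennreal_mult)
    also have "\<dots> \<le> (\<integral>\<^sup>+x. \<integral>\<^sup>+h. f x h \<partial>lborel \<partial>lborel)" by (intro nn_integral_mono low)
    also have "\<dots> = (\<integral>\<^sup>+h. \<integral>\<^sup>+x. f x h \<partial>lborel \<partial>lborel)" by (rule lborel_pair.Fubini'[symmetric]) (rule fm)
    also have "\<dots> \<le> (\<integral>\<^sup>+h. ennreal (r\<^sup>2 * E) * indicator A h \<partial>lborel)" by (intro nn_integral_mono up)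
    also have "\<dots> = ennreal (r\<^sup>2 * E * \<beta>)"
      using A E by (simp add: nn_integral_cmult emeasure_eq_measure2 ennreal_mult \<beta>_def)
    finally have "\<beta> / 2 * measure lborel P \<le> r\<^sup>2 * E * \<beta>" using E \<beta> by (subst (asm) ennreal_le_iff) auto
    then have "\<beta> * measure lborel P \<le> \<beta> * (2 * r\<^sup>2 * E)" by (simp add: algebra_simps)
    then show ?thesis using \<beta> by (simp add: P_def E_def)
  qed
qed

text \<open>Dyadic layer cake: if \<open>y\<close> exceeds \<open>\<delta>\<close>, let
  \<open>n\<close> be the largest level with \<open>\<delta> * 2^n < y\<close>; then
  \<open>y \<le> 2 * \<delta> * 2^n\<close>, so that single summand already dominates.\<close>

lemma powr_le_dyadic_sum:
  fixes y \<delta> p :: real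
  assumes "0 \<le> y" "0 < \<delta>" "0 \<le> p" "y \<le> \<delta> * 2 ^ m"
  shows "y powr p \<le> \<delta> powr p + (\<Sum>n<m. (2 * (\<delta> * 2 ^ n)) powr p * indicator {\<delta> * 2 ^ n <..} y)"
  using assms(4)
proof (induction m)
  case 0
  then show ?case using assms by (simp add: powr_mono2)
next
  case (Suc m)
  show ?case
  proof (cases "y \<le> \<delta> * 2 ^ m")
    case True
    then show ?thesis using Suc.IH by (simp add: add_increasing2)
  next
    case False
    have "y powr p \<le> (2 * (\<delta> * 2 ^ m)) powr p" using Suc.prems assms by (intro powr_mono2) (auto simp: mult_ac)
    moreover have "0 \<le> (\<Sum>n<m. (2 * (\<delta> * 2 ^ n)) powr p * indicator {\<delta> * 2 ^ n <..} y)"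
      by (intro sum_nonneg) simp
    moreover have "(2 * (\<delta> * 2 ^ m)) powr p * indicator {\<delta> * 2 ^ m <..} y = (2 * (\<delta> * 2 ^ m)) powr p"
      using False by simp
    ultimately show ?thesis using powr_ge_zero[of \<delta> p] unfolding sum.lessThan_Suc by linarith
  qed
qed

text \<open>The dyadic shells are disjoint, so the energies that the truncations at different levels
  pick up sum to at most the whole energy.\<close>

lemma sum_dyadic_indicator_le:
  fixes y \<delta> :: real
  assumes "0 < \<delta>"
  shows "(\<Sum>n<m. indicator {\<delta> * 2 ^ n <..< 2 * (\<delta> * 2 ^ n)} y) \<le> (indicator {..<\<delta> * 2 ^ m} y :: real)"
proof (induction m)
  case (Suc m)
  have "indicator {..<\<delta> * 2 ^ m} y + indicator {\<delta> * 2 ^ m <..< 2 * (\<delta> * 2 ^ m)} y \<le> (indicator {..<\<delta> * 2 ^ Suc m} y :: real)"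
    using assms by (auto simp: indicator_def intro: less_le_trans)
  then show ?case using Suc by simp
qed simp

text \<open>Either \<open>b\<close> accounts for half of \<open>B\<close>, or
  \<open>B \<le> 2 * K * B powr \<theta>\<close> and the sublinear power can be divided out.\<close>

lemma absorb_powr:
  fixes B b K \<theta> :: real
  assumes "0 \<le> B" "0 \<le> b" "0 \<le> K" "0 < \<theta>" "\<theta> < 1" "B \<le> b + K * B powr \<theta>"
  shows "B \<le> 2 * b + (2 * K) powr (1 / (1 - \<theta>))"
proof (cases "B \<le> 2 * b")
  case True
  then show ?thesis using powr_ge_zero[of "2 * K" "1 / (1 - \<theta>)"] by linarith
next
  case False
  then have B: "0 < B" "B \<le> 2 * K * B powr \<theta>" using assms by auto
  have "B powr (1 - \<theta>) = B / B powr \<theta>" using B(1) by (simp add: powr_diff)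
  also have "\<dots> \<le> 2 * K" using B by (simp add: divide_le_eq)
  finally have "(B powr (1 - \<theta>)) powr (1 / (1 - \<theta>)) \<le> (2 * K) powr (1 / (1 - \<theta>))"
    using assms by (intro powr_mono2) auto
  then show ?thesis using assms B(1) by (simp add: powr_powr)
qed

text \<open>The factor \<open>2 powr p * 18 * (2 / unit_ball_vol N) powr (2 / N)\<close> is the
  constant of \<open>C1c_level_decay\<close>; the outer \<open>2 powr p\<close> comes from doubling
  the level in the dyadic sum, and the power \<open>p / 2\<close> from absorption. Far from sharp,
  it yields integrability and \<open>0 < S\<close>.\<close>

definition sobolev_const_bound :: "'a::euclidean_space itself \<Rightarrow> real" where
  "sobolev_const_bound _ = (let p = critical_exponent TYPE('a) in 
     2 powr p * (2 * (2 powr p * 18 * (2 / unit_ball_vol (real DIM('a))) powr (2 / real DIM('a)))) powr (p / 2))"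

text \<open>The capacity estimate is applied to the truncation between \<open>t\<close> and
  \<open>2 t\<close>, with a ball of volume exactly \<open>2 a\<close>, so that
  \<open>r\<^sup>2\<close> is a multiple of \<open>a powr \<theta>\<close>; 18 is the factor 2 there
  times the 9 of the truncation. The critical exponent is the one with
  \<open>p * \<theta> = p - 2\<close>, which turns \<open>t powr p / t\<^sup>2\<close> into
  \<open>(t powr p) powr \<theta>\<close> and makes the recursion scale invariant.\<close>

lemma C1c_level_decay:
  fixes u :: "'a::euclidean_space \<Rightarrow> real"
  assumes u: "C1c u G" and t: "0 < t" and N: "2 < DIM('a)"
  defines "p \<equiv> critical_exponent TYPE('a)" and "\<theta> \<equiv> 2 / real DIM('a)"
  shows "(2 * t) powr p * measure lborel {x. 2 * t < \<bar>u x\<bar>} \<le>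
    (2 powr p * 18 * (2 / unit_ball_vol (real DIM('a))) powr \<theta>) * (t powr p * measure lborel {x. t < \<bar>u x\<bar>}) powr \<theta> *
      (LINT x|lborel. indicator {x. t < \<bar>u x\<bar> \<and> \<bar>u x\<bar> < 2 * t} x * (norm (G x))\<^sup>2)" (is "_ \<le> ?K * _ * ?D")
proof -
  note [measurable] = C1c_measurable[OF u]
  define \<omega> where "\<omega> = unit_ball_vol (real DIM('a))"
  have \<omega>: "0 < \<omega>" by (simp add: \<omega>_def)
  define a where "a = measure lborel {x. t < \<bar>u x\<bar>}"
  have a: "0 \<le> a" by (simp add: a_def)
  obtain w H where w: "C1c w H" "\<And>x. \<bar>u x\<bar> \<le> t \<Longrightarrow> w x = 0" "\<And>x. 2 * t \<le> \<bar>u x\<bar> \<Longrightarrow> w x = 1"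
    "\<And>x. (norm (H x))\<^sup>2 \<le> 9 / t\<^sup>2 * (indicator {x. t < \<bar>u x\<bar> \<and> \<bar>u x\<bar> < 2 * t} x * (norm (G x))\<^sup>2)"
    using C1c_truncation[OF u t] by blast
  define r where "r = root DIM('a) (2 * a / \<omega>)"
  have r: "0 \<le> r" "r ^ DIM('a) = 2 * a / \<omega>" using a \<omega> by (auto simp: r_def real_root_pow_pos2)
  have r2: "r\<^sup>2 = (2 / \<omega>) powr \<theta> * a powr \<theta>"
  proof (cases "a = 0")
    case False
    then have "0 < 2 * a / \<omega>" using a \<omega> by simp
    then have "r = (2 * a / \<omega>) powr (1 / DIM('a))" by (simp add: r_def root_powr_inverse)
    then have "r\<^sup>2 = (2 * a / \<omega>) powr \<theta>" using \<open>0 < 2 * a / \<omega>\<close>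
      by (simp add: powr_powr \<theta>_def flip: powr_numeral)
    then show ?thesis using a \<omega> powr_mult[of "2 / \<omega>" a \<theta>] by (simp add: mult.commute)
  qed (simp add: r_def)
  have fm: "{x. t < \<bar>u x\<bar>} \<in> fmeasurable lborel"
  proof (rule fmeasurableI2[OF C1c_support_fmeasurable(1)[OF u]])
    show "{x. t < \<bar>u x\<bar>} \<subseteq> {x. u x \<noteq> 0}" using t by auto
    show "{x. t < \<bar>u x\<bar>} \<in> sets lborel" by simp
  qed
  have "measure lborel {x. w x \<noteq> 0} \<le> a"
    unfolding a_def
  proof (rule measure_mono_fmeasurable[OF _ _ fm])
    show "{x. w x \<noteq> 0} \<subseteq> {x. t < \<bar>u x\<bar>}" using w(2) by force
    show "{x. w x \<noteq> 0} \<in> sets lborel" using C1c_support_fmeasurable(1)[OF w(1)] by auto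
  qed
  moreover have "measure lborel (ball (0::'a) r) = 2 * a"
    unfolding content_ball[OF r(1)] r(2) \<omega>_def[symmetric] using \<omega> by simp
  ultimately have "measure lborel {x. w x = 1} \<le> 2 * r\<^sup>2 * (LINT x|lborel. (norm (H x))\<^sup>2)"
    by (intro C1c_capacity_estimate[OF w(1) r(1)]) simp
  moreover have "measure lborel {x. 2 * t < \<bar>u x\<bar>} \<le> measure lborel {x. w x = 1}"
  proof (rule measure_mono_fmeasurable[OF _ _ C1c_support_fmeasurable(2)[OF w(1)]])
    show "{x. 2 * t < \<bar>u x\<bar>} \<subseteq> {x. w x = 1}" using w(3) by force
    show "{x. 2 * t < \<bar>u x\<bar>} \<in> sets lborel" by simp
  qed
  moreover have "(LINT x|lborel. (norm (H x))\<^sup>2) \<le> 9 / t\<^sup>2 * ?D"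
  proof -
    have "integrable lborel (\<lambda>x. indicator {x. t < \<bar>u x\<bar> \<and> \<bar>u x\<bar> < 2 * t} x * (norm (G x))\<^sup>2)"
      using integrable_mult_indicator[OF _ C1c_integrable(4)[OF u], of "{x. t < \<bar>u x\<bar> \<and> \<bar>u x\<bar> < 2 * t}"] by simp
    then have "(LINT x|lborel. (norm (H x))\<^sup>2) \<le> (LINT x|lborel. 9 / t\<^sup>2 * (indicator {x. t < \<bar>u x\<bar> \<and> \<bar>u x\<bar> < 2 * t} x * (norm (G x))\<^sup>2))"
      by (intro integral_mono C1c_integrable(4)[OF w(1)] integrable_mult_right w(4))
    then show ?thesis by simp
  qed
  ultimately have "measure lborel {x. 2 * t < \<bar>u x\<bar>} \<le> 2 * r\<^sup>2 * (9 / t\<^sup>2 * ?D)"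
    by (meson mult_left_mono order_trans zero_le_mult_iff zero_le_numeral zero_le_power2)
  then have "(2 * t) powr p * measure lborel {x. 2 * t < \<bar>u x\<bar>} \<le> (2 * t) powr p * (2 * r\<^sup>2 * (9 / t\<^sup>2 * ?D))"
    by (rule mult_left_mono) simp
  also have "\<dots> = 2 powr p * 18 * (2 / \<omega>) powr \<theta> * ((t powr p / t\<^sup>2) * a powr \<theta>) * ?D"
    using t by (simp add: powr_mult r2)
  also have "t powr p / t\<^sup>2 = (t powr p) powr \<theta>"
  proof -
    have "p * \<theta> = p - 2" using N by (simp add: p_def \<theta>_def critical_exponent_def field_simps)
    then show ?thesis using t by (simp add: powr_powr powr_diff flip: powr_numeral)
  qed
  also have "(t powr p) powr \<theta> * a powr \<theta> = (t powr p * a) powr \<theta>" using a by (simp add: powr_mult)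
  finally show ?thesis by (simp add: a_def \<omega>_def)
qed

text \<open>For the weighted distribution \<open>b n\<close> at the level \<open>t n\<close> the
  decay reads \<open>b (Suc n) \<le> K * b n powr \<theta> * D n\<close>, with shell energies
  \<open>D n\<close> of sum at most \<open>E\<close>. Hence the sum \<open>B\<close> of the
  \<open>b n\<close> satisfies \<open>B \<le> b 0 + K * E * B powr \<theta>\<close>, which
  \<open>absorb_powr\<close> solves since \<open>p / 2 = 1 / (1 - \<theta>)\<close>. Boundedness of
  \<open>u\<close> keeps the number of levels finite.\<close>

lemma sobolev_C1c:
  fixes u :: "'a::euclidean_space \<Rightarrow> real"
  assumes u: "C1c u G" and N: "2 < DIM('a)"
  defines "p \<equiv> critical_exponent TYPE('a)"
  shows "integrable lborel (\<lambda>x. \<bar>u x\<bar> powr p)"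
    "(LINT x|lborel. \<bar>u x\<bar> powr p) \<le> sobolev_const_bound TYPE('a) * (LINT x|lborel. (norm (G x))\<^sup>2) powr (p / 2)"
proof -
  note [measurable] = C1c_measurable[OF u]
  define \<theta> where "\<theta> = 2 / real DIM('a)"
  define K where "K = 2 powr p * 18 * (2 / unit_ball_vol (real DIM('a))) powr \<theta>"
  define E where "E = (LINT x|lborel. (norm (G x))\<^sup>2)"
  have p: "2 < p" "p / 2 = 1 / (1 - \<theta>)"
    using N by (auto simp: p_def \<theta>_def critical_exponent_def field_simps)
  have \<theta>: "0 < \<theta>" "\<theta> < 1" using N by (auto simp: \<theta>_def)
  have K: "0 \<le> K" by (simp add: K_def)
  have E: "0 \<le> E" by (simp add: E_def)
  obtain R L where R: "0 < R" "0 \<le> L" "\<And>x. R < norm x \<Longrightarrow> u x = 0" "\<And>x. \<bar>u x\<bar> \<le> L"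
    using C1c_bounds[OF u] by metis
  show int: "integrable lborel (\<lambda>x. \<bar>u x\<bar> powr p)"
    by (rule integrable_bounded_support[of _ R "L powr p"]) (use R p(1) in \<open>auto intro: powr_mono2\<close>)
  define V where "V = measure lborel (cball (0::'a) R)"
  have V: "0 \<le> V" by (simp add: V_def)
  have bound: "(LINT x|lborel. \<bar>u x\<bar> powr p) \<le> \<epsilon> * V + 2 powr p * (2 * (\<epsilon> * V) + (2 * (K * E)) powr (p / 2))"
    if \<epsilon>: "0 < \<epsilon>" for \<epsilon>
  proof -
    \<comment> \<open>The lowest level satisfies \<open>\<delta> powr p = \<epsilon>\<close>: values
      of \<open>u\<close> below it contribute at most \<open>\<epsilon>\<close> times the volume
      \<open>V\<close> of a ball containing the support, and \<open>b 0\<close> obeys the same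
      bound; both vanish with \<open>\<epsilon>\<close>.\<close>
    define \<delta> where "\<delta> = \<epsilon> powr (1 / p)"
    have \<delta>: "0 < \<delta>" "\<delta> powr p = \<epsilon>" using \<epsilon> p(1) by (auto simp: \<delta>_def powr_powr)
    define t where "t n = \<delta> * 2 ^ n" for n :: nat
    have t: "0 < t n" "t (Suc n) = 2 * t n" for n using \<delta> by (auto simp: t_def)
    obtain m where "L / \<delta> < 2 ^ m" using real_arch_pow[of 2 "L / \<delta>"] by auto
    then have m: "L \<le> t m" using \<delta> by (simp add: t_def field_simps)
    define b where "b n = t n powr p * measure lborel {x. t n < \<bar>u x\<bar>}" for n
    define D where "D n = (LINT x|lborel. indicator {x. t n < \<bar>u x\<bar> \<and> \<bar>u x\<bar> < 2 * t n} x * (norm (G x))\<^sup>2)" for n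
    have b: "0 \<le> b n" and D: "0 \<le> D n" for n by (auto simp: b_def D_def)
    have fm: "{x. t n < \<bar>u x\<bar>} \<in> fmeasurable lborel" for n
    proof (rule fmeasurableI2[OF C1c_support_fmeasurable(1)[OF u]])
      show "{x. t n < \<bar>u x\<bar>} \<subseteq> {x. u x \<noteq> 0}" using t(1)[of n] by auto
      show "{x. t n < \<bar>u x\<bar>} \<in> sets lborel" by simp
    qed
    have dec: "b (Suc n) \<le> K * b n powr \<theta> * D n" for n
      using C1c_level_decay[OF u t(1) N, of n] unfolding b_def D_def t(2) p_def K_def \<theta>_def by simp
    have "integrable lborel (\<lambda>x. indicator {x. t n < \<bar>u x\<bar> \<and> \<bar>u x\<bar> < 2 * t n} x * (norm (G x))\<^sup>2)" for n
      using integrable_mult_indicator[OF _ C1c_integrable(4)[OF u], of "{x. t n < \<bar>u x\<bar> \<and> \<bar>u x\<bar> < 2 * t n}"] by simp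
    note intD = this
    have DE: "(\<Sum>n<m. D n) \<le> E"
    proof -
      have "(\<Sum>n<m. D n) = (LINT x|lborel. (\<Sum>n<m. indicator {x. t n < \<bar>u x\<bar> \<and> \<bar>u x\<bar> < 2 * t n} x * (norm (G x))\<^sup>2))"
        unfolding D_def by (rule Bochner_Integration.integral_sum[symmetric]) (rule intD)
      also have "\<dots> \<le> E"
        unfolding E_def
      proof (rule integral_mono)
        fix x
        have "(\<Sum>n<m. indicator {x. t n < \<bar>u x\<bar> \<and> \<bar>u x\<bar> < 2 * t n} x) = (\<Sum>n<m. indicator {\<delta> * 2 ^ n <..< 2 * (\<delta> * 2 ^ n)} \<bar>u x\<bar> :: real)"
          by (intro sum.cong) (auto simp: t_def indicator_def)
        also have "\<dots> \<le> 1"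
          using sum_dyadic_indicator_le[OF \<delta>(1), where m = m and y = "\<bar>u x\<bar>"] by (rule order_trans) (simp add: indicator_def)
        finally show "(\<Sum>n<m. indicator {x. t n < \<bar>u x\<bar> \<and> \<bar>u x\<bar> < 2 * t n} x * (norm (G x))\<^sup>2) \<le> (norm (G x))\<^sup>2"
          unfolding sum_distrib_right[symmetric] using mult_right_mono[of _ 1 "(norm (G x))\<^sup>2"] by fastforce
      qed (intro Bochner_Integration.integrable_sum intD C1c_integrable(4)[OF u])+
      finally show ?thesis .
    qed
    define B where "B = (\<Sum>n<Suc m. b n)"
    have B: "0 \<le> B" "\<And>n. n < Suc m \<Longrightarrow> b n \<le> B"
      unfolding B_def by (auto intro!: sum_nonneg b member_le_sum simp del: sum.lessThan_Suc)
    have "B = b 0 + (\<Sum>n<m. b (Suc n))" unfolding B_def by (rule sum.lessThan_Suc_shift)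
    also have "(\<Sum>n<m. b (Suc n)) \<le> (\<Sum>n<m. K * B powr \<theta> * D n)"
    proof (rule sum_mono)
      fix n assume "n \<in> {..<m}"
      then have "b n powr \<theta> \<le> B powr \<theta>" using b \<theta> B(2)[of n] by (intro powr_mono2) auto
      then have "K * b n powr \<theta> * D n \<le> K * B powr \<theta> * D n" using K D by (intro mult_right_mono mult_left_mono) auto
      then show "b (Suc n) \<le> K * B powr \<theta> * D n" using dec[of n] by linarith
    qed
    also have "(\<Sum>n<m. K * B powr \<theta> * D n) = K * B powr \<theta> * (\<Sum>n<m. D n)" by (simp add: sum_distrib_left)
    also have "\<dots> \<le> K * B powr \<theta> * E" using K by (intro mult_left_mono DE) auto
    finally have "B \<le> b 0 + (K * E) * B powr \<theta>" by (simp add: mult_ac)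
    from absorb_powr[OF B(1) b[of 0] _ \<theta> this] K E
    have B2: "B \<le> 2 * b 0 + (2 * (K * E)) powr (p / 2)" unfolding p(2) by simp
    have "measure lborel {x. t 0 < \<bar>u x\<bar>} \<le> V"
      unfolding V_def
    proof (rule measure_mono_fmeasurable)
      have "norm x \<le> R" if "t 0 < \<bar>u x\<bar>" for x
        using R(3)[of x] t(1)[of 0] that by (cases "R < norm x") auto
      then show "{x. t 0 < \<bar>u x\<bar>} \<subseteq> cball 0 R" by auto
    qed (auto intro!: fmeasurableI emeasure_bounded_finite)
    then have b0: "b 0 \<le> \<epsilon> * V" using \<delta> \<epsilon> by (simp add: b_def t_def)
    have intS: "integrable lborel (\<lambda>x. 2 powr p * t n powr p * indicator {x. t n < \<bar>u x\<bar>} x :: real)" for n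
      using fm[of n] by (intro integrable_mult_right integrable_real_indicator) (auto simp: fmeasurable_def)
    have LS: "(LINT x|lborel. 2 powr p * t n powr p * indicator {x. t n < \<bar>u x\<bar>} x) = 2 powr p * b n" for n
      by (simp add: b_def)
    have LV: "(LINT x|lborel. \<epsilon> * indicator (cball (0::'a) R) x) = \<epsilon> * V" by (simp add: V_def)
    have "(LINT x|lborel. \<bar>u x\<bar> powr p) \<le> (LINT x|lborel. \<epsilon> * indicator (cball 0 R) x +
        (\<Sum>n<m. 2 powr p * t n powr p * indicator {x. t n < \<bar>u x\<bar>} x))"
    proof (rule integral_mono)
      show "integrable lborel (\<lambda>x. \<epsilon> * indicator (cball 0 R) x + (\<Sum>n<m. 2 powr p * t n powr p * indicator {x. t n < \<bar>u x\<bar>} x))"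
        by (intro Bochner_Integration.integrable_add integrable_indicator_cball Bochner_Integration.integrable_sum intS)
      fix x
      show "\<bar>u x\<bar> powr p \<le> \<epsilon> * indicator (cball 0 R) x + (\<Sum>n<m. 2 powr p * t n powr p * indicator {x. t n < \<bar>u x\<bar>} x)"
      proof (cases "norm x \<le> R")
        case True
        have "\<bar>u x\<bar> powr p \<le> \<delta> powr p + (\<Sum>n<m. (2 * (\<delta> * 2 ^ n)) powr p * indicator {\<delta> * 2 ^ n <..} \<bar>u x\<bar>)"
          using m R(4)[of x] p(1) \<delta>(1) by (intro powr_le_dyadic_sum) (auto simp: t_def)
        also have "(\<Sum>n<m. (2 * (\<delta> * 2 ^ n)) powr p * indicator {\<delta> * 2 ^ n <..} \<bar>u x\<bar>) = (\<Sum>n<m. 2 powr p * t n powr p * indicator {x. t n < \<bar>u x\<bar>} x)"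
          using \<delta> by (intro sum.cong) (auto simp: t_def indicator_def powr_mult)
        finally show ?thesis using True \<delta> by simp
      next
        case False
        then have "u x = 0" using R(3) by auto
        then show ?thesis using False by (auto intro!: sum_nonneg)
      qed
    qed (rule int)
    also have "\<dots> = \<epsilon> * V + (\<Sum>n<m. 2 powr p * b n)"
      unfolding LS[symmetric] LV[symmetric]
      by (subst Bochner_Integration.integral_sum[OF intS, symmetric])
        (intro Bochner_Integration.integral_add integrable_indicator_cball Bochner_Integration.integrable_sum intS)
    also have "\<dots> \<le> \<epsilon> * V + 2 powr p * B"
      using b[of m] by (simp add: B_def sum_distrib_left[symmetric])
    also have "\<dots> \<le> \<epsilon> * V + 2 powr p * (2 * (\<epsilon> * V) + (2 * (K * E)) powr (p / 2))"
      using B2 b0 by (intro add_left_mono mult_left_mono) auto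
    finally show ?thesis .
  qed
  have "(LINT x|lborel. \<bar>u x\<bar> powr p) \<le> 2 powr p * (2 * (K * E)) powr (p / 2)"
  proof (rule field_le_epsilon)
    fix e :: real assume e: "0 < e"
    define Q where "Q = V + 2 powr p * (2 * V)"
    have Q: "0 \<le> Q" using V by (simp add: Q_def)
    define q where "q = e / (Q + 1)"
    have q: "0 < q" "q * Q \<le> e" using e Q by (auto simp: q_def field_simps add_pos_nonneg)
    have "(LINT x|lborel. \<bar>u x\<bar> powr p) \<le> q * V + 2 powr p * (2 * (q * V) + (2 * (K * E)) powr (p / 2))"
      by (rule bound) (rule q)
    also have "\<dots> = 2 powr p * (2 * (K * E)) powr (p / 2) + q * Q"
      by (simp add: Q_def algebra_simps)
    also have "q * Q \<le> e" by (rule q)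
    finally show "(LINT x|lborel. \<bar>u x\<bar> powr p) \<le> 2 powr p * (2 * (K * E)) powr (p / 2) + e" by simp
  qed
  also have "\<dots> = sobolev_const_bound TYPE('a) * E powr (p / 2)"
    using K E powr_mult[of "2 * K" E "p / 2"] by (simp add: sobolev_const_bound_def Let_def K_def p_def \<theta>_def mult.assoc)
  finally show "(LINT x|lborel. \<bar>u x\<bar> powr p) \<le> sobolev_const_bound TYPE('a) * (LINT x|lborel. (norm (G x))\<^sup>2) powr (p / 2)"
    by (simp add: E_def)
qed

section \<open>The Hilbert space \<open>H\<^sub>0\<^sup>1(\<Omega>)\<close>\<close>

context bounded_domain
begin

definition D :: "('a \<Rightarrow> real) \<Rightarrow> ('a \<Rightarrow> real) \<Rightarrow> real" where
  "D u v = L2_inner M (weak_gradient \<Omega> u) (weak_gradient \<Omega> v)"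

definition energy_norm :: "('a \<Rightarrow> real) \<Rightarrow> real" where
  "energy_norm u = L2_norm M (weak_gradient \<Omega> u)"

lemma has_weak_gradient_L2: "has_weak_gradient \<Omega> u g \<Longrightarrow> u \<in> L2 M" "has_weak_gradient \<Omega> u g \<Longrightarrow> g \<in> L2 M"
  by (auto simp: has_weak_gradient_iff)

lemma has_weak_gradient_H1: "has_weak_gradient \<Omega> u g \<Longrightarrow> u \<in> H1 \<Omega>"
  by (auto simp: H1_def)

lemma has_weak_gradient_norm_eq:
  assumes "has_weak_gradient \<Omega> u g" "has_weak_gradient \<Omega> u g'" "h \<in> L2 M"
  shows "L2_norm M (g - h) = L2_norm M (g' - h)"
proof (rule L2_norm_cong_AE)
  show "AE x in M. (g - h) x = (g' - h) x"
    using has_weak_gradient_unique[OF assms(1,2)] by eventually_elim simp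
qed (intro L2_measurable L2.mem_diff has_weak_gradient_L2(2)[OF assms(1)] has_weak_gradient_L2(2)[OF assms(2)] assms(3))+

lemma energy_norm_eq: "has_weak_gradient \<Omega> u g \<Longrightarrow> energy_norm u = L2_norm M g"
  using has_weak_gradient_norm_eq[OF has_weak_gradient_weak_gradient[OF has_weak_gradient_H1] _ L2.mem_zero, of u g g]
  by (simp add: energy_norm_def)

lemma D_eq:
  assumes "has_weak_gradient \<Omega> u g" "has_weak_gradient \<Omega> v h"
  shows "D u v = L2_inner M g h"
  unfolding D_def
  using assms weak_gradient_L2[OF has_weak_gradient_H1] has_weak_gradient_L2 weak_gradient_AE_eq
  by (intro L2_inner_cong_AE) (auto intro: L2_measurable)

lemma dirichlet_energy_eq: "dirichlet_energy \<Omega> u = (energy_norm u)\<^sup>2"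
  by (simp add: dirichlet_energy_def energy_norm_def L2_norm_sq set_integral_M)

lemma H01_norm_eq: "H01_norm \<Omega> u = energy_norm u"
  by (simp add: H01_norm_def dirichlet_energy_eq energy_norm_def)

lemma H1_norm_eq: "H1_norm \<Omega> u = sqrt ((L2_norm M u)\<^sup>2 + (energy_norm u)\<^sup>2)"
  by (simp add: H1_norm_def dirichlet_energy_eq L2_norm_sq set_integral_M)

lemma H01_H1: "u \<in> H01 \<Omega> \<Longrightarrow> u \<in> H1 \<Omega>"
  by (simp add: H01_def)

lemma H01_L2: "u \<in> H01 \<Omega> \<Longrightarrow> u \<in> L2 M"
  by (simp add: H01_H1 H1_L2)

lemma H01_weak_gradient: "u \<in> H01 \<Omega> \<Longrightarrow> has_weak_gradient \<Omega> u (weak_gradient \<Omega> u)"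
  by (simp add: H01_H1 has_weak_gradient_weak_gradient)

text \<open>Membership in \<open>H01\<close> is tested through any weak gradient \<open>g\<close>,
  so that the choice hidden in \<open>H1_norm\<close> need not be unfolded again.\<close>

lemma H01I:
  assumes u: "has_weak_gradient \<Omega> u g" and \<phi>: "\<And>k. \<phi> k \<in> test_functions \<Omega>"
    and lim: "(\<lambda>k. L2_norm M (u - \<phi> k)) \<longlonglongrightarrow> 0" "(\<lambda>k. L2_norm M (g - grad (\<phi> k))) \<longlonglongrightarrow> 0"
  shows "u \<in> H01 \<Omega>"
proof -
  have "energy_norm (u - \<phi> k) = L2_norm M (g - grad (\<phi> k))" for k
    by (rule energy_norm_eq[OF has_weak_gradient_diff[OF u has_weak_gradient_test[OF \<phi>]]])
  moreover have "(\<lambda>k. sqrt ((L2_norm M (u - \<phi> k))\<^sup>2 + (L2_norm M (g - grad (\<phi> k)))\<^sup>2)) \<longlonglongrightarrow> sqrt (0\<^sup>2 + 0\<^sup>2)"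
    by (intro tendsto_intros lim)
  ultimately have "(\<lambda>k. H1_norm \<Omega> (u - \<phi> k)) \<longlonglongrightarrow> 0" by (simp add: H1_norm_eq)
  then show ?thesis using u \<phi> by (auto simp: H01_def H1_def fun_diff_def)
qed

lemma H01_approx:
  assumes u: "u \<in> H01 \<Omega>"
  obtains \<phi> where "\<And>k. \<phi> k \<in> test_functions \<Omega>" "(\<lambda>k::nat. L2_norm M (\<phi> k - u)) \<longlonglongrightarrow> 0"
    "(\<lambda>k. energy_norm (\<phi> k - u)) \<longlonglongrightarrow> 0"
proof -
  obtain \<phi> where \<phi>: "\<And>k. \<phi> k \<in> test_functions \<Omega>" and lim: "(\<lambda>k::nat. H1_norm \<Omega> (u - \<phi> k)) \<longlonglongrightarrow> 0"
    using u by (auto simp: H01_def fun_diff_def)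
  have H: "has_weak_gradient \<Omega> (u - \<phi> k) (weak_gradient \<Omega> u - grad (\<phi> k))"
    and H': "has_weak_gradient \<Omega> (\<phi> k - u) (grad (\<phi> k) - weak_gradient \<Omega> u)" for k
    by (intro has_weak_gradient_diff H01_weak_gradient u has_weak_gradient_test \<phi>)+
  have e1: "L2_norm M (\<phi> k - u) = L2_norm M (u - \<phi> k)" for k
    by (rule L2.nrm_minus_commute[OF test_M(1)[OF \<phi>] H01_L2[OF u]])
  have e2: "energy_norm (\<phi> k - u) = energy_norm (u - \<phi> k)" for k
    unfolding energy_norm_eq[OF H] energy_norm_eq[OF H']
    by (rule L2.nrm_minus_commute[OF test_M(2)[OF \<phi>] has_weak_gradient_L2(2)[OF H01_weak_gradient[OF u]]])
  have "norm (L2_norm M (\<phi> k - u)) \<le> H1_norm \<Omega> (u - \<phi> k)" for k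
    unfolding H1_norm_eq e1 by (simp add: real_le_rsqrt)
  moreover have "norm (energy_norm (\<phi> k - u)) \<le> H1_norm \<Omega> (u - \<phi> k)" for k
    unfolding H1_norm_eq e2 by (simp add: real_le_rsqrt energy_norm_def)
  ultimately have "(\<lambda>k. L2_norm M (\<phi> k - u)) \<longlonglongrightarrow> 0" "(\<lambda>k. energy_norm (\<phi> k - u)) \<longlonglongrightarrow> 0"
    by (auto intro!: Lim_null_comparison[OF always_eventually lim])
  then show thesis by (rule that[OF \<phi>])
qed

lemma test_H01:
  assumes \<phi>: "\<phi> \<in> test_functions \<Omega>"
  shows "\<phi> \<in> H01 \<Omega>"
  by (rule H01I[OF has_weak_gradient_test[OF \<phi>], of "\<lambda>_. \<phi>"]) (simp_all add: \<phi> L2.nrm_zero)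

lemma subspace_H01: "subspace (H01 \<Omega>)"
proof (rule subspaceI)
  show "0 \<in> H01 \<Omega>" using subspace_0[OF subspace_test_functions] test_H01 by blast
next
  fix u v assume uv: "u \<in> H01 \<Omega>" "v \<in> H01 \<Omega>"
  obtain \<phi> where \<phi>: "\<And>k. \<phi> k \<in> test_functions \<Omega>" "(\<lambda>k::nat. L2_norm M (\<phi> k - u)) \<longlonglongrightarrow> 0"
    "(\<lambda>k. energy_norm (\<phi> k - u)) \<longlonglongrightarrow> 0" using H01_approx[OF uv(1)] by blast
  obtain \<psi> where \<psi>: "\<And>k. \<psi> k \<in> test_functions \<Omega>" "(\<lambda>k::nat. L2_norm M (\<psi> k - v)) \<longlonglongrightarrow> 0"
    "(\<lambda>k. energy_norm (\<psi> k - v)) \<longlonglongrightarrow> 0" using H01_approx[OF uv(2)] by blast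
  note W = H01_weak_gradient[OF uv(1)] H01_weak_gradient[OF uv(2)]
  have T: "\<phi> k + \<psi> k \<in> test_functions \<Omega>" for k by (intro subspace_add[OF subspace_test_functions] \<phi> \<psi>)
  note L = test_M(1,2)[OF \<phi>(1)] test_M(1,2)[OF \<psi>(1)] has_weak_gradient_L2[OF W(1)] has_weak_gradient_L2[OF W(2)]
  note Wd = has_weak_gradient_diff[OF has_weak_gradient_test[OF \<phi>(1)] W(1)] has_weak_gradient_diff[OF has_weak_gradient_test[OF \<psi>(1)] W(2)]
  show "u + v \<in> H01 \<Omega>"
  proof (rule H01I[OF has_weak_gradient_add[OF W] T])
    show "(\<lambda>k. L2_norm M (u + v - (\<phi> k + \<psi> k))) \<longlonglongrightarrow> 0"
    proof (rule Lim_null_comparison)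
      show "(\<lambda>k. L2_norm M (\<phi> k - u) + L2_norm M (\<psi> k - v)) \<longlonglongrightarrow> 0" using tendsto_add[OF \<phi>(2) \<psi>(2)] by simp
      have "L2_norm M (u + v - (\<phi> k + \<psi> k)) = L2_norm M ((\<phi> k - u) + (\<psi> k - v))" for k
        using L2.nrm_minus_commute[of "u + v" M "\<phi> k + \<psi> k"] L by (simp add: L2.mems algebra_simps)
      then show "\<forall>\<^sub>F k in sequentially. norm (L2_norm M (u + v - (\<phi> k + \<psi> k))) \<le> L2_norm M (\<phi> k - u) + L2_norm M (\<psi> k - v)"
        using L2.nrm_triangle[of "\<phi> _ - u" M "\<psi> _ - v"] L by (simp add: L2.mems)
    qed
    show "(\<lambda>k. L2_norm M (weak_gradient \<Omega> u + weak_gradient \<Omega> v - grad (\<phi> k + \<psi> k))) \<longlonglongrightarrow> 0"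
    proof (rule Lim_null_comparison)
      show "(\<lambda>k. energy_norm (\<phi> k - u) + energy_norm (\<psi> k - v)) \<longlonglongrightarrow> 0" using tendsto_add[OF \<phi>(3) \<psi>(3)] by simp
      have "L2_norm M (weak_gradient \<Omega> u + weak_gradient \<Omega> v - grad (\<phi> k + \<psi> k)) = 
          L2_norm M ((grad (\<phi> k) - weak_gradient \<Omega> u) + (grad (\<psi> k) - weak_gradient \<Omega> v))" for k
      proof -
        \<comment> \<open>The gradient of the sum and the sum of the gradients are two weak
          gradients of one function; uniqueness almost everywhere is enough for the norm.\<close>
        have "L2_norm M (grad (\<phi> k + \<psi> k) - (weak_gradient \<Omega> u + weak_gradient \<Omega> v)) = 
          L2_norm M ((grad (\<phi> k) + grad (\<psi> k)) - (weak_gradient \<Omega> u + weak_gradient \<Omega> v))"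
          by (rule has_weak_gradient_norm_eq[OF has_weak_gradient_test[OF T]
              has_weak_gradient_add[OF has_weak_gradient_test[OF \<phi>(1)] has_weak_gradient_test[OF \<psi>(1)]]])
            (intro L2.mems L)
        then show ?thesis
          using L2.nrm_minus_commute[of "weak_gradient \<Omega> u + weak_gradient \<Omega> v" M "grad (\<phi> k + \<psi> k)"] L test_M(2)[OF T]
          by (simp add: L2.mems algebra_simps)
      qed
      then show "\<forall>\<^sub>F k in sequentially. norm (L2_norm M (weak_gradient \<Omega> u + weak_gradient \<Omega> v - grad (\<phi> k + \<psi> k))) \<le> energy_norm (\<phi> k - u) + energy_norm (\<psi> k - v)"
        unfolding energy_norm_eq[OF Wd(1)] energy_norm_eq[OF Wd(2)]
        using L2.nrm_triangle[of "grad (\<phi> _) - weak_gradient \<Omega> u" M "grad (\<psi> _) - weak_gradient \<Omega> v"] L by (simp add: L2.mems)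
    qed
  qed
next
  fix u and r :: real assume u: "u \<in> H01 \<Omega>"
  obtain \<phi> where \<phi>: "\<And>k. \<phi> k \<in> test_functions \<Omega>" "(\<lambda>k::nat. L2_norm M (\<phi> k - u)) \<longlonglongrightarrow> 0"
    "(\<lambda>k. energy_norm (\<phi> k - u)) \<longlonglongrightarrow> 0" using H01_approx[OF u] by blast
  note W = H01_weak_gradient[OF u]
  have T: "r *\<^sub>R \<phi> k \<in> test_functions \<Omega>" for k by (intro subspace_scale[OF subspace_test_functions] \<phi>)
  note L = test_M(1,2)[OF \<phi>(1)] has_weak_gradient_L2[OF W]
  note Wd = has_weak_gradient_diff[OF has_weak_gradient_test[OF \<phi>(1)] W]
  show "r *\<^sub>R u \<in> H01 \<Omega>"
  proof (rule H01I[OF has_weak_gradient_scale[OF W] T])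
    have "L2_norm M (r *\<^sub>R u - r *\<^sub>R \<phi> k) = \<bar>r\<bar> * L2_norm M (\<phi> k - u)" for k
      using L2.nrm_scale[of "u - \<phi> k" M r] L2.nrm_minus_commute[of u M "\<phi> k"] L 
      by (simp add: L2.mems scaleR_diff_right)
    then show "(\<lambda>k. L2_norm M (r *\<^sub>R u - r *\<^sub>R \<phi> k)) \<longlonglongrightarrow> 0"
      using tendsto_mult_right_zero[OF \<phi>(2)] by simp
    have "L2_norm M (r *\<^sub>R weak_gradient \<Omega> u - grad (r *\<^sub>R \<phi> k)) = \<bar>r\<bar> * energy_norm (\<phi> k - u)" for k
    proof -
      have "L2_norm M (grad (r *\<^sub>R \<phi> k) - r *\<^sub>R weak_gradient \<Omega> u) = L2_norm M (r *\<^sub>R grad (\<phi> k) - r *\<^sub>R weak_gradient \<Omega> u)"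
        by (rule has_weak_gradient_norm_eq[OF has_weak_gradient_test[OF T] has_weak_gradient_scale[OF has_weak_gradient_test[OF \<phi>(1)]]])
          (intro L2.mems L)
      then show ?thesis
        using L2.nrm_scale[of "grad (\<phi> k) - weak_gradient \<Omega> u" M r] L test_M(2)[OF T]
          L2.nrm_minus_commute[of "r *\<^sub>R weak_gradient \<Omega> u" M "grad (r *\<^sub>R \<phi> k)"]
        by (simp add: energy_norm_eq[OF Wd] L2.mems scaleR_diff_right)
    qed
    then show "(\<lambda>k. L2_norm M (r *\<^sub>R weak_gradient \<Omega> u - grad (r *\<^sub>R \<phi> k))) \<longlonglongrightarrow> 0"
      using tendsto_mult_right_zero[OF \<phi>(3)] by simp
  qed
qed

lemma semi_inner_H01: "semi_inner (H01 \<Omega>) D"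
proof
  fix u v w assume "u \<in> H01 \<Omega>" "v \<in> H01 \<Omega>" "w \<in> H01 \<Omega>"
  note W = this[THEN H01_weak_gradient]
  show "D (u + v) w = D u w + D v w"
    using has_weak_gradient_L2[OF W(1)] has_weak_gradient_L2[OF W(2)] has_weak_gradient_L2[OF W(3)]
    by (simp add: D_eq[OF has_weak_gradient_add[OF W(1,2)] W(3)] D_eq[OF W(1,3)] D_eq[OF W(2,3)] L2.bilin)
next
  fix u w and r :: real assume "u \<in> H01 \<Omega>" "w \<in> H01 \<Omega>"
  note W = this[THEN H01_weak_gradient]
  show "D (r *\<^sub>R u) w = r * D u w"
    using has_weak_gradient_L2[OF W(1)] has_weak_gradient_L2[OF W(2)]
    by (simp add: D_eq[OF has_weak_gradient_scale[OF W(1)] W(2)] D_eq[OF W(1,2)] L2.bilin)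
next
  fix u w assume "u \<in> H01 \<Omega>" "w \<in> H01 \<Omega>"
  then show "D u w = D w u" unfolding D_def by (intro L2.sym weak_gradient_L2 H01_H1)
next
  fix u assume "u \<in> H01 \<Omega>"
  then show "0 \<le> D u u" unfolding D_def by (intro L2.nonneg weak_gradient_L2 H01_H1)
qed (rule subspace_H01)

lemma sqrt_D: "sqrt (D u u) = energy_norm u"
  by (simp add: D_def energy_norm_def L2_norm_def L2_inner_self)

sublocale H: semi_inner "H01 \<Omega>" D
  rewrites "semi_inner.nrm D = energy_norm"
proof -
  show "semi_inner (H01 \<Omega>) D" by (rule semi_inner_H01)
  then interpret semi_inner "H01 \<Omega>" D .
  show "nrm = energy_norm" by (simp add: fun_eq_iff nrm_def sqrt_D)
qed

lemma D_self: "D u u = (energy_norm u)\<^sup>2"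
  by (simp add: D_def energy_norm_def L2_norm_sq L2_inner_self)

lemma energy_norm_nonneg [simp]: "0 \<le> energy_norm u"
  by (simp add: energy_norm_def)

text \<open>For \<open>h\<close> longer than the diameter of \<open>\<Omega>\<close> the functions \<open>\<phi>\<close> and \<open>\<phi>(\<cdot> + h)\<close> have
  disjoint supports, so the translation estimate bounds twice the \<open>L\<^sup>2\<close> norm.\<close>

lemma poincare_test: "\<exists>C>0. \<forall>\<phi>\<in>test_functions \<Omega>. L2_norm M \<phi> \<le> C * energy_norm \<phi>"
proof -
  obtain R where R: "0 < R" "\<And>x. x \<in> \<Omega> \<Longrightarrow> norm x \<le> R"
    using bounded_dom by (auto simp: bounded_pos)
  obtain b :: 'a where b: "b \<in> Basis" using nonempty_Basis by blast
  \<comment> \<open>\<Omega> lies in the ball of radius \<open>R\<close>, hence has diameter at most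
    \<open>2 R\<close>; a shift of length \<open>3 R\<close> moves it off itself.\<close>
  define h where "h = (3 * R) *\<^sub>R b"
  have h: "norm h = 3 * R" using b R by (simp add: h_def)
  have "L2_norm M \<phi> \<le> (3 * R) * energy_norm \<phi>" if \<phi>: "\<phi> \<in> test_functions \<Omega>" for \<phi>
  proof -
    note C = test_C1c[OF \<phi>]
    note [measurable] = C1c_measurable[OF C]
    have "\<phi> (x + h) * \<phi> x = 0" for x
    proof (cases "norm x \<le> R")
      case True
      have "norm (x + h) \<ge> norm h - norm x" using norm_diff_ineq[of h x] by (simp add: add.commute)
      then have "x + h \<notin> \<Omega>" using True h R(1) R(2)[of "x + h"] by force
      then show ?thesis using test_zero_outside[OF \<phi>] by simp
    next
      case False
      then show ?thesis using R(2) test_zero_outside[OF \<phi>, of x] by auto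
    qed
    then have sq: "(\<phi> (x + h) - \<phi> x)\<^sup>2 = (\<phi> (x + h))\<^sup>2 + (\<phi> x)\<^sup>2" for x by (simp add: power2_diff mult.assoc)
    have "2 * (L2_norm lborel \<phi>)\<^sup>2 = (LINT x|lborel. (\<phi> (x + h))\<^sup>2) + (LINT x|lborel. (\<phi> x)\<^sup>2)"
      using lborel_integral_translation(1)[of "\<lambda>x. (\<phi> x)\<^sup>2" h] by (simp add: L2_norm_sq)
    also have "\<dots> = (LINT x|lborel. (\<phi> (x + h) - \<phi> x)\<^sup>2)"
      unfolding sq using C1c_integrable(2)[OF C] lborel_integral_translation(2)[of "\<lambda>x. (\<phi> x)\<^sup>2" h] by simp
    also have "\<dots> \<le> (norm h)\<^sup>2 * (L2_norm lborel (grad \<phi>))\<^sup>2"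
      unfolding L2_norm_sq by (rule C1c_translation(2)[OF C])
    finally have "2 * (L2_norm lborel \<phi>)\<^sup>2 \<le> (3 * R * L2_norm lborel (grad \<phi>))\<^sup>2"
      by (simp add: h power_mult_distrib)
    moreover have "0 \<le> (L2_norm lborel \<phi>)\<^sup>2" by simp
    ultimately have "(L2_norm lborel \<phi>)\<^sup>2 \<le> (3 * R * L2_norm lborel (grad \<phi>))\<^sup>2" by linarith
    then have "L2_norm lborel \<phi> \<le> 3 * R * L2_norm lborel (grad \<phi>)"
      by (rule power2_le_imp_le) (use R in simp)
    then show ?thesis
      by (simp add: test_M(5,6)[OF \<phi>] energy_norm_eq[OF has_weak_gradient_test[OF \<phi>]])
  qed
  then show ?thesis using R by (intro exI[of _ "3 * R"]) auto
qed

definition poincare_const :: real where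
  "poincare_const = (SOME C. 0 < C \<and> (\<forall>\<phi>\<in>test_functions \<Omega>. L2_norm M \<phi> \<le> C * energy_norm \<phi>))"

lemma poincare_const: "0 < poincare_const" "\<phi> \<in> test_functions \<Omega> \<Longrightarrow> L2_norm M \<phi> \<le> poincare_const * energy_norm \<phi>"
  using someI_ex[of "\<lambda>C. 0 < C \<and> (\<forall>\<phi>\<in>test_functions \<Omega>. L2_norm M \<phi> \<le> C * energy_norm \<phi>)"] poincare_test
  unfolding poincare_const_def by auto

lemma poincare:
  assumes u: "u \<in> H01 \<Omega>"
  shows "L2_norm M u \<le> poincare_const * energy_norm u"
proof -
  obtain \<phi> where \<phi>: "\<And>k. \<phi> k \<in> test_functions \<Omega>" "(\<lambda>k::nat. L2_norm M (\<phi> k - u)) \<longlonglongrightarrow> 0"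
    "(\<lambda>k. energy_norm (\<phi> k - u)) \<longlonglongrightarrow> 0" using H01_approx[OF u] by blast
  have 1: "(\<lambda>k. L2_norm M (\<phi> k)) \<longlonglongrightarrow> L2_norm M u"
    by (rule L2.nrm_LIMSEQ[OF test_M(1)[OF \<phi>(1)] H01_L2[OF u] \<phi>(2)])
  have 2: "(\<lambda>k. poincare_const * energy_norm (\<phi> k)) \<longlonglongrightarrow> poincare_const * energy_norm u"
    by (intro tendsto_intros H.nrm_LIMSEQ[OF test_H01[OF \<phi>(1)] u \<phi>(3)])
  show ?thesis by (rule LIMSEQ_le[OF 1 2]) (use poincare_const(2)[OF \<phi>(1)] in blast)
qed

text \<open>The Poincare inequality makes a sequence that is Cauchy in energy Cauchy in L2;
  functions and gradients converge separately, and closedness of the weak gradient joins the limits.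
  One test function within \<open>1 / (n + 1)\<close> of each \<open>U n\<close> shows that the
  limit is again in the closure of the test functions.\<close>

lemma H01_complete:
  assumes U: "\<And>n. U n \<in> H01 \<Omega>"
    and C: "\<And>e. 0 < e \<Longrightarrow> \<exists>K. \<forall>m\<ge>K. \<forall>n\<ge>K. energy_norm (U m - U n) < e"
  shows "\<exists>u\<in>H01 \<Omega>. (\<lambda>n. energy_norm (U n - u)) \<longlonglongrightarrow> 0"
proof -
  let ?G = "\<lambda>n. weak_gradient \<Omega> (U n)"
  note W = H01_weak_gradient[OF U]
  note L = has_weak_gradient_L2[OF W]
  have "\<exists>u\<in>L2 M. (\<lambda>n. L2_norm M (U n - u)) \<longlonglongrightarrow> 0"
  proof (rule M.L2_complete[OF L(1)])
    fix e :: real assume e: "0 < e"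
    obtain K where K: "\<And>m n. m \<ge> K \<Longrightarrow> n \<ge> K \<Longrightarrow> energy_norm (U m - U n) < e / poincare_const"
      using C[of "e / poincare_const"] e poincare_const(1) by auto
    have "L2_norm M (U m - U n) < e" if "m \<ge> K" "n \<ge> K" for m n
      using poincare[OF H.mem_diff[OF U U], of m n] K[OF that] poincare_const(1) by (simp add: field_simps)
    then show "\<exists>K. \<forall>m\<ge>K. \<forall>n\<ge>K. L2_norm M (U m - U n) < e" by blast
  qed
  then obtain u where u: "u \<in> L2 M" "(\<lambda>n. L2_norm M (U n - u)) \<longlonglongrightarrow> 0" by blast
  have "\<exists>g\<in>L2 M. (\<lambda>n. L2_norm M (?G n - g)) \<longlonglongrightarrow> 0"
    by (rule M.L2_complete[OF L(2)]) (use C energy_norm_eq[OF has_weak_gradient_diff[OF W W]] in simp)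
  then obtain g where g: "g \<in> L2 M" "(\<lambda>n. L2_norm M (?G n - g)) \<longlonglongrightarrow> 0" by blast
  have ug: "has_weak_gradient \<Omega> u g" by (rule has_weak_gradient_limit[OF W u(1) g(1) u(2) g(2)])
  have "\<exists>\<phi>\<in>test_functions \<Omega>. L2_norm M (U n - \<phi>) < 1 / real (Suc n) \<and> L2_norm M (?G n - grad \<phi>) < 1 / real (Suc n)" for n
  proof -
    obtain \<phi> where \<phi>: "\<And>k. \<phi> k \<in> test_functions \<Omega>" "(\<lambda>k::nat. L2_norm M (\<phi> k - U n)) \<longlonglongrightarrow> 0"
      "(\<lambda>k. energy_norm (\<phi> k - U n)) \<longlonglongrightarrow> 0" using H01_approx[OF U] by blast
    have "\<forall>\<^sub>F k in sequentially. L2_norm M (\<phi> k - U n) < 1 / real (Suc n) \<and> energy_norm (\<phi> k - U n) < 1 / real (Suc n)"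
      by (intro eventually_conj order_tendstoD[OF \<phi>(2)] order_tendstoD[OF \<phi>(3)]) auto
    then obtain k where k: "L2_norm M (\<phi> k - U n) < 1 / real (Suc n)" "energy_norm (\<phi> k - U n) < 1 / real (Suc n)"
      by (auto simp: eventually_sequentially)
    have "L2_norm M (U n - \<phi> k) < 1 / real (Suc n)"
      using k(1) L2.nrm_minus_commute[OF L(1) test_M(1)[OF \<phi>(1)]] by simp
    moreover have "L2_norm M (?G n - grad (\<phi> k)) < 1 / real (Suc n)"
      using k(2) L2.nrm_minus_commute[OF L(2) test_M(2)[OF \<phi>(1)], of n k]
      by (simp add: energy_norm_eq[OF has_weak_gradient_diff[OF has_weak_gradient_test[OF \<phi>(1)] W]])
    ultimately show ?thesis using \<phi>(1) by blast
  qed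
  then obtain \<phi> where \<phi>: "\<And>n. \<phi> n \<in> test_functions \<Omega>" "\<And>n. L2_norm M (U n - \<phi> n) < 1 / real (Suc n)"
    "\<And>n. L2_norm M (?G n - grad (\<phi> n)) < 1 / real (Suc n)" by metis
  have inv: "(\<lambda>n. 1 / real (Suc n)) \<longlonglongrightarrow> 0" using LIMSEQ_inverse_real_of_nat by (simp add: inverse_eq_divide)
  have "u \<in> H01 \<Omega>"
  proof (rule H01I[OF ug \<phi>(1)])
    show "(\<lambda>n. L2_norm M (u - \<phi> n)) \<longlonglongrightarrow> 0"
    proof (rule Lim_null_comparison)
      have "L2_norm M (u - \<phi> n) \<le> L2_norm M (U n - u) + 1 / real (Suc n)" for n
        using L2.nrm_triangle_le[OF u(1) L(1) test_M(1)[OF \<phi>(1)], of n n] \<phi>(2)[of n] L2.nrm_minus_commute[OF u(1) L(1), of n]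
        by linarith
      then show "\<forall>\<^sub>F n in sequentially. norm (L2_norm M (u - \<phi> n)) \<le> L2_norm M (U n - u) + 1 / real (Suc n)" by simp
      show "(\<lambda>n. L2_norm M (U n - u) + 1 / real (Suc n)) \<longlonglongrightarrow> 0" using tendsto_add[OF u(2) inv] by simp
    qed
    show "(\<lambda>n. L2_norm M (g - grad (\<phi> n))) \<longlonglongrightarrow> 0"
    proof (rule Lim_null_comparison)
      have "L2_norm M (g - grad (\<phi> n)) \<le> L2_norm M (?G n - g) + 1 / real (Suc n)" for n
        using L2.nrm_triangle_le[OF g(1) L(2) test_M(2)[OF \<phi>(1)], of n n] \<phi>(3)[of n] L2.nrm_minus_commute[OF g(1) L(2), of n]
        by linarith
      then show "\<forall>\<^sub>F n in sequentially. norm (L2_norm M (g - grad (\<phi> n))) \<le> L2_norm M (?G n - g) + 1 / real (Suc n)" by simp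
      show "(\<lambda>n. L2_norm M (?G n - g) + 1 / real (Suc n)) \<longlonglongrightarrow> 0" using tendsto_add[OF g(2) inv] by simp
    qed
  qed
  moreover have "(\<lambda>n. energy_norm (U n - u)) \<longlonglongrightarrow> 0"
    using g(2) by (simp add: energy_norm_eq[OF has_weak_gradient_diff[OF W ug]])
  ultimately show ?thesis by blast
qed

sublocale H: semi_hilbert "H01 \<Omega>" D
  rewrites "semi_inner.nrm D = energy_norm"
proof -
  show "semi_hilbert (H01 \<Omega>) D"
    by unfold_locales (unfold sqrt_D, rule H01_complete)
  show "semi_inner.nrm D = energy_norm"
    by (simp add: fun_eq_iff semi_inner.nrm_def[OF semi_inner_H01] sqrt_D)
qed

text \<open>The infimum defining \<open>S\<close> and the one for the Rayleigh quotient thus range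
  over nonempty sets; for reals the infimum of the empty set would be unspecified.\<close>

lemma exists_nonzero_test: "\<exists>\<phi>\<in>test_functions \<Omega>. ae_nonzero \<Omega> \<phi>"
proof -
  obtain x where x: "x \<in> \<Omega>" using nonempty_dom by blast
  obtain a b where ab: "x \<in> box a b" "cbox a b \<subseteq> \<Omega>"
    using open_contains_cbox[OF open_dom x] by metis
  obtain \<phi> :: "nat \<Rightarrow> 'a \<Rightarrow> real" where \<phi>: "\<And>n. \<phi> n \<in> test_functions \<Omega>"
    "\<And>x. (\<lambda>n. \<phi> n x) \<longlonglongrightarrow> indicator (box a b) x"
    using test_functions_box_approx[OF ab(2)] by metis
  show ?thesis
  proof (rule ccontr)
    assume "\<not> ?thesis"
    then have "AE x in lborel. x \<in> \<Omega> \<longrightarrow> \<phi> n x = 0" for n using \<phi>(1) by (auto simp: ae_nonzero_def)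
    then have "AE x in lborel. \<forall>n. x \<in> \<Omega> \<longrightarrow> \<phi> n x = 0" by (subst AE_all_countable) auto
    then have "AE x in lborel. x \<notin> box a b"
    proof eventually_elim
      case (elim x)
      show ?case
      proof
        assume xb: "x \<in> box a b"
        then have "x \<in> \<Omega>" using ab(2) box_subset_cbox by blast
        then have "(\<lambda>n. 0) \<longlonglongrightarrow> (indicator (box a b) x :: real)" using \<phi>(2)[of x] elim by simp
        then show False using xb by (simp add: LIMSEQ_const_iff)
      qed
    qed
    then have "box a b \<in> null_sets lborel" by (simp add: AE_iff_null_sets)
    then have "emeasure lborel (box a b) = 0" by auto
    moreover have lt: "a \<bullet> i < b \<bullet> i" if "i \<in> Basis" for i using ab(1) that by (force simp: mem_box)
    moreover have "0 < (\<Prod>i\<in>Basis. (b - a) \<bullet> i)" by (intro prod_pos) (simp add: inner_diff_left lt)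
    moreover have "emeasure lborel (box a b) = ennreal (\<Prod>i\<in>Basis. (b - a) \<bullet> i)"
      by (rule emeasure_lborel_box) (use lt less_imp_le in auto)
    ultimately show False by (metis ennreal_eq_0_iff not_less)
  qed
qed

end

section \<open>The critical exponent and the best Sobolev constant\<close>

locale sobolev_domain = bounded_domain \<Omega> for \<Omega> :: "'a::euclidean_space set" +
  fixes p :: real
  assumes dim: "2 < DIM('a)" and p_eq: "p = critical_exponent TYPE('a)"
begin

abbreviation "S \<equiv> sobolev_constant \<Omega>"

lemma p_gt_2: "2 < p"
  using dim by (simp add: p_eq critical_exponent_def field_simps)

lemma critical_integral_eq: "critical_integral \<Omega> u = (LINT x|M. \<bar>u x\<bar> powr p)"
  by (simp add: critical_integral_def set_integral_M p_eq)

lemma sobolev_const_bound_pos: "0 < sobolev_const_bound TYPE('a)"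
proof -
  have "unit_ball_vol (real DIM('a)) \<noteq> 0" using unit_ball_vol_pos[of "real DIM('a)"] by linarith
  then show ?thesis by (simp add: sobolev_const_bound_def Let_def)
qed

lemma sobolev_test:
  assumes \<phi>: "\<phi> \<in> test_functions \<Omega>"
  shows "integrable M (\<lambda>x. \<bar>\<phi> x\<bar> powr p)"
    "(LINT x|M. \<bar>\<phi> x\<bar> powr p) \<le> sobolev_const_bound TYPE('a) * energy_norm \<phi> powr p"
proof -
  note C = test_C1c[OF \<phi>]
  have ind: "indicator \<Omega> x *\<^sub>R \<bar>\<phi> x\<bar> powr p = \<bar>\<phi> x\<bar> powr p" for x
    using test_zero_outside[OF \<phi>, of x] by (auto simp: indicator_def)
  show "integrable M (\<lambda>x. \<bar>\<phi> x\<bar> powr p)"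
    unfolding integrable_restrict_space[OF dom_sets(2)] ind by (rule sobolev_C1c(1)[OF C dim, folded p_eq])
  have "(LINT x|M. \<bar>\<phi> x\<bar> powr p) = (LINT x|lborel. \<bar>\<phi> x\<bar> powr p)"
    unfolding integral_restrict_space[OF dom_sets(2)] ind ..
  also have "\<dots> \<le> sobolev_const_bound TYPE('a) * (LINT x|lborel. (norm (grad \<phi> x))\<^sup>2) powr (p / 2)"
    by (rule sobolev_C1c(2)[OF C dim, folded p_eq])
  also have "(LINT x|lborel. (norm (grad \<phi> x))\<^sup>2) = (energy_norm \<phi>)\<^sup>2"
    by (simp add: L2_norm_sq[symmetric] test_M(5)[OF \<phi>, symmetric] energy_norm_eq[OF has_weak_gradient_test[OF \<phi>]])
  also have "((energy_norm \<phi>)\<^sup>2) powr (p / 2) = energy_norm \<phi> powr p"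
    by (cases "energy_norm \<phi> = 0") (auto simp: powr_powr simp flip: powr_numeral)
  finally show "(LINT x|M. \<bar>\<phi> x\<bar> powr p) \<le> sobolev_const_bound TYPE('a) * energy_norm \<phi> powr p" .
qed

lemma H01_borel [measurable]: "u \<in> H01 \<Omega> \<Longrightarrow> u \<in> borel_measurable M"
  by (rule L2_measurable[OF H01_L2])

text \<open>Density of the test functions, and Fatou along a subsequence that converges almost
  everywhere. The bounds converge instead of being constant, hence the slack
  \<open>e\<close>.\<close>

lemma sobolev_H01:
  assumes u: "u \<in> H01 \<Omega>"
  shows "integrable M (\<lambda>x. \<bar>u x\<bar> powr p)"
    "(LINT x|M. \<bar>u x\<bar> powr p) \<le> sobolev_const_bound TYPE('a) * energy_norm u powr p"
proof -
  obtain \<phi> where \<phi>: "\<And>k. \<phi> k \<in> test_functions \<Omega>" "(\<lambda>k::nat. L2_norm M (\<phi> k - u)) \<longlonglongrightarrow> 0"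
    "(\<lambda>k. energy_norm (\<phi> k - u)) \<longlonglongrightarrow> 0" using H01_approx[OF u] by blast
  obtain r :: "nat \<Rightarrow> nat" where r: "strict_mono r" and lim: "AE x in M. (\<lambda>n. \<phi> (r n) x) \<longlonglongrightarrow> u x"
    using L2_AE_subseq[OF test_M(1)[OF \<phi>(1)] H01_L2[OF u] \<phi>(2)] by blast
  have lim_p: "AE x in M. (\<lambda>n. \<bar>\<phi> (r n) x\<bar> powr p) \<longlonglongrightarrow> \<bar>u x\<bar> powr p"
    using lim by eventually_elim (use p_gt_2 in \<open>auto intro!: tendsto_powr' tendsto_rabs\<close>)
  let ?B = "sobolev_const_bound TYPE('a) * energy_norm u powr p"
  have "(\<lambda>n. energy_norm (\<phi> n)) \<longlonglongrightarrow> energy_norm u"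
    by (rule H.nrm_LIMSEQ[OF test_H01[OF \<phi>(1)] u \<phi>(3)])
  then have "(\<lambda>n. energy_norm (\<phi> (r n))) \<longlonglongrightarrow> energy_norm u"
    using LIMSEQ_subseq_LIMSEQ[OF _ r] by (simp add: o_def)
  then have limB: "(\<lambda>n. sobolev_const_bound TYPE('a) * energy_norm (\<phi> (r n)) powr p) \<longlonglongrightarrow> ?B"
    using p_gt_2 by (intro tendsto_intros tendsto_powr') auto
  have ev: "\<forall>\<^sub>F n in sequentially. (LINT x|M. \<bar>\<phi> (r n) x\<bar> powr p) \<le> ?B + e" if "0 < e" for e
  proof -
    have "\<forall>\<^sub>F n in sequentially. sobolev_const_bound TYPE('a) * energy_norm (\<phi> (r n)) powr p < ?B + e"
      by (rule order_tendstoD[OF limB]) (use that in simp)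
    then show ?thesis by eventually_elim (use sobolev_test(2)[OF \<phi>(1)] in \<open>metis less_imp_le order_trans\<close>)
  qed
  have [measurable]: "u \<in> borel_measurable M" using u by measurable
  have meas: "(\<lambda>x. \<bar>u x\<bar> powr p) \<in> borel_measurable M" by measurable
  note F = Fatou_integral_le[OF sobolev_test(1)[OF \<phi>(1)] _ meas lim_p ev]
  show "integrable M (\<lambda>x. \<bar>u x\<bar> powr p)" using F(1)[of 1] by simp
  show "(LINT x|M. \<bar>u x\<bar> powr p) \<le> ?B"
    by (rule field_le_epsilon) (use F(2) in simp)
qed

lemma ae_nonzero_iff: "ae_nonzero \<Omega> u \<longleftrightarrow> \<not> (AE x in M. u x = 0)"
  by (simp add: ae_nonzero_def AE_restrict_space_iff[OF dom_sets(2)])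

lemma critical_integral_nonneg: "0 \<le> critical_integral \<Omega> u"
  by (simp add: critical_integral_eq)

lemma critical_integral_pos:
  assumes "u \<in> H01 \<Omega>" "ae_nonzero \<Omega> u"
  shows "0 < critical_integral \<Omega> u"
proof -
  have "critical_integral \<Omega> u \<noteq> 0"
    using assms integral_nonneg_eq_0_iff_AE[OF sobolev_H01(1)[OF assms(1)]] by (auto simp: critical_integral_eq ae_nonzero_iff)
  then show ?thesis using critical_integral_nonneg[of u] by linarith
qed

text \<open>The power \<open>2 / p\<close> of the crude inequality bounds every Sobolev quotient
  from below by one positive number, which explains the exponent \<open>- 2 / p\<close>. The
  explicit constant does not return after this.\<close>

lemma sobolev_constant_pos: "0 < S"
proof -
  let ?K = "sobolev_const_bound TYPE('a) powr (- 2 / p)"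
  have "?K \<le> S"
    unfolding sobolev_constant_def p_eq[symmetric]
  proof (rule cINF_greatest)
    show "{u \<in> H01 \<Omega>. ae_nonzero \<Omega> u} \<noteq> {}" using exists_nonzero_test test_H01 by blast
    fix u assume "u \<in> {u \<in> H01 \<Omega>. ae_nonzero \<Omega> u}"
    then have u: "u \<in> H01 \<Omega>" "ae_nonzero \<Omega> u" by auto
    note pos = critical_integral_pos[OF u]
    have "critical_integral \<Omega> u powr (2 / p) \<le> (sobolev_const_bound TYPE('a) * energy_norm u powr p) powr (2 / p)"
      using pos p_gt_2 sobolev_H01(2)[OF u(1)] by (intro powr_mono2) (auto simp: critical_integral_eq)
    also have "\<dots> = sobolev_const_bound TYPE('a) powr (2 / p) * (energy_norm u)\<^sup>2"
    proof -
      have "(energy_norm u powr p) powr (2 / p) = (energy_norm u)\<^sup>2"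
        using p_gt_2 by (cases "energy_norm u = 0") (auto simp: powr_powr)
      then show ?thesis using sobolev_const_bound_pos by (simp add: powr_mult)
    qed
    finally have "?K * critical_integral \<Omega> u powr (2 / p) \<le> (energy_norm u)\<^sup>2"
      using sobolev_const_bound_pos by (simp add: powr_minus field_simps)
    then show "?K \<le> dirichlet_energy \<Omega> u / critical_integral \<Omega> u powr (2 / p)"
      using pos by (simp add: dirichlet_energy_eq le_divide_eq)
  qed
  then show ?thesis using sobolev_const_bound_pos by (smt (verit) powr_gt_zero)
qed

lemma sobolev_inequality:
  assumes u: "u \<in> H01 \<Omega>"
  shows "critical_integral \<Omega> u \<le> (dirichlet_energy \<Omega> u / S) powr (p / 2)"
proof (cases "ae_nonzero \<Omega> u")
  case True
  note pos = critical_integral_pos[OF u True]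
  have "S \<le> dirichlet_energy \<Omega> u / critical_integral \<Omega> u powr (2 / p)"
    unfolding sobolev_constant_def p_eq[symmetric]
    by (rule cINF_lower) (use u True in \<open>auto intro!: bdd_belowI[of _ 0] simp: dirichlet_energy_eq\<close>)
  then have "critical_integral \<Omega> u powr (2 / p) \<le> dirichlet_energy \<Omega> u / S"
    using pos sobolev_constant_pos by (simp add: field_simps)
  then have "(critical_integral \<Omega> u powr (2 / p)) powr (p / 2) \<le> (dirichlet_energy \<Omega> u / S) powr (p / 2)"
    using p_gt_2 by (intro powr_mono2) auto
  then show ?thesis using pos p_gt_2 by (simp add: powr_powr)
next
  case False
  then have "critical_integral \<Omega> u = 0"
    unfolding ae_nonzero_iff critical_integral_eq
    using integral_nonneg_eq_0_iff_AE[OF sobolev_H01(1)[OF u]] by auto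
  then show ?thesis by simp
qed

end

section \<open>Compactness of the embedding into \<open>L\<^sup>2\<close>\<close>

context bounded_domain
begin

text \<open>By the Poincare inequality the pairing with \<open>f\<close> is bounded in the energy
  norm, hence represented by some \<open>w\<close> through \<open>D\<close>.\<close>

lemma weak_imp_weak_L2:
  assumes V: "\<And>n. V n \<in> H01 \<Omega>" and weak: "\<And>w. w \<in> H01 \<Omega> \<Longrightarrow> (\<lambda>n. D (V n) w) \<longlonglongrightarrow> 0"
    and f: "f \<in> L2 M"
  shows "(\<lambda>n. L2_inner M f (V n)) \<longlonglongrightarrow> 0"
proof -
  have "\<exists>w\<in>H01 \<Omega>. \<forall>v\<in>H01 \<Omega>. L2_inner M f v = D w v"
  proof (rule H.riesz[where C = "L2_norm M f * poincare_const"])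
    fix u assume u: "u \<in> H01 \<Omega>"
    have "\<bar>L2_inner M f u\<bar> \<le> L2_norm M f * L2_norm M u" by (rule L2.Cauchy_Schwarz[OF f H01_L2[OF u]])
    also have "\<dots> \<le> L2_norm M f * (poincare_const * energy_norm u)"
      by (intro mult_left_mono poincare u) simp
    finally show "\<bar>L2_inner M f u\<bar> \<le> L2_norm M f * poincare_const * energy_norm u" by (simp add: mult.assoc)
  qed (simp_all add: L2.bilin H01_L2 f)
  then obtain w where w: "w \<in> H01 \<Omega>" "\<And>v. v \<in> H01 \<Omega> \<Longrightarrow> L2_inner M f v = D w v" by blast
  have "L2_inner M f (V n) = D (V n) w" for n using w V H.sym by simp
  then show ?thesis using weak[OF w(1)] by simp
qed

text \<open>The ball average without its normalising factor. At a fixed \<open>x\<close> it is, on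
  test functions, an inner product with an indicator (\<open>ball_integral_test\<close>), so weak
  convergence controls it pointwise.\<close>

definition ball_integral :: "real \<Rightarrow> ('a \<Rightarrow> real) \<Rightarrow> 'a \<Rightarrow> real" where
  "ball_integral r \<phi> x = (LINT h|lborel. indicator (ball 0 r) h * \<phi> (x + h))"

lemma ball_integral_measurable:
  assumes [measurable]: "\<phi> \<in> borel_measurable borel"
  shows "ball_integral r \<phi> \<in> borel_measurable borel"
proof -
  have [measurable]: "ball (0::'a) r \<in> sets borel" by simp
  show ?thesis unfolding ball_integral_def[abs_def] by measurable
qed

lemma indicator_ball_L2: "(indicator (ball x r) :: 'a \<Rightarrow> real) \<in> L2 M"
proof -
  have "(\<lambda>y. (norm (indicator (ball x r) y :: real))\<^sup>2) = indicator (ball x r)"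
    by (auto simp: indicator_def)
  moreover have m: "(indicator (ball x r) :: 'a \<Rightarrow> real) \<in> borel_measurable M"
    by (intro borel_measurable_M borel_measurable_indicator) simp
  moreover have "integrable M (indicator (ball x r) :: 'a \<Rightarrow> real)"
    by (rule M.integrable_const_bound[where B = 1, OF _ m]) (auto simp: indicator_def)
  ultimately show ?thesis by (simp add: L2_def)
qed

lemma ball_integral_test:
  assumes \<phi>: "\<phi> \<in> test_functions \<Omega>"
  shows "ball_integral r \<phi> x = L2_inner M (indicator (ball x r)) \<phi>"
proof -
  note [measurable] = C1c_measurable(1)[OF test_C1c[OF \<phi>]]
  have [measurable]: "ball x r \<in> sets borel" by simp
  have "ball_integral r \<phi> x = (LINT h|lborel. (\<lambda>y. indicator (ball x r) y * \<phi> y) (h + x))"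
    unfolding ball_integral_def by (intro Bochner_Integration.integral_cong) (auto simp: indicator_def dist_norm add.commute)
  also have "\<dots> = (LINT y|lborel. indicator (ball x r) y * \<phi> y)"
    by (rule lborel_integral_translation(1)) measurable
  also have "\<dots> = L2_inner M (indicator (ball x r)) \<phi>"
    unfolding L2_inner_def integral_restrict_space[OF dom_sets(2)]
    by (intro Bochner_Integration.integral_cong) (use test_zero_outside[OF \<phi>] in \<open>auto simp: indicator_def\<close>)
  finally show ?thesis .
qed

text \<open>\<open>\<beta> * \<phi> x\<close> is the ball integral minus the integral of the
  increments \<open>g\<close>, and Cauchy-Schwarz over the ball bounds the square of the latter by
  \<open>\<beta>\<close> times the integral of \<open>g\<^sup>2\<close>.\<close>

lemma pointwise_ball_average:
  assumes C: "C1c \<phi> G" and r: "0 < r"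
  defines "\<beta> \<equiv> measure lborel (ball (0::'a) r)"
  shows "integrable lborel (\<lambda>h. indicator (ball 0 r) h * (\<phi> (x + h) - \<phi> x)\<^sup>2)"
    "\<beta> * (\<phi> x)\<^sup>2 \<le> 2 * (LINT h|lborel. indicator (ball 0 r) h * (\<phi> (x + h) - \<phi> x)\<^sup>2) + 2 / \<beta> * (ball_integral r \<phi> x)\<^sup>2"
proof -
  note [measurable] = C1c_measurable(1)[OF C]
  have \<beta>: "0 < \<beta>" unfolding \<beta>_def using content_ball_pos[OF r] by simp
  obtain K where K: "\<And>x. \<bar>\<phi> x\<bar> \<le> K" using C1c_bounds[OF C] by metis
  then have K2: "\<bar>\<phi> (x + h) - \<phi> x\<bar> \<le> 2 * K" for h using K[of "x + h"] K[of x] by linarith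
  \<comment> \<open>The ball is itself a bounded domain, so the L2 facts for finite measures apply
    to functions of the shift \<open>h\<close>.\<close>
  interpret B: bounded_domain "ball (0::'a) r" by unfold_locales (use r in auto)
  define g where "g h = \<phi> (x + h) - \<phi> x" for h
  have gm[measurable]: "g \<in> borel_measurable borel" unfolding g_def by measurable
  have g2: "integrable B.M (\<lambda>h. (norm (g h))\<^sup>2)"
  proof (rule B.M.integrable_const_bound[where B = "(2 * K)\<^sup>2"])
    have "(norm (g h))\<^sup>2 \<le> (2 * K)\<^sup>2" for h using K2[of h] by (intro power_mono) (auto simp: g_def)
    then show "AE h in B.M. norm ((norm (g h))\<^sup>2) \<le> (2 * K)\<^sup>2" by simp
    show "(\<lambda>h. (norm (g h))\<^sup>2) \<in> borel_measurable B.M" by (intro B.borel_measurable_M) measurable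
  qed
  then have gL: "g \<in> L2 B.M" by (auto simp: L2_def intro: B.borel_measurable_M gm)
  have g1: "integrable B.M g" by (rule B.M.L2_integral_norm_le(1)[OF gL])
  have sp: "measure B.M (space B.M) = \<beta>"
    by (simp add: B.space_M measure_restrict_space \<beta>_def)
  show "integrable lborel (\<lambda>h. indicator (ball 0 r) h * (\<phi> (x + h) - \<phi> x)\<^sup>2)"
    using g2 by (simp add: integrable_restrict_space g_def)
  have J: "(LINT h|lborel. indicator (ball 0 r) h * (\<phi> (x + h) - \<phi> x)\<^sup>2) = (L2_norm B.M g)\<^sup>2"
    by (simp add: L2_norm_sq integral_restrict_space g_def)
  have m: "ball_integral r \<phi> x = (LINT h|B.M. g h) + \<beta> * \<phi> x"
  proof -
    have "ball_integral r \<phi> x = (LINT h|B.M. \<phi> (x + h))"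
      by (simp add: ball_integral_def integral_restrict_space)
    also have "\<dots> = (LINT h|B.M. g h + \<phi> x)" by (simp add: g_def)
    also have "\<dots> = (LINT h|B.M. g h) + \<beta> * \<phi> x"
      using g1 sp by (subst Bochner_Integration.integral_add) auto
    finally show ?thesis .
  qed
  have "\<bar>LINT h|B.M. g h\<bar> \<le> (LINT h|B.M. norm (g h))" using integral_norm_bound[of B.M g] by simp
  also have "\<dots> \<le> sqrt \<beta> * L2_norm B.M g" using B.M.L2_integral_norm_le(2)[OF gL] sp by simp
  finally have "(LINT h|B.M. g h)\<^sup>2 \<le> (sqrt \<beta> * L2_norm B.M g)\<^sup>2" by (simp add: abs_le_square_iff[symmetric])
  also have "\<dots> = \<beta> * (L2_norm B.M g)\<^sup>2" using \<beta> by (simp add: power_mult_distrib)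
  finally have I2: "(LINT h|B.M. g h)\<^sup>2 \<le> \<beta> * (L2_norm B.M g)\<^sup>2" .
  have "(\<beta> * \<phi> x)\<^sup>2 \<le> 2 * (ball_integral r \<phi> x)\<^sup>2 + 2 * (LINT h|B.M. g h)\<^sup>2"
    using norm_add_power2_le[of "ball_integral r \<phi> x" "- (LINT h|B.M. g h)"] m by simp
  also have "\<dots> \<le> 2 * (ball_integral r \<phi> x)\<^sup>2 + 2 * (\<beta> * (L2_norm B.M g)\<^sup>2)" using I2 by simp
  finally have "\<beta> * (\<beta> * (\<phi> x)\<^sup>2) \<le> \<beta> * (2 * (L2_norm B.M g)\<^sup>2 + 2 / \<beta> * (ball_integral r \<phi> x)\<^sup>2)"
    using \<beta> by (simp add: power2_eq_square algebra_simps)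
  then show "\<beta> * (\<phi> x)\<^sup>2 \<le> 2 * (LINT h|lborel. indicator (ball 0 r) h * (\<phi> (x + h) - \<phi> x)\<^sup>2) + 2 / \<beta> * (ball_integral r \<phi> x)\<^sup>2"
    unfolding J using \<beta> by simp
qed

lemma ball_integral_bound:
  assumes \<phi>: "\<phi> \<in> test_functions \<Omega>"
  shows "\<bar>ball_integral r \<phi> x\<bar> \<le> sqrt (measure M \<Omega>) * L2_norm M \<phi>"
proof -
  have 1: "(\<lambda>x. 1::real) \<in> L2 M" by (simp add: L2_def)
  have "\<bar>ball_integral r \<phi> x\<bar> \<le> L2_norm M (indicator (ball x r) :: 'a \<Rightarrow> real) * L2_norm M \<phi>"
    unfolding ball_integral_test[OF \<phi>] by (rule L2.Cauchy_Schwarz[OF indicator_ball_L2 test_M(1)[OF \<phi>]])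
  also have "L2_norm M (indicator (ball x r) :: 'a \<Rightarrow> real) \<le> L2_norm M (\<lambda>x. 1::real)"
    unfolding L2_norm_def
    by (intro real_sqrt_le_mono integral_mono L2_integrable indicator_ball_L2 1) (auto simp: indicator_def)
  also have "L2_norm M (\<lambda>x. 1::real) = sqrt (measure M \<Omega>)"
    using space_M by (simp add: L2_norm_def)
  finally show ?thesis by (simp add: mult_right_mono)
qed

text \<open>When the pointwise estimate is integrated over the domain and the integrals are
  exchanged, shifts shorter than \<open>r\<close> cost at most \<open>r\<^sup>2\<close> times the
  energy. What remains sees \<open>\<phi>\<close> only through its ball integrals.\<close>

lemma test_L2_ball_estimate:
  assumes \<phi>: "\<phi> \<in> test_functions \<Omega>" and r: "0 < r"
  defines "\<beta> \<equiv> measure lborel (ball (0::'a) r)"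
  shows "(L2_norm M \<phi>)\<^sup>2 \<le> 2 * r\<^sup>2 * (energy_norm \<phi>)\<^sup>2 + 2 / \<beta>\<^sup>2 * (LINT x|M. (ball_integral r \<phi> x)\<^sup>2)"
proof -
  note C = test_C1c[OF \<phi>]
  note [measurable] = C1c_measurable(1)[OF C] ball_integral_measurable[OF C1c_measurable(1)[OF C]]
  have \<beta>: "0 < \<beta>" unfolding \<beta>_def using content_ball_pos[OF r] by simp
  have [measurable]: "ball (0::'a) r \<in> sets borel" by simp
  let ?A = "ball (0::'a) r"
  let ?J = "\<lambda>x. LINT h|lborel. indicator ?A h * (\<phi> (x + h) - \<phi> x)\<^sup>2"
  let ?m = "\<lambda>x. 2 / \<beta> * (ball_integral r \<phi> x)\<^sup>2"
  have mint: "integrable M ?m"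
  proof (intro integrable_mult_right M.integrable_const_bound)
    have "(ball_integral r \<phi> x)\<^sup>2 \<le> (sqrt (measure M \<Omega>) * L2_norm M \<phi>)\<^sup>2" for x
      using ball_integral_bound[OF \<phi>, of r x] by (intro abs_le_square_iff[THEN iffD1]) simp
    then show "AE x in M. norm ((ball_integral r \<phi> x)\<^sup>2) \<le> (sqrt (measure M \<Omega>) * L2_norm M \<phi>)\<^sup>2" by simp
    show "(\<lambda>x. (ball_integral r \<phi> x)\<^sup>2) \<in> borel_measurable M" by (intro borel_measurable_M) measurable
  qed
  have En: "energy_norm \<phi> = L2_norm lborel (grad \<phi>)"
    by (simp add: energy_norm_eq[OF has_weak_gradient_test[OF \<phi>]] test_M(5)[OF \<phi>])
  have J: "(\<integral>\<^sup>+x. ennreal (?J x) \<partial>M) \<le> ennreal (\<beta> * (r\<^sup>2 * (energy_norm \<phi>)\<^sup>2))"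
  proof -
    have fm[measurable]: "(\<lambda>(x, h). ennreal (indicator ?A h * (\<phi> (x + h) - \<phi> x)\<^sup>2)) \<in> borel_measurable (lborel \<Otimes>\<^sub>M lborel)"
      by measurable
    have "(\<integral>\<^sup>+x. ennreal (?J x) \<partial>M) = (\<integral>\<^sup>+x. ennreal (?J x) * indicator \<Omega> x \<partial>lborel)"
      by (rule nn_integral_restrict_space[OF dom_sets(2)])
    also have "\<dots> \<le> (\<integral>\<^sup>+x. ennreal (?J x) \<partial>lborel)"
      by (intro nn_integral_mono) (auto simp: indicator_def)
    also have "\<dots> = (\<integral>\<^sup>+x. \<integral>\<^sup>+h. ennreal (indicator ?A h * (\<phi> (x + h) - \<phi> x)\<^sup>2) \<partial>lborel \<partial>lborel)"
      by (simp add: nn_integral_eq_integral pointwise_ball_average(1)[OF C r])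
    also have "\<dots> = (\<integral>\<^sup>+h. \<integral>\<^sup>+x. ennreal (indicator ?A h * (\<phi> (x + h) - \<phi> x)\<^sup>2) \<partial>lborel \<partial>lborel)"
      by (rule lborel_pair.Fubini'[symmetric]) (rule fm)
    also have "\<dots> \<le> (\<integral>\<^sup>+h. ennreal (r\<^sup>2 * (energy_norm \<phi>)\<^sup>2) * indicator ?A h \<partial>lborel)"
    proof (rule nn_integral_mono)
      fix h
      show "(\<integral>\<^sup>+x. ennreal (indicator ?A h * (\<phi> (x + h) - \<phi> x)\<^sup>2) \<partial>lborel) \<le> ennreal (r\<^sup>2 * (energy_norm \<phi>)\<^sup>2) * indicator ?A h"
      proof (cases "h \<in> ?A")
        case True
        have "(\<integral>\<^sup>+x. ennreal (indicator ?A h * (\<phi> (x + h) - \<phi> x)\<^sup>2) \<partial>lborel) = ennreal (LINT x|lborel. (\<phi> (x + h) - \<phi> x)\<^sup>2)"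
          using True by (simp add: nn_integral_eq_integral C1c_translation[OF C])
        also have "\<dots> \<le> ennreal ((norm h)\<^sup>2 * (energy_norm \<phi>)\<^sup>2)"
          unfolding En L2_norm_sq by (intro ennreal_leI C1c_translation[OF C])
        also have "\<dots> \<le> ennreal (r\<^sup>2 * (energy_norm \<phi>)\<^sup>2)"
          using True by (intro ennreal_leI mult_right_mono power_mono) auto
        finally show ?thesis using True by simp
      qed simp
    qed
    also have "\<dots> = ennreal (r\<^sup>2 * (energy_norm \<phi>)\<^sup>2) * emeasure lborel ?A" by (simp add: nn_integral_cmult)
    also have "\<dots> = ennreal (\<beta> * (r\<^sup>2 * (energy_norm \<phi>)\<^sup>2))"
    proof -
      have "emeasure lborel ?A = ennreal \<beta>"
        unfolding \<beta>_def by (intro emeasure_eq_ennreal_measure) (use emeasure_bounded_finite[of ?A] in auto)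
      then show ?thesis using \<beta> by (simp add: mult.commute flip: ennreal_mult)
    qed
    finally show ?thesis .
  qed
  have Jm: "?J \<in> borel_measurable M" by (intro borel_measurable_M) measurable
  have "ennreal (\<beta> * (L2_norm M \<phi>)\<^sup>2) = (\<integral>\<^sup>+x. ennreal (\<beta> * (\<phi> x)\<^sup>2) \<partial>M)"
    using \<beta> L2_integrable[OF test_M(1)[OF \<phi>]] by (subst nn_integral_eq_integral) (auto simp: L2_norm_sq)
  also have "\<dots> \<le> (\<integral>\<^sup>+x. ennreal (2 * ?J x + ?m x) \<partial>M)"
    unfolding \<beta>_def by (intro nn_integral_mono ennreal_leI pointwise_ball_average(2)[OF C r])
  also have "\<dots> = (\<integral>\<^sup>+x. 2 * ennreal (?J x) + ennreal (?m x) \<partial>M)"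
  proof (rule nn_integral_cong)
    fix x
    have "0 \<le> ?J x" by (intro integral_nonneg_AE AE_I2) simp
    moreover have "0 \<le> ?m x" using \<beta> by simp
    ultimately show "ennreal (2 * ?J x + ?m x) = 2 * ennreal (?J x) + ennreal (?m x)"
      by (subst ennreal_plus) (simp_all add: ennreal_mult)
  qed
  also have "\<dots> = 2 * (\<integral>\<^sup>+x. ennreal (?J x) \<partial>M) + (\<integral>\<^sup>+x. ennreal (?m x) \<partial>M)"
    using Jm mint by (subst nn_integral_add) (auto simp: nn_integral_cmult)
  also have "(\<integral>\<^sup>+x. ennreal (?m x) \<partial>M) = ennreal (LINT x|M. ?m x)"
    using \<beta> mint by (intro nn_integral_eq_integral) auto
  also have "2 * (\<integral>\<^sup>+x. ennreal (?J x) \<partial>M) + ennreal (LINT x|M. ?m x) \<le> 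
      2 * ennreal (\<beta> * (r\<^sup>2 * (energy_norm \<phi>)\<^sup>2)) + ennreal (LINT x|M. ?m x)"
    by (intro add_right_mono mult_left_mono J) simp
  also have "\<dots> = ennreal (2 * (\<beta> * (r\<^sup>2 * (energy_norm \<phi>)\<^sup>2)) + (LINT x|M. ?m x))"
    using \<beta> by (subst ennreal_plus) (auto simp: ennreal_mult)
  finally have "\<beta> * (L2_norm M \<phi>)\<^sup>2 \<le> 2 * (\<beta> * (r\<^sup>2 * (energy_norm \<phi>)\<^sup>2)) + (LINT x|M. ?m x)"
    using \<beta> by (subst (asm) ennreal_le_iff) auto
  also have "\<dots> = \<beta> * (2 * r\<^sup>2 * (energy_norm \<phi>)\<^sup>2 + 2 / \<beta>\<^sup>2 * (LINT x|M. (ball_integral r \<phi> x)\<^sup>2))"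
    using \<beta> by (simp add: power2_eq_square algebra_simps)
  finally show ?thesis using \<beta> by simp
qed

text \<open>The radius is fixed first, to make the energy term small uniformly in \<open>n\<close>;
  for that radius the ball integrals tend to 0 pointwise by weak convergence and are uniformly
  bounded, so dominated convergence applies.\<close>

lemma rellich_test:
  assumes \<phi>: "\<And>n. \<phi> n \<in> test_functions \<Omega>" and bd: "\<And>n. energy_norm (\<phi> n) \<le> K"
    and weak: "\<And>f. f \<in> L2 M \<Longrightarrow> (\<lambda>n. L2_inner M f (\<phi> n)) \<longlonglongrightarrow> 0"
  shows "(\<lambda>n. (L2_norm M (\<phi> n))\<^sup>2) \<longlonglongrightarrow> 0"
proof (rule LIMSEQ_I)
  fix e :: real assume e: "0 < e"
  have K: "0 \<le> K" using order_trans[OF energy_norm_nonneg bd[of 0]] .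
  \<comment> \<open>With \<open>r\<^sup>2 = e / X\<close> the energy term is at most
    \<open>e / 2\<close>; adding 1 keeps \<open>X\<close> positive when
    \<open>K = 0\<close>.\<close>
  define X where "X = 4 * (K\<^sup>2 + 1)"
  have X: "0 < X" by (simp add: X_def add_nonneg_pos)
  define r where "r = sqrt (e / X)"
  have r: "0 < r" using e X by (simp add: r_def)
  have rK: "2 * r\<^sup>2 * K\<^sup>2 < e"
  proof -
    have "r\<^sup>2 * X = e" using e X by (simp add: r_def)
    moreover have "2 * r\<^sup>2 * K\<^sup>2 \<le> r\<^sup>2 * X / 2" by (simp add: X_def algebra_simps)
    ultimately show ?thesis using e by linarith
  qed
  define \<beta> where "\<beta> = measure lborel (ball (0::'a) r)"
  define c where "c = sqrt (measure M \<Omega>) * (poincare_const * K)"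
  have mb: "\<bar>ball_integral r (\<phi> n) x\<bar> \<le> c" for n x
  proof -
    have "L2_norm M (\<phi> n) \<le> poincare_const * K"
      using poincare_const(2)[OF \<phi>] mult_left_mono[OF bd less_imp_le[OF poincare_const(1)]] by (rule order_trans)
    then have "sqrt (measure M \<Omega>) * L2_norm M (\<phi> n) \<le> c" unfolding c_def by (rule mult_left_mono) simp
    then show ?thesis using ball_integral_bound[OF \<phi>] by (rule order_trans[rotated])
  qed
  have "(\<lambda>n. LINT x|M. (ball_integral r (\<phi> n) x)\<^sup>2) \<longlonglongrightarrow> (LINT x|M. 0)"
  proof (rule integral_dominated_convergence[where w = "\<lambda>x. c\<^sup>2"])
    show "(\<lambda>x. (ball_integral r (\<phi> n) x)\<^sup>2) \<in> borel_measurable M" for n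
      by (intro borel_measurable_M borel_measurable_power ball_integral_measurable C1c_measurable(1)[OF test_C1c[OF \<phi>]])
    show "AE x in M. (\<lambda>n. (ball_integral r (\<phi> n) x)\<^sup>2) \<longlonglongrightarrow> 0"
      using tendsto_power[OF weak[OF indicator_ball_L2], of _ r 2] by (simp add: ball_integral_test[OF \<phi>])
    show "AE x in M. norm ((ball_integral r (\<phi> n) x)\<^sup>2) \<le> c\<^sup>2" for n
    proof (rule AE_I2)
      fix x show "norm ((ball_integral r (\<phi> n) x)\<^sup>2) \<le> c\<^sup>2"
        using power_mono[OF mb[of n x], of 2] by simp
    qed
  qed auto
  from tendsto_add[OF tendsto_const tendsto_mult[OF tendsto_const this], of "2 * r\<^sup>2 * K\<^sup>2" "2 / \<beta>\<^sup>2"]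
  have lim: "(\<lambda>n. 2 * r\<^sup>2 * K\<^sup>2 + 2 / \<beta>\<^sup>2 * (LINT x|M. (ball_integral r (\<phi> n) x)\<^sup>2)) \<longlonglongrightarrow> 2 * r\<^sup>2 * K\<^sup>2" by simp
  have "\<forall>\<^sub>F n in sequentially. 2 * r\<^sup>2 * K\<^sup>2 + 2 / \<beta>\<^sup>2 * (LINT x|M. (ball_integral r (\<phi> n) x)\<^sup>2) < e"
    by (rule order_tendstoD(2)[OF lim rK])
  then have "\<forall>\<^sub>F n in sequentially. norm ((L2_norm M (\<phi> n))\<^sup>2 - 0) < e"
  proof eventually_elim
    case (elim n)
    have "(L2_norm M (\<phi> n))\<^sup>2 \<le> 2 * r\<^sup>2 * (energy_norm (\<phi> n))\<^sup>2 + 2 / \<beta>\<^sup>2 * (LINT x|M. (ball_integral r (\<phi> n) x)\<^sup>2)"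
      unfolding \<beta>_def by (rule test_L2_ball_estimate[OF \<phi> r])
    also have "2 * r\<^sup>2 * (energy_norm (\<phi> n))\<^sup>2 \<le> 2 * r\<^sup>2 * K\<^sup>2"
      by (intro mult_left_mono power_mono bd) auto
    finally show ?case using elim by simp
  qed
  then show "\<exists>no. \<forall>n\<ge>no. norm ((L2_norm M (\<phi> n))\<^sup>2 - 0) < e" by (simp add: eventually_sequentially)
qed

lemma H01_close_test:
  assumes u: "u \<in> H01 \<Omega>" and e: "0 < e"
  obtains \<phi> where "\<phi> \<in> test_functions \<Omega>" "energy_norm (\<phi> - u) < e"
proof -
  obtain \<phi> where \<phi>: "\<And>k. \<phi> k \<in> test_functions \<Omega>" "(\<lambda>k::nat. energy_norm (\<phi> k - u)) \<longlonglongrightarrow> 0"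
    using H01_approx[OF u] by metis
  have "\<forall>\<^sub>F k in sequentially. energy_norm (\<phi> k - u) < e" by (rule order_tendstoD(2)[OF \<phi>(2) e])
  then show thesis using \<phi>(1) that by (auto simp: eventually_sequentially)
qed

text \<open>Each \<open>V n\<close> is replaced by a test function at energy distance below
  \<open>1 / (n + 1)\<close>, which changes neither boundedness nor the weak limit.\<close>

lemma rellich:
  assumes V: "\<And>n. V n \<in> H01 \<Omega>" and bd: "\<And>n. energy_norm (V n) \<le> K"
    and weak: "\<And>w. w \<in> H01 \<Omega> \<Longrightarrow> (\<lambda>n. D (V n) w) \<longlonglongrightarrow> 0"
  shows "(\<lambda>n. L2_norm M (V n)) \<longlonglongrightarrow> 0"
proof -
  have "\<exists>\<phi>. \<phi> \<in> test_functions \<Omega> \<and> energy_norm (\<phi> - V n) < 1 / real (Suc n)" for n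
    using H01_close_test[OF V, of "1 / real (Suc n)" n] by auto
  then obtain \<phi> where \<phi>: "\<And>n. \<phi> n \<in> test_functions \<Omega>" "\<And>n. energy_norm (\<phi> n - V n) < 1 / real (Suc n)" by metis
  have dH: "\<phi> n - V n \<in> H01 \<Omega>" for n by (intro H.mems V test_H01 \<phi>)
  have inv: "(\<lambda>n. poincare_const * (1 / real (Suc n))) \<longlonglongrightarrow> 0" 
    using tendsto_mult_right_zero[OF LIMSEQ_inverse_real_of_nat] by (simp add: inverse_eq_divide)
  have d: "(\<lambda>n. L2_norm M (\<phi> n - V n)) \<longlonglongrightarrow> 0"
  proof (rule Lim_null_comparison[OF _ inv])
    have "L2_norm M (\<phi> n - V n) \<le> poincare_const * (1 / real (Suc n))" for n
      using poincare[OF dH] mult_left_mono[OF less_imp_le[OF \<phi>(2)] less_imp_le[OF poincare_const(1)]] by (rule order_trans)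
    then show "\<forall>\<^sub>F n in sequentially. norm (L2_norm M (\<phi> n - V n)) \<le> poincare_const * (1 / real (Suc n))" by simp
  qed
  have "(\<lambda>n. (L2_norm M (\<phi> n))\<^sup>2) \<longlonglongrightarrow> 0"
  proof (rule rellich_test[OF \<phi>(1)])
    fix n
    have "energy_norm (\<phi> n) \<le> energy_norm (V n) + energy_norm (\<phi> n - V n)"
      using H.nrm_triangle[OF V dH, of n n] by simp
    also have "1 / real (Suc n) \<le> 1" by simp
    then have "energy_norm (V n) + energy_norm (\<phi> n - V n) \<le> K + 1" using bd[of n] \<phi>(2)[of n] by linarith
    finally show "energy_norm (\<phi> n) \<le> K + 1" .
  next
    fix f :: "'a \<Rightarrow> real" assume f: "f \<in> L2 M"
    have "(\<lambda>n. L2_inner M f (V n)) \<longlonglongrightarrow> 0" by (rule weak_imp_weak_L2[OF V weak f])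
    moreover have "(\<lambda>n. L2_inner M f (\<phi> n - V n)) \<longlonglongrightarrow> 0"
    proof (rule Lim_null_comparison)
      show "\<forall>\<^sub>F n in sequentially. norm (L2_inner M f (\<phi> n - V n)) \<le> L2_norm M f * L2_norm M (\<phi> n - V n)"
        using L2.Cauchy_Schwarz[OF f H01_L2[OF dH]] by simp
      show "(\<lambda>n. L2_norm M f * L2_norm M (\<phi> n - V n)) \<longlonglongrightarrow> 0" by (rule tendsto_mult_right_zero[OF d])
    qed
    moreover have "L2_inner M f (\<phi> n) = L2_inner M f (V n) + L2_inner M f (\<phi> n - V n)" for n
      using f H01_L2[OF V] test_M(1)[OF \<phi>(1)] by (simp add: L2.bilin)
    ultimately show "(\<lambda>n. L2_inner M f (\<phi> n)) \<longlonglongrightarrow> 0" using tendsto_add[of _ 0 sequentially _ 0] by simp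
  qed
  from tendsto_real_sqrt[OF this] have p: "(\<lambda>n. L2_norm M (\<phi> n)) \<longlonglongrightarrow> 0" by simp
  show ?thesis
  proof (rule Lim_null_comparison)
    have "L2_norm M (V n) \<le> L2_norm M (\<phi> n) + L2_norm M (\<phi> n - V n)" for n
      using L2.nrm_triangle_diff[OF test_M(1)[OF \<phi>(1)] H01_L2[OF dH], of n n] by simp
    then show "\<forall>\<^sub>F n in sequentially. norm (L2_norm M (V n)) \<le> L2_norm M (\<phi> n) + L2_norm M (\<phi> n - V n)" by simp
    show "(\<lambda>n. L2_norm M (\<phi> n) + L2_norm M (\<phi> n - V n)) \<longlonglongrightarrow> 0" using tendsto_add[OF p d] by simp
  qed
qed

lemma weakly_convergent_subseq:
  assumes U: "\<And>n. U n \<in> H01 \<Omega>" and bd: "\<And>n. energy_norm (U n) \<le> K"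
  obtains u r where "u \<in> H01 \<Omega>" "strict_mono (r :: nat \<Rightarrow> nat)"
    "\<And>w. w \<in> H01 \<Omega> \<Longrightarrow> (\<lambda>n. D (U (r n) - u) w) \<longlonglongrightarrow> 0" "(\<lambda>n. L2_norm M (U (r n) - u)) \<longlonglongrightarrow> 0"
proof -
  obtain u and r :: "nat \<Rightarrow> nat" where ur: "u \<in> H01 \<Omega>" "strict_mono r" "\<And>v. v \<in> H01 \<Omega> \<Longrightarrow> (\<lambda>n. D (U (r n)) v) \<longlonglongrightarrow> D u v"
    using H.weakly_compact[of U K, OF U bd] by blast
  have weak: "(\<lambda>n. D (U (r n) - u) w) \<longlonglongrightarrow> 0" if w: "w \<in> H01 \<Omega>" for w
    using tendsto_diff[OF ur(3)[OF w] tendsto_const, of "D u w"] w ur(1) U by (simp add: H.bilin)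
  have "(\<lambda>n. L2_norm M (U (r n) - u)) \<longlonglongrightarrow> 0"
  proof (rule rellich[OF _ _ weak])
    show "U (r n) - u \<in> H01 \<Omega>" for n by (intro H.mems U ur)
    show "energy_norm (U (r n) - u) \<le> K + energy_norm u" for n
      using H.nrm_triangle_diff[OF U ur(1), of "r n"] bd[of "r n"] by linarith
  qed
  then show thesis using that[OF ur(1,2) weak] by blast
qed

section \<open>The first Dirichlet eigenvalue\<close>

lemma L2_norm_pos_iff: "u \<in> H01 \<Omega> \<Longrightarrow> ae_nonzero \<Omega> u \<longleftrightarrow> 0 < L2_norm M u"
proof -
  assume u: "u \<in> H01 \<Omega>"
  have "ae_nonzero \<Omega> u \<longleftrightarrow> L2_norm M u \<noteq> 0"
    using L2_norm_eq_0_iff[OF H01_L2[OF u]] by (simp add: ae_nonzero_def AE_restrict_space_iff[OF dom_sets(2)])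
  then show ?thesis using L2_norm_nonneg[of M u] by linarith
qed

text \<open>Direct method. Compactness in L2 preserves the constraint \<open>L2_norm M u = 1\<close>
  in the weak limit, while the energy can only drop, since the square of
  \<open>energy_norm (U (r n) - u)\<close> is discarded.\<close>

lemma rayleigh_minimizer:
  obtains u where "u \<in> H01 \<Omega>" "L2_norm M u = 1"
    "\<And>v. v \<in> H01 \<Omega> \<Longrightarrow> (energy_norm u)\<^sup>2 * (L2_norm M v)\<^sup>2 \<le> (energy_norm v)\<^sup>2"
proof -
  define R where "R = (\<lambda>u. (energy_norm u)\<^sup>2) ` {u \<in> H01 \<Omega>. L2_norm M u = 1}"
  define m where "m = Inf R"
  obtain \<phi> where "\<phi> \<in> H01 \<Omega>" "0 < L2_norm M \<phi>" using exists_nonzero_test test_H01 L2_norm_pos_iff by blast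
  then have "(1 / L2_norm M \<phi>) *\<^sub>R \<phi> \<in> {u \<in> H01 \<Omega>. L2_norm M u = 1}"
    by (auto simp: H.mems L2.nrm_scale H01_L2)
  then have ne: "R \<noteq> {}" by (auto simp: R_def)
  have bdd: "bdd_below R" by (auto simp: R_def intro!: bdd_belowI[of _ 0])
  have m_le: "m \<le> (energy_norm v)\<^sup>2" if "v \<in> H01 \<Omega>" "L2_norm M v = 1" for v
    unfolding m_def by (rule cInf_lower[OF _ bdd]) (use that in \<open>auto simp: R_def\<close>)
  have "\<exists>v. v \<in> H01 \<Omega> \<and> L2_norm M v = 1 \<and> (energy_norm v)\<^sup>2 < m + 1 / real (Suc n)" for n
  proof -
    have "\<exists>x\<in>R. x < m + 1 / real (Suc n)" by (rule cInf_lessD[OF ne]) (simp add: m_def)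
    then show ?thesis by (auto simp: R_def)
  qed
  then obtain U where U: "\<And>n. U n \<in> H01 \<Omega>" "\<And>n. L2_norm M (U n) = 1" "\<And>n. (energy_norm (U n))\<^sup>2 < m + 1 / real (Suc n)"
    by metis
  have "energy_norm (U n) \<le> sqrt (m + 1)" for n
  proof (rule real_le_rsqrt)
    have "1 / real (Suc n) \<le> 1" by simp
    then show "(energy_norm (U n))\<^sup>2 \<le> m + 1" using U(3)[of n] by linarith
  qed
  then obtain u r where ur: "u \<in> H01 \<Omega>" "strict_mono (r :: nat \<Rightarrow> nat)"
    "\<And>w. w \<in> H01 \<Omega> \<Longrightarrow> (\<lambda>n. D (U (r n) - u) w) \<longlonglongrightarrow> 0" "(\<lambda>n. L2_norm M (U (r n) - u)) \<longlonglongrightarrow> 0"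
    using weakly_convergent_subseq[of U "sqrt (m + 1)", OF U(1)] by metis
  have "(\<lambda>n. L2_norm M (U (r n))) \<longlonglongrightarrow> L2_norm M u"
    by (rule L2.nrm_LIMSEQ[OF _ _ ur(4)]) (use U ur H01_L2 in auto)
  then have u1: "L2_norm M u = 1" using U(2) by (simp add: LIMSEQ_const_iff)
  have "(energy_norm u)\<^sup>2 \<le> m"
  proof (rule LIMSEQ_le)
    have "(\<lambda>n. m + 1 / real (Suc (r n)) - 2 * D (U (r n) - u) u) \<longlonglongrightarrow> m + 0 - 2 * 0"
      by (intro tendsto_intros ur(3)[OF ur(1)] LIMSEQ_subseq_LIMSEQ[OF LIMSEQ_inverse_real_of_nat[unfolded inverse_eq_divide] ur(2), unfolded o_def])
    then show "(\<lambda>n. m + 1 / real (Suc (r n)) - 2 * D (U (r n) - u) u) \<longlonglongrightarrow> m" by simp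
    have "(energy_norm u)\<^sup>2 \<le> m + 1 / real (Suc (r n)) - 2 * D (U (r n) - u) u" for n
    proof -
      have V: "U (r n) - u \<in> H01 \<Omega>" by (intro H.mems U ur)
      have "(energy_norm (U (r n)))\<^sup>2 = D ((U (r n) - u) + u) ((U (r n) - u) + u)" by (simp add: D_self)
      also have "\<dots> = (energy_norm (U (r n) - u))\<^sup>2 + 2 * D (U (r n) - u) u + (energy_norm u)\<^sup>2"
        using H.quad_expand[OF V ur(1), of 1] by (simp only: D_self scaleR_one mult_1_right power_one mult_1)
      finally show ?thesis using U(3)[of "r n"] zero_le_power2[of "energy_norm (U (r n) - u)"] by linarith
    qed
    then show "\<exists>N. \<forall>n\<ge>N. (energy_norm u)\<^sup>2 \<le> m + 1 / real (Suc (r n)) - 2 * D (U (r n) - u) u" by blast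
  qed (rule tendsto_const)
  then have um: "(energy_norm u)\<^sup>2 = m" using m_le[OF ur(1) u1] by simp
  have "(energy_norm u)\<^sup>2 * (L2_norm M v)\<^sup>2 \<le> (energy_norm v)\<^sup>2" if v: "v \<in> H01 \<Omega>" for v
  proof (cases "L2_norm M v = 0")
    case False
    then have pos: "0 < L2_norm M v" using L2_norm_nonneg[of M v] by linarith
    have "m \<le> (energy_norm ((1 / L2_norm M v) *\<^sub>R v))\<^sup>2"
      by (rule m_le) (use pos v in \<open>auto simp: H.mems L2.nrm_scale H01_L2\<close>)
    also have "\<dots> = (energy_norm v)\<^sup>2 / (L2_norm M v)\<^sup>2" using v by (simp add: H.nrm_scale power_divide power_mult_distrib)
    finally show ?thesis using pos um by (simp add: pos_le_divide_eq)
  qed simp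
  then show thesis using that ur(1) u1 by blast
qed

lemma dirichlet_eigenvalue_iff:
  "dirichlet_eigenvalue \<Omega> \<mu> \<longleftrightarrow> (\<exists>u\<in>H01 \<Omega>. ae_nonzero \<Omega> u \<and> (\<forall>v\<in>H01 \<Omega>. D u v = \<mu> * L2_inner M u v))"
  unfolding dirichlet_eigenvalue_def D_def L2_inner_def set_integral_M by simp

text \<open>\<open>first_dirichlet_eigenvalue\<close> is a \<open>LEAST\<close>, so it says nothing
  until a smallest eigenvalue exists. The Rayleigh minimiser supplies it: its first variation is the
  eigenvalue equation, and every eigenvalue is the Rayleigh quotient of its own
  eigenfunction.\<close>

lemma first_dirichlet_eigenvalue_le:
  assumes v: "v \<in> H01 \<Omega>"
  shows "first_dirichlet_eigenvalue \<Omega> * (L2_norm M v)\<^sup>2 \<le> (energy_norm v)\<^sup>2"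
proof -
  obtain u where u: "u \<in> H01 \<Omega>" "L2_norm M u = 1"
    and min: "\<And>v. v \<in> H01 \<Omega> \<Longrightarrow> (energy_norm u)\<^sup>2 * (L2_norm M v)\<^sup>2 \<le> (energy_norm v)\<^sup>2"
    using rayleigh_minimizer by blast
  let ?m = "(energy_norm u)\<^sup>2"
  have "dirichlet_eigenvalue \<Omega> ?m"
    unfolding dirichlet_eigenvalue_iff
  proof (intro bexI[OF _ u(1)] conjI ballI)
    show "ae_nonzero \<Omega> u" using u L2_norm_pos_iff by simp
    fix v assume v: "v \<in> H01 \<Omega>"
    \<comment> \<open>Minimality along \<open>u + t v\<close>; the constant term cancels because
      \<open>u\<close> has L2 norm 1.\<close>
    have "0 \<le> t\<^sup>2 * (D v v - ?m * L2_inner M v v) + 2 * t * (D u v - ?m * L2_inner M u v)" for t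
    proof -
      have "?m * L2_inner M (u + t *\<^sub>R v) (u + t *\<^sub>R v) \<le> D (u + t *\<^sub>R v) (u + t *\<^sub>R v)"
        using min[of "u + t *\<^sub>R v"] u(1) v by (simp add: H.mems D_self L2_inner_self L2_norm_sq)
      then show ?thesis
        using L2.quad_expand[OF H01_L2[OF u(1)] H01_L2[OF v], of t] H.quad_expand[OF u(1) v, of t] u(2)
          L2_norm_sq[of M u]
        by (simp add: L2_inner_self[of M u] D_self[of u] algebra_simps)
    qed
    from nonneg_quadratic_linear_term_zero[OF this] show "D u v = ?m * L2_inner M u v" by simp
  qed
  moreover have "?m \<le> \<mu>" if ev: "dirichlet_eigenvalue \<Omega> \<mu>" for \<mu>
  proof -
    obtain w where w: "w \<in> H01 \<Omega>" "ae_nonzero \<Omega> w" "D w w = \<mu> * L2_inner M w w"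
      using ev unfolding dirichlet_eigenvalue_iff by blast
    then have "?m * (L2_norm M w)\<^sup>2 \<le> \<mu> * (L2_norm M w)\<^sup>2" using min[OF w(1)] by (simp add: D_self L2_inner_self L2_norm_sq)
    then show ?thesis using w L2_norm_pos_iff by simp
  qed
  ultimately have "first_dirichlet_eigenvalue \<Omega> = ?m"
    unfolding first_dirichlet_eigenvalue_def by (rule Least_equality)
  then show ?thesis using min[OF v] by simp
qed

end

section \<open>Differentiability of the functional\<close>

text \<open>For \<open>q = p - 2\<close> this is the derivative of
  \<open>\<bar>s\<bar>^p / p\<close>, the nonlinearity of the problem.\<close>

definition signed_power :: "real \<Rightarrow> real \<Rightarrow> real" where
  "signed_power q s = \<bar>s\<bar> powr q * s"

lemma signed_power_derivative:
  assumes q: "0 < q"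
  shows "(signed_power q has_real_derivative (q + 1) * \<bar>s\<bar> powr q) (at s)"
proof -
  consider "0 < s" | "s < 0" | "s = 0" by linarith
  then show ?thesis
  proof cases
    case 1
    have "((\<lambda>s. s powr (q + 1)) has_real_derivative (q + 1) * s powr (q + 1 - 1)) (at s)"
      by (rule has_real_derivative_powr[OF 1])
    then have "((\<lambda>s. s powr (q + 1)) has_real_derivative (q + 1) * \<bar>s\<bar> powr q) (at s)" using 1 by simp
    then show ?thesis
      by (rule has_field_derivative_transform_within_open[of _ _ _ "{0<..}"])
        (use 1 in \<open>auto simp: signed_power_def powr_add\<close>)
  next
    case 2
    have "((\<lambda>s. s powr (q + 1)) has_real_derivative (q + 1) * (-s) powr (q + 1 - 1)) (at (-s))"
      by (rule has_real_derivative_powr) (use 2 in simp)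
    moreover have "(uminus has_real_derivative -1) (at s)" by (auto intro!: derivative_eq_intros)
    ultimately have "((\<lambda>s. (-s) powr (q + 1)) has_real_derivative (q + 1) * (-s) powr (q + 1 - 1) * -1) (at s)"
      by (rule DERIV_chain2)
    from DERIV_minus[OF this] have "((\<lambda>s. - ((-s) powr (q + 1))) has_real_derivative (q + 1) * \<bar>s\<bar> powr q) (at s)" using 2 by simp
    then show ?thesis
      by (rule has_field_derivative_transform_within_open[of _ _ _ "{..<0}"])
        (use 2 in \<open>auto simp: signed_power_def powr_add\<close>)
  next
    case 3
    have "((\<lambda>h. \<bar>h\<bar> powr q) \<longlongrightarrow> 0 powr q) (at (0::real))"
      using q by (intro tendsto_powr' tendsto_rabs_zero tendsto_ident_at) auto
    then have lim: "((\<lambda>h. \<bar>h\<bar> powr q) \<longlongrightarrow> 0) (at (0::real))" by simp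
    have "((\<lambda>h. (signed_power q h - signed_power q 0) / (h - 0)) \<longlongrightarrow> 0) (at (0::real))"
      by (rule Lim_transform_eventually[OF lim]) (auto simp: signed_power_def eventually_at_filter)
    then show ?thesis using 3 by (simp add: has_field_derivative_iff)
  qed
qed

lemma abs_powr_derivative:
  assumes p: "2 < p"
  shows "((\<lambda>s. \<bar>s\<bar> powr p) has_real_derivative p * signed_power (p - 2) s) (at s)"
proof -
  have eq: "\<bar>s\<bar> powr p = signed_power (p - 2) s * s" for s
    by (cases "s = 0") (auto simp: signed_power_def powr_diff power2_eq_square)
  have "((\<lambda>s. signed_power (p - 2) s * s) has_real_derivative
      (p - 2 + 1) * \<bar>s\<bar> powr (p - 2) * s + 1 * signed_power (p - 2) s) (at s)"
    by (rule DERIV_mult) (use signed_power_derivative[of "p - 2" s] p in auto)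
  moreover have "(p - 2 + 1) * \<bar>s\<bar> powr (p - 2) * s + 1 * signed_power (p - 2) s = p * signed_power (p - 2) s"
    by (simp add: signed_power_def algebra_simps)
  ultimately show ?thesis by (simp add: eq)
qed

lemma signed_power_diff_le:
  assumes q: "0 < q"
  shows "\<bar>signed_power q x - signed_power q y\<bar> \<le> (q + 1) * (\<bar>x\<bar> + \<bar>y\<bar>) powr q * \<bar>x - y\<bar>"
proof -
  let ?S = "{- (\<bar>x\<bar> + \<bar>y\<bar>)..\<bar>x\<bar> + \<bar>y\<bar>}"
  have "norm (signed_power q x - signed_power q y) \<le> ((q + 1) * (\<bar>x\<bar> + \<bar>y\<bar>) powr q) * norm (x - y)"
  proof (rule field_differentiable_bound[where S = ?S])
    show "(signed_power q has_real_derivative (q + 1) * \<bar>z\<bar> powr q) (at z within ?S)" for z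
      by (rule has_field_derivative_at_within[OF signed_power_derivative[OF q]])
    show "norm ((q + 1) * \<bar>z\<bar> powr q) \<le> (q + 1) * (\<bar>x\<bar> + \<bar>y\<bar>) powr q" if "z \<in> ?S" for z
    proof -
      have "\<bar>z\<bar> powr q \<le> (\<bar>x\<bar> + \<bar>y\<bar>) powr q" using that q by (intro powr_mono2) auto
      then show ?thesis using q by (simp add: abs_mult)
    qed
  qed auto
  then show ?thesis by simp
qed

text \<open>The mean value inequality for the remainder as a function of the increment; its
  derivative is a difference of signed powers, locally Lipschitz by
  \<open>signed_power_diff_le\<close>, which yields the second factor \<open>t\<close>.\<close>

lemma abs_powr_taylor_le:
  assumes p: "2 < p"
  shows "\<bar>\<bar>x + t\<bar> powr p - \<bar>x\<bar> powr p - p * signed_power (p - 2) x * t\<bar> \<le> p * (p - 1) * (2 * \<bar>x\<bar> + \<bar>t\<bar>) powr (p - 2) * t\<^sup>2"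
proof -
  let ?S = "{- \<bar>t\<bar>..\<bar>t\<bar>}"
  let ?f = "\<lambda>s. \<bar>x + s\<bar> powr p - \<bar>x\<bar> powr p - p * signed_power (p - 2) x * s"
  let ?B = "p * ((p - 1) * (2 * \<bar>x\<bar> + \<bar>t\<bar>) powr (p - 2) * \<bar>t\<bar>)"
  have "norm (?f t - ?f 0) \<le> ?B * norm (t - 0)"
  proof (rule field_differentiable_bound[where S = ?S])
    fix s assume s: "s \<in> ?S"
    have "((\<lambda>s. x + s) has_real_derivative 1) (at s)" by (auto intro!: derivative_eq_intros)
    from DERIV_chain2[OF abs_powr_derivative[OF p] this]
    have "((\<lambda>s. \<bar>x + s\<bar> powr p) has_real_derivative p * signed_power (p - 2) (x + s)) (at s)" by simp
    then have "(?f has_real_derivative p * signed_power (p - 2) (x + s) - 0 - p * signed_power (p - 2) x * 1) (at s)"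
      by (intro DERIV_diff DERIV_const DERIV_cmult DERIV_ident)
    then have "(?f has_real_derivative p * (signed_power (p - 2) (x + s) - signed_power (p - 2) x)) (at s)"
      by (simp add: algebra_simps)
    then show "(?f has_real_derivative p * (signed_power (p - 2) (x + s) - signed_power (p - 2) x)) (at s within ?S)"
      by (rule has_field_derivative_at_within)
    have "\<bar>signed_power (p - 2) (x + s) - signed_power (p - 2) x\<bar> \<le> (p - 2 + 1) * (\<bar>x + s\<bar> + \<bar>x\<bar>) powr (p - 2) * \<bar>x + s - x\<bar>"
      by (rule signed_power_diff_le) (use p in simp)
    also have "\<dots> \<le> (p - 2 + 1) * (2 * \<bar>x\<bar> + \<bar>t\<bar>) powr (p - 2) * \<bar>t\<bar>"
      using s p by (intro mult_mono powr_mono2) auto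
    finally have "\<bar>p\<bar> * \<bar>signed_power (p - 2) (x + s) - signed_power (p - 2) x\<bar> \<le> p * ((p - 2 + 1) * (2 * \<bar>x\<bar> + \<bar>t\<bar>) powr (p - 2) * \<bar>t\<bar>)"
      using p by (intro mult_mono) auto
    then show "norm (p * (signed_power (p - 2) (x + s) - signed_power (p - 2) x)) \<le> ?B"
      by (simp add: abs_mult)
  qed auto
  note bnd = this
  have "?B * norm (t - 0) = p * (p - 1) * (2 * \<bar>x\<bar> + \<bar>t\<bar>) powr (p - 2) * (\<bar>t\<bar> * \<bar>t\<bar>)"
    by (simp only: mult_ac diff_zero real_norm_def)
  also have "\<bar>t\<bar> * \<bar>t\<bar> = t\<^sup>2" by (simp add: power2_eq_square)
  finally have eq: "?B * norm (t - 0) = p * (p - 1) * (2 * \<bar>x\<bar> + \<bar>t\<bar>) powr (p - 2) * t\<^sup>2" .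
  show ?thesis using bnd unfolding eq by simp
qed

text \<open>All three factors are controlled by the maximum \<open>m\<close>, and
  \<open>m powr (p - 2) * m * m = m powr p\<close>; a crude replacement for Young's
  inequality.\<close>

lemma powr_product_le:
  fixes x y z p :: real
  assumes "0 \<le> x" "0 \<le> y" "0 \<le> z" "2 < p"
  shows "x powr (p - 2) * y * z \<le> x powr p + y powr p + z powr p"
proof -
  define m where "m = max x (max y z)"
  have m: "0 \<le> m" "x \<le> m" "y \<le> m" "z \<le> m" using assms by (auto simp: m_def)
  have "x powr (p - 2) * y * z \<le> m powr (p - 2) * m * m"
    using m assms by (intro mult_mono powr_mono2) auto
  also have "\<dots> = m powr p"
    using m(1) assms by (cases "m = 0") (auto simp: powr_diff power2_eq_square)
  also have "\<dots> \<le> x powr p + y powr p + z powr p" by (auto simp: m_def max_def)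
  finally show ?thesis .
qed

text \<open>Holder's inequality with exponents \<open>p / (p - 2)\<close>, \<open>p\<close>,
  \<open>p\<close>, up to the factor 3: divide each function by its bound, apply the pointwise
  inequality and integrate. The division is why the bounds must be positive.\<close>

lemma integral_powr_product_le:
  fixes x y z :: "'x \<Rightarrow> real"
  assumes p: "2 < p" and nn: "\<And>t. 0 \<le> x t" "\<And>t. 0 \<le> y t" "\<And>t. 0 \<le> z t"
    and m[measurable]: "x \<in> borel_measurable M" "y \<in> borel_measurable M" "z \<in> borel_measurable M"
    and int: "integrable M (\<lambda>t. x t powr p)" "integrable M (\<lambda>t. y t powr p)" "integrable M (\<lambda>t. z t powr p)"
    and pos: "0 < \<alpha>" "0 < \<beta>" "0 < \<gamma>"
    and le: "(LINT t|M. x t powr p) \<le> \<alpha> powr p" "(LINT t|M. y t powr p) \<le> \<beta> powr p" "(LINT t|M. z t powr p) \<le> \<gamma> powr p"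
  shows "integrable M (\<lambda>t. x t powr (p - 2) * y t * z t)"
    "(LINT t|M. x t powr (p - 2) * y t * z t) \<le> 3 * \<alpha> powr (p - 2) * \<beta> * \<gamma>"
proof -
  let ?c = "\<alpha> powr (p - 2) * \<beta> * \<gamma>"
  let ?w = "\<lambda>t. ?c * (x t powr p / \<alpha> powr p + y t powr p / \<beta> powr p + z t powr p / \<gamma> powr p)"
  have c: "0 < ?c" using pos by simp
  have bound: "x t powr (p - 2) * y t * z t \<le> ?w t" for t
  proof -
    have "x t powr (p - 2) * y t * z t = ?c * ((x t / \<alpha>) powr (p - 2) * (y t / \<beta>) * (z t / \<gamma>))"
      using pos nn[of t] by (simp add: powr_divide)
    also have "\<dots> \<le> ?c * ((x t / \<alpha>) powr p + (y t / \<beta>) powr p + (z t / \<gamma>) powr p)"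
      using c pos nn p by (intro mult_left_mono powr_product_le) auto
    also have "\<dots> = ?w t" using pos nn[of t] by (simp add: powr_divide)
    finally show ?thesis .
  qed
  have intw: "integrable M ?w" using int by (intro integrable_mult_right Bochner_Integration.integrable_add integrable_divide)
  show I: "integrable M (\<lambda>t. x t powr (p - 2) * y t * z t)"
    by (rule Bochner_Integration.integrable_bound[OF intw])
      (use bound nn in \<open>auto intro!: AE_I2 order_trans[OF _ abs_ge_self]\<close>)
  have one: "r / \<delta> powr p \<le> 1" if "r \<le> \<delta> powr p" "0 < \<delta>" for r \<delta> using that by simp
  have "(LINT t|M. x t powr (p - 2) * y t * z t) \<le> (LINT t|M. ?w t)" by (rule integral_mono[OF I intw bound])
  also have "\<dots> = ?c * ((LINT t|M. x t powr p) / \<alpha> powr p + (LINT t|M. y t powr p) / \<beta> powr p + (LINT t|M. z t powr p) / \<gamma> powr p)"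
    using int by simp
  also have "\<dots> \<le> ?c * (1 + 1 + 1)"
    using c by (intro mult_left_mono add_mono one le pos) auto
  finally show "(LINT t|M. x t powr (p - 2) * y t * z t) \<le> 3 * \<alpha> powr (p - 2) * \<beta> * \<gamma>" by simp
qed

lemma powr_add_le:
  fixes x y p :: real
  assumes "0 \<le> x" "0 \<le> y" "0 \<le> p"
  shows "(x + y) powr p \<le> 2 powr p * (x powr p + y powr p)"
proof -
  have "(x + y) powr p \<le> (2 * max x y) powr p" using assms by (intro powr_mono2) auto
  also have "\<dots> = 2 powr p * (max x y) powr p" using assms by (simp add: powr_mult)
  also have "(max x y) powr p \<le> x powr p + y powr p" by (auto simp: max_def)
  finally show ?thesis by simp
qed

section \<open>Estimates of the critical term in the energy norm\<close>

context sobolev_domain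
begin

text \<open>The constant of the embedding of \<open>H01\<close> into the Lebesgue space of exponent
  \<open>p\<close>.\<close>

definition emb :: real where "emb = 1 / sqrt S"

lemma emb_pos: "0 < emb"
  using sobolev_constant_pos by (simp add: emb_def)

lemma integral_powr_le:
  assumes u: "u \<in> H01 \<Omega>"
  shows "(LINT x|M. \<bar>u x\<bar> powr p) \<le> (emb * energy_norm u) powr p"
proof -
  have "dirichlet_energy \<Omega> u / S = (emb * energy_norm u)\<^sup>2"
    using sobolev_constant_pos by (simp add: dirichlet_energy_eq emb_def power_divide)
  then have "(dirichlet_energy \<Omega> u / S) powr (p / 2) = (emb * energy_norm u) powr p"
    using emb_pos by (cases "energy_norm u = 0") (auto simp: powr_powr simp flip: powr_numeral)
  then show ?thesis using sobolev_inequality[OF u] by (simp add: critical_integral_eq)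
qed

lemma integral_powr_sum_le:
  assumes u: "u \<in> H01 \<Omega>" and v: "v \<in> H01 \<Omega>"
  shows "integrable M (\<lambda>x. (\<bar>u x\<bar> + \<bar>v x\<bar>) powr p)"
    "(LINT x|M. (\<bar>u x\<bar> + \<bar>v x\<bar>) powr p) \<le> (4 * emb * (energy_norm u + energy_norm v)) powr p"
proof -
  have [measurable]: "u \<in> borel_measurable M" "v \<in> borel_measurable M" using u v by measurable
  let ?w = "\<lambda>x. 2 powr p * (\<bar>u x\<bar> powr p + \<bar>v x\<bar> powr p)"
  have intw: "integrable M ?w" using sobolev_H01(1)[OF u] sobolev_H01(1)[OF v] by simp
  have le: "(\<bar>u x\<bar> + \<bar>v x\<bar>) powr p \<le> ?w x" for x using p_gt_2 by (intro powr_add_le) auto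
  show I: "integrable M (\<lambda>x. (\<bar>u x\<bar> + \<bar>v x\<bar>) powr p)"
    by (rule Bochner_Integration.integrable_bound[OF intw]) (use le in \<open>auto intro!: AE_I2 order_trans[OF _ abs_ge_self]\<close>)
  let ?t = "emb * (energy_norm u + energy_norm v)"
  have t: "0 \<le> ?t" using emb_pos by simp
  have "(LINT x|M. (\<bar>u x\<bar> + \<bar>v x\<bar>) powr p) \<le> (LINT x|M. ?w x)" by (rule integral_mono[OF I intw le])
  also have "\<dots> = 2 powr p * ((LINT x|M. \<bar>u x\<bar> powr p) + (LINT x|M. \<bar>v x\<bar> powr p))"
    using sobolev_H01(1)[OF u] sobolev_H01(1)[OF v] by simp
  also have "\<dots> \<le> 2 powr p * (?t powr p + ?t powr p)"
  proof (intro mult_left_mono add_mono)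
    show "(LINT x|M. \<bar>u x\<bar> powr p) \<le> ?t powr p"
      by (rule order_trans[OF integral_powr_le[OF u]]) (use emb_pos p_gt_2 in \<open>auto intro!: powr_mono2 mult_left_mono\<close>)
    show "(LINT x|M. \<bar>v x\<bar> powr p) \<le> ?t powr p"
      by (rule order_trans[OF integral_powr_le[OF v]]) (use emb_pos p_gt_2 in \<open>auto intro!: powr_mono2 mult_left_mono\<close>)
  qed simp
  also have "\<dots> = 2 powr p * (2 * ?t powr p)" by simp
  \<comment> \<open>The factor 2 is absorbed as \<open>2 powr p\<close>; the result is Minkowski's
    inequality combined with the embedding, with a lossy factor 4.\<close>
  also have "\<dots> \<le> 2 powr p * (2 powr p * ?t powr p)"
    using powr_mono[of 1 p 2] p_gt_2 by (intro mult_left_mono mult_right_mono) auto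
  also have "\<dots> = (4 * ?t) powr p" using t powr_mult[of 2 "2 * ?t" p] powr_mult[of 2 ?t p] by (simp add: mult.assoc)
  finally show "(LINT x|M. (\<bar>u x\<bar> + \<bar>v x\<bar>) powr p) \<le> (4 * emb * (energy_norm u + energy_norm v)) powr p"
    by (simp add: mult.assoc)
qed

definition tri_const :: real where "tri_const = 3 * (4 * emb) powr (p - 2) * emb\<^sup>2"

lemma tri_const_pos: "0 < tri_const"
  using emb_pos by (simp add: tri_const_def)

text \<open>One estimate behind the derivative of \<open>J\<close>, its continuity and the
  comparison along weakly convergent sequences. The Holder substitute needs positive bounds, so some
  \<open>\<epsilon>\<close> is added to every norm and sent to 0. In \<open>tri_const\<close>, 3
  stems from that substitute and 4 from the norm of a sum.\<close>

lemma trilinear_le: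
  assumes u: "u \<in> H01 \<Omega>" and v: "v \<in> H01 \<Omega>" and h: "h \<in> H01 \<Omega>" and k: "k \<in> H01 \<Omega>"
  shows "integrable M (\<lambda>x. (\<bar>u x\<bar> + \<bar>v x\<bar>) powr (p - 2) * \<bar>h x\<bar> * \<bar>k x\<bar>)"
    "(LINT x|M. (\<bar>u x\<bar> + \<bar>v x\<bar>) powr (p - 2) * \<bar>h x\<bar> * \<bar>k x\<bar>)
       \<le> tri_const * (energy_norm u + energy_norm v) powr (p - 2) * energy_norm h * energy_norm k"
proof -
  have [measurable]: "u \<in> borel_measurable M" "v \<in> borel_measurable M" "h \<in> borel_measurable M" "k \<in> borel_measurable M"
    using u v h k by measurable
  let ?I = "LINT x|M. (\<bar>u x\<bar> + \<bar>v x\<bar>) powr (p - 2) * \<bar>h x\<bar> * \<bar>k x\<bar>"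
  let ?s = "energy_norm u + energy_norm v"
  have main: "integrable M (\<lambda>x. (\<bar>u x\<bar> + \<bar>v x\<bar>) powr (p - 2) * \<bar>h x\<bar> * \<bar>k x\<bar>) \<and>
    ?I \<le> 3 * (4 * emb * (?s + \<epsilon>)) powr (p - 2) * (emb * (energy_norm h + \<epsilon>)) * (emb * (energy_norm k + \<epsilon>))" if \<epsilon>: "0 < \<epsilon>" for \<epsilon>
  proof -
    have pw: "(emb * energy_norm w) powr p \<le> (emb * (energy_norm w + \<epsilon>)) powr p" for w
      using \<epsilon> emb_pos p_gt_2 by (intro powr_mono2 mult_left_mono) auto
    have pw2: "(4 * emb * ?s) powr p \<le> (4 * emb * (?s + \<epsilon>)) powr p"
      using \<epsilon> emb_pos p_gt_2 by (intro powr_mono2 mult_left_mono) auto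
    have pos: "0 < energy_norm w + \<epsilon>" for w using \<epsilon> by (simp add: add_nonneg_pos)
    have pos2: "0 < ?s + \<epsilon>" using \<epsilon> by (simp add: add_nonneg_pos)
    show ?thesis
      by (intro conjI integral_powr_product_le[OF p_gt_2, where \<alpha> = "4 * emb * (?s + \<epsilon>)" and \<beta> = "emb * (energy_norm h + \<epsilon>)" and \<gamma> = "emb * (energy_norm k + \<epsilon>)"]
          integral_powr_sum_le(1) u v sobolev_H01(1) h k
          order_trans[OF integral_powr_sum_le(2) pw2] order_trans[OF integral_powr_le pw])
        (use emb_pos pos pos2 in auto)
  qed
  show "integrable M (\<lambda>x. (\<bar>u x\<bar> + \<bar>v x\<bar>) powr (p - 2) * \<bar>h x\<bar> * \<bar>k x\<bar>)" using main[of 1] by simp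
  let ?f = "\<lambda>\<epsilon>. 3 * (4 * emb * (?s + \<epsilon>)) powr (p - 2) * (emb * (energy_norm h + \<epsilon>)) * (emb * (energy_norm k + \<epsilon>))"
  have lim: "(\<lambda>n. ?f (1 / real (Suc n))) \<longlonglongrightarrow> 3 * (4 * emb * (?s + 0)) powr (p - 2) * (emb * (energy_norm h + 0)) * (emb * (energy_norm k + 0))"
    using p_gt_2 emb_pos
    by (intro tendsto_mult tendsto_const tendsto_powr' tendsto_add LIMSEQ_inverse_real_of_nat[unfolded inverse_eq_divide]) auto
  have "?I \<le> 3 * (4 * emb * (?s + 0)) powr (p - 2) * (emb * (energy_norm h + 0)) * (emb * (energy_norm k + 0))"
    by (rule LIMSEQ_le_const[OF lim]) (use main in auto)
  also have "\<dots> = tri_const * ?s powr (p - 2) * energy_norm h * energy_norm k"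
    using emb_pos by (simp add: tri_const_def powr_mult power2_eq_square)
  finally show "?I \<le> tri_const * ?s powr (p - 2) * energy_norm h * energy_norm k" .
qed

definition N :: "('a \<Rightarrow> real) \<Rightarrow> ('a \<Rightarrow> real) \<Rightarrow> real" where
  "N u h = (LINT x|M. signed_power (p - 2) (u x) * h x)"

lemma energy_norm_zero: "energy_norm 0 = 0"
  by (rule H.nrm_zero)

lemma N_integrable:
  assumes u: "u \<in> H01 \<Omega>" and h: "h \<in> H01 \<Omega>"
  shows "integrable M (\<lambda>x. signed_power (p - 2) (u x) * h x)"
proof -
  have [measurable]: "u \<in> borel_measurable M" "h \<in> borel_measurable M" using u h by measurable
  show ?thesis
    by (rule Bochner_Integration.integrable_bound[OF trilinear_le(1)[OF u H.mem_zero u h]])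
      (auto simp: signed_power_def abs_mult)
qed

lemma N_diff_le:
  assumes u: "u \<in> H01 \<Omega>" and v: "v \<in> H01 \<Omega>" and h: "h \<in> H01 \<Omega>"
  shows "\<bar>N v h - N u h\<bar> \<le> (p - 1) * tri_const * (energy_norm v + energy_norm u) powr (p - 2) * energy_norm (v - u) * energy_norm h"
proof -
  note T = trilinear_le[OF v u H.mem_diff[OF v u] h]
  note I = N_integrable[OF v h] N_integrable[OF u h]
  have "\<bar>N v h - N u h\<bar> = \<bar>LINT x|M. signed_power (p - 2) (v x) * h x - signed_power (p - 2) (u x) * h x\<bar>"
    unfolding N_def using I by simp
  also have "\<dots> \<le> (LINT x|M. norm (signed_power (p - 2) (v x) * h x - signed_power (p - 2) (u x) * h x))"
    unfolding real_norm_def[symmetric] by (rule integral_norm_bound)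
  also have "\<dots> \<le> (LINT x|M. (p - 1) * ((\<bar>v x\<bar> + \<bar>u x\<bar>) powr (p - 2) * \<bar>(v - u) x\<bar> * \<bar>h x\<bar>))"
  proof (rule integral_mono)
    fix x
    have "norm (signed_power (p - 2) (v x) * h x - signed_power (p - 2) (u x) * h x) = 
      \<bar>signed_power (p - 2) (v x) - signed_power (p - 2) (u x)\<bar> * \<bar>h x\<bar>"
      by (simp add: abs_mult left_diff_distrib[symmetric])
    also have "\<dots> \<le> ((p - 2 + 1) * (\<bar>v x\<bar> + \<bar>u x\<bar>) powr (p - 2) * \<bar>v x - u x\<bar>) * \<bar>h x\<bar>"
      using p_gt_2 by (intro mult_right_mono signed_power_diff_le) auto
    finally show "norm (signed_power (p - 2) (v x) * h x - signed_power (p - 2) (u x) * h x) \<le> (p - 1) * ((\<bar>v x\<bar> + \<bar>u x\<bar>) powr (p - 2) * \<bar>(v - u) x\<bar> * \<bar>h x\<bar>)"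
      by (simp add: mult_ac)
  qed (intro integrable_norm Bochner_Integration.integrable_diff I integrable_mult_right T)+
  also have "\<dots> = (p - 1) * (LINT x|M. (\<bar>v x\<bar> + \<bar>u x\<bar>) powr (p - 2) * \<bar>(v - u) x\<bar> * \<bar>h x\<bar>)" by simp
  also have "\<dots> \<le> (p - 1) * (tri_const * (energy_norm v + energy_norm u) powr (p - 2) * energy_norm (v - u) * energy_norm h)"
    using p_gt_2 by (intro mult_left_mono T) auto
  finally show ?thesis by (simp add: mult_ac)
qed

lemma critical_integral_expand:
  assumes u: "u \<in> H01 \<Omega>" and h: "h \<in> H01 \<Omega>"
  shows "\<bar>critical_integral \<Omega> (u + h) - critical_integral \<Omega> u - p * N u h\<bar>
    \<le> p * (p - 1) * tri_const * (2 * energy_norm u + energy_norm h) powr (p - 2) * (energy_norm h)\<^sup>2"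
proof -
  \<comment> \<open>The Taylor bound involves \<open>2 * \<bar>u\<bar> + \<bar>h\<bar>\<close>,
    which is the sum in \<open>trilinear_le\<close> for \<open>2 *\<^sub>R u\<close> in place of
    \<open>u\<close>.\<close>
  note T = trilinear_le[OF H.mem_scale[OF u, of 2] h h h]
  note I = sobolev_H01(1)[OF H.mem_add[OF u h]] sobolev_H01(1)[OF u] N_integrable[OF u h]
  let ?f = "\<lambda>x. \<bar>(u + h) x\<bar> powr p - \<bar>u x\<bar> powr p - p * (signed_power (p - 2) (u x) * h x)"
  have intf: "integrable M ?f" by (intro Bochner_Integration.integrable_diff integrable_mult_right I)
  have "\<bar>critical_integral \<Omega> (u + h) - critical_integral \<Omega> u - p * N u h\<bar> = \<bar>LINT x|M. ?f x\<bar>"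
    unfolding critical_integral_eq N_def
    by (subst Bochner_Integration.integral_diff | simp only: integral_mult_right_zero | intro Bochner_Integration.integrable_diff integrable_mult_right I)+
  also have "\<dots> \<le> (LINT x|M. norm (?f x))" unfolding real_norm_def[symmetric] by (rule integral_norm_bound)
  also have "\<dots> \<le> (LINT x|M. p * (p - 1) * ((\<bar>(2 *\<^sub>R u) x\<bar> + \<bar>h x\<bar>) powr (p - 2) * \<bar>h x\<bar> * \<bar>h x\<bar>))"
  proof (rule integral_mono)
    fix x
    show "norm (?f x) \<le> p * (p - 1) * ((\<bar>(2 *\<^sub>R u) x\<bar> + \<bar>h x\<bar>) powr (p - 2) * \<bar>h x\<bar> * \<bar>h x\<bar>)"
      using abs_powr_taylor_le[OF p_gt_2, of "u x" "h x"] by (simp add: power2_eq_square mult.assoc abs_mult)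
  qed (intro integrable_norm intf integrable_mult_right T)+
  also have "\<dots> = p * (p - 1) * (LINT x|M. (\<bar>(2 *\<^sub>R u) x\<bar> + \<bar>h x\<bar>) powr (p - 2) * \<bar>h x\<bar> * \<bar>h x\<bar>)" by simp
  also have "\<dots> \<le> p * (p - 1) * (tri_const * (energy_norm (2 *\<^sub>R u) + energy_norm h) powr (p - 2) * energy_norm h * energy_norm h)"
    using p_gt_2 by (intro mult_left_mono T) auto
  finally show ?thesis by (simp add: H.nrm_scale[OF u] power2_eq_square mult_ac)
qed

lemma dual_norm_le:
  assumes "0 \<le> K" "\<And>h. h \<in> H01 \<Omega> \<Longrightarrow> \<bar>L h\<bar> \<le> K * energy_norm h"
  shows "H01_dual_norm \<Omega> L \<le> K"
  unfolding H01_dual_norm_def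
proof (rule cSUP_least)
  show "{v \<in> H01 \<Omega>. H01_norm \<Omega> v \<le> 1} \<noteq> {}"
    using H.mem_zero by (auto simp: H01_norm_eq energy_norm_zero intro!: exI[of _ 0])
  fix v assume "v \<in> {v \<in> H01 \<Omega>. H01_norm \<Omega> v \<le> 1}"
  then have v: "v \<in> H01 \<Omega>" "energy_norm v \<le> 1" by (auto simp: H01_norm_eq)
  have "\<bar>L v\<bar> \<le> K * energy_norm v" by (rule assms(2)[OF v(1)])
  also have "\<dots> \<le> K * 1" using v assms(1) by (intro mult_left_mono)
  finally show "\<bar>L v\<bar> \<le> K" by simp
qed

lemma dual_norm_apply:
  assumes L: "H01_bounded_linear \<Omega> L" and v: "v \<in> H01 \<Omega>"
  shows "\<bar>L v\<bar> \<le> H01_dual_norm \<Omega> L * energy_norm v"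
proof -
  obtain C where C: "\<And>u. u \<in> H01 \<Omega> \<Longrightarrow> \<bar>L u\<bar> \<le> C * energy_norm u"
    using L unfolding H01_bounded_linear_def H01_norm_eq by blast
  have scale: "L (r *\<^sub>R u) = r * L u" if "u \<in> H01 \<Omega>" for u r
    using L that unfolding H01_bounded_linear_def scaleR_fun_def by simp
  show ?thesis
  \<comment> \<open>The norm is a seminorm on representatives: when it vanishes \<open>v\<close>
    cannot be normalised, but the bound in \<open>H01_bounded_linear\<close> gives
    \<open>L v = 0\<close>.\<close>
  proof (cases "energy_norm v = 0")
    case True
    then show ?thesis using C[OF v] by simp
  next
    case False
    then have pos: "0 < energy_norm v" using energy_norm_nonneg[of v] by linarith
    define w where "w = (1 / energy_norm v) *\<^sub>R v"
    have w: "w \<in> H01 \<Omega>" "energy_norm w = 1" using v pos by (auto simp: w_def H.mems H.nrm_scale)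
    have "\<bar>L w\<bar> \<le> H01_dual_norm \<Omega> L"
      unfolding H01_dual_norm_def
    proof (rule cSUP_upper)
      show "w \<in> {v \<in> H01 \<Omega>. H01_norm \<Omega> v \<le> 1}" using w by (simp add: H01_norm_eq)
      show "bdd_above ((\<lambda>v. \<bar>L v\<bar>) ` {v \<in> H01 \<Omega>. H01_norm \<Omega> v \<le> 1})"
      proof (rule bdd_aboveI2)
        fix v assume "v \<in> {v \<in> H01 \<Omega>. H01_norm \<Omega> v \<le> 1}"
        then have v: "v \<in> H01 \<Omega>" "energy_norm v \<le> 1" by (auto simp: H01_norm_eq)
        have "\<bar>L v\<bar> \<le> \<bar>C\<bar> * energy_norm v"
          using C[OF v(1)] mult_right_mono[OF abs_ge_self[of C] energy_norm_nonneg[of v]] by linarith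
        also have "\<dots> \<le> \<bar>C\<bar> * 1" using v by (intro mult_left_mono) auto
        finally show "\<bar>L v\<bar> \<le> \<bar>C\<bar>" by simp
      qed
    qed
    moreover have "L v = energy_norm v * L w" unfolding w_def scale[OF v] using pos by simp
    ultimately show ?thesis using pos by (simp add: abs_mult mult.commute)
  qed
qed

end

section \<open>The Kirchhoff functional and its derivative\<close>

locale kirchhoff = sobolev_domain \<Omega> p for \<Omega> :: "'a::euclidean_space set" and p +
  fixes a b \<mu> :: real
  assumes a: "0 \<le> a" and b: "0 < b" and \<mu>: "0 < \<mu>"
begin

abbreviation "J \<equiv> kirchhoff_functional \<Omega> a b \<mu>"

definition J' :: "('a \<Rightarrow> real) \<Rightarrow> ('a \<Rightarrow> real) \<Rightarrow> real" where
  "J' u h = (a + b * (energy_norm u)\<^sup>2) * D u h - \<mu> * L2_inner M u h - N u h"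

lemma J_eq: "J u = a / 2 * (energy_norm u)\<^sup>2 + b / 4 * ((energy_norm u)\<^sup>2)\<^sup>2 - \<mu> / 2 * (L2_norm M u)\<^sup>2 - 1 / p * critical_integral \<Omega> u"
  by (simp add: kirchhoff_functional_def dirichlet_energy_eq L2_norm_sq set_integral_M p_eq)

lemma N_add: "\<lbrakk>u \<in> H01 \<Omega>; h \<in> H01 \<Omega>; k \<in> H01 \<Omega>\<rbrakk> \<Longrightarrow> N u (h + k) = N u h + N u k"
  by (simp add: N_def distrib_left N_integrable)

lemma J'_add: "\<lbrakk>u \<in> H01 \<Omega>; h \<in> H01 \<Omega>; k \<in> H01 \<Omega>\<rbrakk> \<Longrightarrow> J' u (h + k) = J' u h + J' u k"
  by (simp add: J'_def H.bilin L2.bilin H01_L2 N_add) (simp add: algebra_simps)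

lemma N_scale: "N u (r *\<^sub>R h) = r * N u h"
proof -
  have "(\<lambda>x. signed_power (p - 2) (u x) * (r *\<^sub>R h) x) = (\<lambda>x. r * (signed_power (p - 2) (u x) * h x))"
    by (simp add: fun_eq_iff)
  then show ?thesis unfolding N_def by (simp only: integral_mult_right_zero)
qed

lemma J'_scale: "\<lbrakk>u \<in> H01 \<Omega>; h \<in> H01 \<Omega>\<rbrakk> \<Longrightarrow> J' u (r *\<^sub>R h) = r * J' u h"
  by (simp add: J'_def H.bilin L2.bilin H01_L2 N_scale) (simp add: algebra_simps)

lemma L2_inner_le: 
  assumes "u \<in> H01 \<Omega>" "h \<in> H01 \<Omega>" 
  shows "\<bar>L2_inner M u h\<bar> \<le> poincare_const\<^sup>2 * energy_norm u * energy_norm h"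
proof -
  have "\<bar>L2_inner M u h\<bar> \<le> L2_norm M u * L2_norm M h" by (rule L2.Cauchy_Schwarz[OF assms[THEN H01_L2]])
  also have "\<dots> \<le> (poincare_const * energy_norm u) * (poincare_const * energy_norm h)"
    by (intro mult_mono poincare assms mult_nonneg_nonneg) (auto intro: less_imp_le poincare_const)
  finally show ?thesis by (simp add: power2_eq_square mult_ac)
qed

lemma J'_diff_le:
  assumes u: "u \<in> H01 \<Omega>" and v: "v \<in> H01 \<Omega>" and h: "h \<in> H01 \<Omega>"
  defines "s \<equiv> energy_norm u" and "t \<equiv> energy_norm v"
  shows "\<bar>J' v h - J' u h\<bar> \<le> (a + b * t\<^sup>2 + b * (t + s) * s + \<mu> * poincare_const\<^sup>2 + (p - 1) * tri_const * (t + s) powr (p - 2))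
    * energy_norm (v - u) * energy_norm h"
proof -
  let ?d = "energy_norm (v - u)" and ?e = "energy_norm h"
  note vu = H.mem_diff[OF v u]
  \<comment> \<open>The nonlocal coefficient differs by \<open>b * (t\<^sup>2 - s\<^sup>2)\<close>,
    factored so that \<open>\<bar>t - s\<bar>\<close> can be bounded by the distance of
    \<open>v\<close> and \<open>u\<close>.\<close>
  have eq: "J' v h - J' u h = (a + b * t\<^sup>2) * D (v - u) h + b * (t - s) * (t + s) * D u h - \<mu> * L2_inner M (v - u) h - (N v h - N u h)"
    using u v h by (simp add: J'_def s_def t_def H.bilin L2.bilin H01_L2 algebra_simps power2_eq_square)
  have 1: "\<bar>(a + b * t\<^sup>2) * D (v - u) h\<bar> \<le> (a + b * t\<^sup>2) * (?d * ?e)"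
    using H.Cauchy_Schwarz[OF vu h] a b by (simp add: abs_mult mult_left_mono)
  have 2: "\<bar>b * (t - s) * (t + s) * D u h\<bar> \<le> b * ?d * (t + s) * (s * ?e)"
  proof -
    have "\<bar>t - s\<bar> \<le> ?d" using H.nrm_reverse_triangle[OF v u] by (simp add: s_def t_def)
    moreover have "\<bar>D u h\<bar> \<le> s * ?e" unfolding s_def by (rule H.Cauchy_Schwarz[OF u h])
    moreover have "\<bar>t + s\<bar> = t + s" by (simp add: s_def t_def)
    ultimately show ?thesis unfolding abs_mult using b by (intro mult_mono) (auto simp: s_def t_def)
  qed
  have 3: "\<bar>\<mu> * L2_inner M (v - u) h\<bar> \<le> \<mu> * (poincare_const\<^sup>2 * ?d * ?e)"
    using L2_inner_le[OF vu h] \<mu> by (simp add: abs_mult)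
  have 4: "\<bar>N v h - N u h\<bar> \<le> (p - 1) * tri_const * (t + s) powr (p - 2) * ?d * ?e"
    unfolding s_def t_def by (rule N_diff_le[OF u v h])
  have "\<bar>J' v h - J' u h\<bar> \<le> (a + b * t\<^sup>2) * (?d * ?e) + b * ?d * (t + s) * (s * ?e) + \<mu> * (poincare_const\<^sup>2 * ?d * ?e) 
     + (p - 1) * tri_const * (t + s) powr (p - 2) * ?d * ?e"
    unfolding eq using 1 2 3 4 by linarith
  then show ?thesis by (simp add: algebra_simps)
qed

lemma J'_zero: "h \<in> H01 \<Omega> \<Longrightarrow> J' 0 h = 0"
  by (simp add: J'_def H.B_zero L2.B_zero H01_L2 N_def signed_power_def)

lemma J'_bounded_linear:
  assumes u: "u \<in> H01 \<Omega>"
  shows "H01_bounded_linear \<Omega> (J' u)"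
  unfolding H01_bounded_linear_def H01_norm_eq
proof (intro conjI ballI allI)
  fix h k assume "h \<in> H01 \<Omega>" "k \<in> H01 \<Omega>"
  then show "J' u (\<lambda>x. h x + k x) = J' u h + J' u k" using J'_add[OF u] by (simp add: plus_fun_def)
next
  fix h and r :: real assume "h \<in> H01 \<Omega>"
  then show "J' u (\<lambda>x. r * h x) = r * J' u h" using J'_scale[OF u, of h r] by (simp add: scaleR_fun_def)
next
  show "\<exists>C. \<forall>h\<in>H01 \<Omega>. \<bar>J' u h\<bar> \<le> C * energy_norm h"
    \<comment> \<open>Boundedness is the difference estimate between \<open>u\<close> and the zero
      function, where \<open>J'\<close> vanishes.\<close>
    using J'_diff_le[OF H.mem_zero u] J'_zero by (auto simp: energy_norm_zero)
qed

lemma J_derivative_bound: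
  assumes u: "u \<in> H01 \<Omega>" and h: "h \<in> H01 \<Omega>" and h1: "energy_norm h \<le> 1"
  defines "s \<equiv> energy_norm u"
  shows "\<bar>J (u + h) - J u - J' u h\<bar> \<le> 
    (a / 2 + b / 4 * (2 * s\<^sup>2 + (2 * s + 1)\<^sup>2) + \<mu> / 2 * poincare_const\<^sup>2 + (p - 1) * tri_const * (2 * s + 1) powr (p - 2)) * (energy_norm h)\<^sup>2"
proof -
  define e where "e = energy_norm h"
  have e: "0 \<le> e" "e \<le> 1" using h1 by (auto simp: e_def)
  have s: "0 \<le> s" by (simp add: s_def)
  define B where "B = D u h"
  have B: "\<bar>B\<bar> \<le> s * e" unfolding B_def s_def e_def by (rule H.Cauchy_Schwarz[OF u h])
  \<comment> \<open>\<open>X\<close> is the increment of the squared energy. In \<open>(s\<^sup>2 +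
    X)\<^sup>2 - (s\<^sup>2)\<^sup>2 = 2 * s\<^sup>2 * X + X\<^sup>2\<close> the part linear in
    \<open>h\<close> cancels against \<open>J'\<close>; \<open>energy_norm h \<le> 1\<close> makes
    the rest quadratic in \<open>h\<close> with a constant depending on \<open>u\<close>
    alone.\<close>
  define X where "X = 2 * B + e\<^sup>2"
  have E: "(energy_norm (u + h))\<^sup>2 = s\<^sup>2 + X"
    using H.quad_expand[OF u h, of 1] by (simp add: D_self X_def B_def s_def e_def)
  have Q: "(L2_norm M (u + h))\<^sup>2 = (L2_norm M u)\<^sup>2 + 2 * L2_inner M u h + (L2_norm M h)\<^sup>2"
    using L2.quad_expand[OF H01_L2[OF u] H01_L2[OF h], of 1] by (simp add: L2_inner_self L2_norm_sq)
  define R where "R = critical_integral \<Omega> (u + h) - critical_integral \<Omega> u - p * N u h"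
  have "J (u + h) - J u - J' u h = a / 2 * e\<^sup>2 + b / 4 * (2 * s\<^sup>2 * e\<^sup>2 + X\<^sup>2) - \<mu> / 2 * (L2_norm M h)\<^sup>2 - 1 / p * R"
    unfolding J_eq J'_def E Q R_def using p_gt_2
    by (simp add: s_def[symmetric] B_def[symmetric] X_def algebra_simps power2_eq_square) 
  moreover have X2: "X\<^sup>2 \<le> (2 * s + 1)\<^sup>2 * e\<^sup>2"
  proof -
    have "e\<^sup>2 \<le> e" using e by (simp add: power2_eq_square mult_left_le)
    then have "\<bar>X\<bar> \<le> 2 * (s * e) + e" using B zero_le_power2[of e] unfolding X_def by linarith
    also have "\<dots> = (2 * s + 1) * e" by (simp add: algebra_simps)
    finally have "\<bar>X\<bar> \<le> (2 * s + 1) * e" .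
    then have "\<bar>X\<bar>\<^sup>2 \<le> ((2 * s + 1) * e)\<^sup>2" by (intro power_mono) auto
    then show ?thesis by (simp add: power_mult_distrib)
  qed
  moreover have Lh: "(L2_norm M h)\<^sup>2 \<le> poincare_const\<^sup>2 * e\<^sup>2"
    using power_mono[OF poincare[OF h] L2_norm_nonneg, of 2] by (simp add: e_def power_mult_distrib)
  moreover have Rb: "1 / p * \<bar>R\<bar> \<le> (p - 1) * tri_const * (2 * s + 1) powr (p - 2) * e\<^sup>2"
  proof -
    have "\<bar>R\<bar> \<le> p * (p - 1) * tri_const * (2 * s + e) powr (p - 2) * e\<^sup>2"
      unfolding R_def s_def e_def by (rule critical_integral_expand[OF u h])
    also have "\<dots> \<le> p * (p - 1) * tri_const * (2 * s + 1) powr (p - 2) * e\<^sup>2"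
      using p_gt_2 tri_const_pos s e by (intro mult_right_mono mult_left_mono powr_mono2) auto
    finally show ?thesis using p_gt_2 by (simp add: field_simps)
  qed
  ultimately have "\<bar>J (u + h) - J u - J' u h\<bar> \<le> a / 2 * e\<^sup>2 + b / 4 * (2 * s\<^sup>2 * e\<^sup>2 + (2 * s + 1)\<^sup>2 * e\<^sup>2) 
      + \<mu> / 2 * (poincare_const\<^sup>2 * e\<^sup>2) + (p - 1) * tri_const * (2 * s + 1) powr (p - 2) * e\<^sup>2"
  proof -
    have "0 \<le> a / 2 * e\<^sup>2" using a by simp
    moreover have "0 \<le> b / 4 * (2 * s\<^sup>2 * e\<^sup>2 + X\<^sup>2)" using b by simp
    moreover have "b / 4 * (2 * s\<^sup>2 * e\<^sup>2 + X\<^sup>2) \<le> b / 4 * (2 * s\<^sup>2 * e\<^sup>2 + (2 * s + 1)\<^sup>2 * e\<^sup>2)"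
      using b X2 by (intro mult_left_mono) auto
    moreover have "0 \<le> \<mu> / 2 * (L2_norm M h)\<^sup>2" "\<mu> / 2 * (L2_norm M h)\<^sup>2 \<le> \<mu> / 2 * (poincare_const\<^sup>2 * e\<^sup>2)"
      using \<mu> Lh by auto
    moreover have "\<bar>1 / p * R\<bar> = 1 / p * \<bar>R\<bar>" using p_gt_2 by (simp add: abs_mult)
    ultimately show ?thesis
      using Rb \<open>J (u + h) - J u - J' u h = _\<close> by linarith
  qed
  then show ?thesis by (simp add: e_def algebra_simps)
qed

lemma small_linear:
  fixes Q \<epsilon> t :: real
  assumes "0 \<le> Q" "0 < \<epsilon>" "0 \<le> t" "t < \<epsilon> / (Q + 1)"
  shows "Q * t < \<epsilon>"
proof -
  have "t * (Q + 1) < \<epsilon>" using assms by (simp add: pos_less_divide_eq)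
  then show ?thesis using assms by (simp add: algebra_simps)
qed

lemma J_C1: "H01_C1 \<Omega> J J'"
  unfolding H01_C1_def
proof (intro conjI ballI allI impI)
  fix u assume u: "u \<in> H01 \<Omega>"
  define s where "s = energy_norm u"
  show "H01_has_derivative \<Omega> J (J' u) u"
    unfolding H01_has_derivative_def H01_norm_eq
  proof (intro conjI allI impI J'_bounded_linear u)
    fix \<epsilon> :: real assume \<epsilon>: "0 < \<epsilon>"
    define Q where "Q = a / 2 + b / 4 * (2 * s\<^sup>2 + (2 * s + 1)\<^sup>2) + \<mu> / 2 * poincare_const\<^sup>2 + (p - 1) * tri_const * (2 * s + 1) powr (p - 2)"
    have Q: "0 \<le> Q" using a b \<mu> p_gt_2 tri_const_pos by (simp add: Q_def)
    show "\<exists>\<delta>>0. \<forall>h\<in>H01 \<Omega>. energy_norm h < \<delta> \<longrightarrow> \<bar>J (\<lambda>x. u x + h x) - J u - J' u h\<bar> \<le> \<epsilon> * energy_norm h"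
    \<comment> \<open>The cap 1 keeps the increment in the range where the constant \<open>Q\<close>
      depends on \<open>u\<close> only; \<open>Q + 1\<close> guards against
      \<open>Q = 0\<close>.\<close>
    proof (intro exI[of _ "min 1 (\<epsilon> / (Q + 1))"] conjI ballI impI)
      show "0 < min 1 (\<epsilon> / (Q + 1))" using Q \<epsilon> by simp
      fix h assume h: "h \<in> H01 \<Omega>" and small: "energy_norm h < min 1 (\<epsilon> / (Q + 1))"
      have "\<bar>J (u + h) - J u - J' u h\<bar> \<le> Q * (energy_norm h)\<^sup>2"
        unfolding Q_def s_def by (rule J_derivative_bound[OF u h]) (use small in simp)
      also have "\<dots> = (Q * energy_norm h) * energy_norm h" by (simp add: power2_eq_square)
      also have "\<dots> \<le> \<epsilon> * energy_norm h"
        using small_linear[OF Q \<epsilon>, of "energy_norm h"] small by (intro mult_right_mono) auto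
      finally show "\<bar>J (\<lambda>x. u x + h x) - J u - J' u h\<bar> \<le> \<epsilon> * energy_norm h" by (simp add: plus_fun_def)
    qed
  qed
next
  fix u and \<epsilon> :: real assume u: "u \<in> H01 \<Omega>" and \<epsilon>: "0 < \<epsilon>"
  define s where "s = energy_norm u"
  have s: "0 \<le> s" by (simp add: s_def)
  define Q where "Q = a + b * (s + 1)\<^sup>2 + b * (2 * s + 1) * s + \<mu> * poincare_const\<^sup>2 + (p - 1) * tri_const * (2 * s + 1) powr (p - 2)"
  have Q: "0 \<le> Q" using a b \<mu> p_gt_2 tri_const_pos s by (simp add: Q_def)
  show "\<exists>\<delta>>0. \<forall>v\<in>H01 \<Omega>. H01_norm \<Omega> (\<lambda>x. v x - u x) < \<delta> \<longrightarrow> H01_dual_norm \<Omega> (\<lambda>h. J' v h - J' u h) < \<epsilon>"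
  proof (intro exI[of _ "min 1 (\<epsilon> / (Q + 1))"] conjI ballI impI)
    show "0 < min 1 (\<epsilon> / (Q + 1))" using Q \<epsilon> by simp
    fix v assume v: "v \<in> H01 \<Omega>" and small: "H01_norm \<Omega> (\<lambda>x. v x - u x) < min 1 (\<epsilon> / (Q + 1))"
    define d where "d = energy_norm (v - u)"
    define t where "t = energy_norm v"
    have d: "0 \<le> d" "d < 1" "d < \<epsilon> / (Q + 1)" using small by (auto simp: d_def H01_norm_eq fun_diff_def)
    have t: "0 \<le> t" "t \<le> s + 1"
      using H.nrm_reverse_triangle[OF v u] d(2) by (auto simp: t_def s_def d_def)
    have "H01_dual_norm \<Omega> (\<lambda>h. J' v h - J' u h) \<le> Q * d"
    proof (rule dual_norm_le)
      show "0 \<le> Q * d" using Q d by simp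
      fix h assume h: "h \<in> H01 \<Omega>"
      have "a + b * t\<^sup>2 + b * (t + s) * s + \<mu> * poincare_const\<^sup>2 + (p - 1) * tri_const * (t + s) powr (p - 2) \<le> Q"
      proof -
        have "b * t\<^sup>2 \<le> b * (s + 1)\<^sup>2" using t b by (intro mult_left_mono power_mono) auto
        moreover have "b * (t + s) * s \<le> b * (2 * s + 1) * s"
          by (rule mult_right_mono[OF mult_left_mono]) (use t s b in auto)
        moreover have "(p - 1) * tri_const * (t + s) powr (p - 2) \<le> (p - 1) * tri_const * (2 * s + 1) powr (p - 2)"
          by (rule mult_left_mono[OF powr_mono2]) (use t s p_gt_2 tri_const_pos in auto)
        ultimately show ?thesis unfolding Q_def by linarith
      qed
      then have "(a + b * t\<^sup>2 + b * (t + s) * s + \<mu> * poincare_const\<^sup>2 + (p - 1) * tri_const * (t + s) powr (p - 2)) * d * energy_norm h \<le> Q * d * energy_norm h"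
        using d by (intro mult_right_mono) auto
      then show "\<bar>J' v h - J' u h\<bar> \<le> Q * d * energy_norm h"
        using J'_diff_le[OF u v h] unfolding s_def t_def d_def by linarith
    qed
    also have "Q * d < \<epsilon>" by (rule small_linear[OF Q \<epsilon> d(1,3)])
    finally show "H01_dual_norm \<Omega> (\<lambda>h. J' v h - J' u h) < \<epsilon>" .
  qed
qed

end

section \<open>Palais--Smale sequences\<close>

text \<open>The total degree \<open>p - 1\<close> is below \<open>p\<close>: for
  \<open>s \<ge> 1 / \<epsilon>\<close> this gains a factor \<open>\<epsilon>\<close>, and for
  smaller \<open>s\<close> the power is bounded and Young's inequality trades \<open>v\<close> for
  \<open>v\<^sup>2\<close>. Thus L2 smallness of \<open>v\<close> controls the product up to
  \<open>\<epsilon>\<close>.\<close>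

lemma powr_mult_cutoff_le:
  fixes s v p \<epsilon> :: real
  assumes "2 < p" "0 \<le> v" "v \<le> s" "0 < \<epsilon>"
  shows "s powr (p - 2) * v \<le> \<epsilon> * s powr p + \<epsilon> + ((1 / \<epsilon>) powr (p - 2))\<^sup>2 / (4 * \<epsilon>) * v\<^sup>2"
proof -
  let ?A = "(1 / \<epsilon>) powr (p - 2)"
  have s: "0 \<le> s" using assms by linarith
  have last: "0 \<le> ?A\<^sup>2 / (4 * \<epsilon>) * v\<^sup>2" using assms by simp
  show ?thesis
  proof (cases "1 / \<epsilon> \<le> s")
    case True
    then have s0: "0 < s" using assms less_le_trans[of 0 "1 / \<epsilon>" s] by simp
    have "s powr (p - 2) * v \<le> s powr (p - 2) * s" using assms by (intro mult_left_mono) auto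
    also have "\<dots> = s powr p / s" using s0 by (simp add: powr_diff power2_eq_square)
    also have "\<dots> \<le> \<epsilon> * s powr p"
      using True s0 assms mult_left_mono[of 1 "\<epsilon> * s" "s powr p"] by (simp add: field_simps)
    finally show ?thesis using last assms by linarith
  next
    case False
    then have "s powr (p - 2) * v \<le> ?A * v" using s assms by (intro mult_right_mono powr_mono2) auto
    also have "?A * v \<le> \<epsilon> + ?A\<^sup>2 / (4 * \<epsilon>) * v\<^sup>2"
    proof -
      have "0 \<le> (2 * \<epsilon> - ?A * v)\<^sup>2" by simp
      then have "4 * \<epsilon> * (?A * v) \<le> 4 * \<epsilon> * \<epsilon> + ?A\<^sup>2 * v\<^sup>2" by (simp add: power2_eq_square algebra_simps)
      then have "4 * \<epsilon> * (?A * v) \<le> 4 * \<epsilon> * (\<epsilon> + ?A\<^sup>2 / (4 * \<epsilon>) * v\<^sup>2)" using assms by (simp add: distrib_left)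
      then show ?thesis using assms(4) mult_le_cancel_left_pos[of "4 * \<epsilon>"] by simp
    qed
    finally show ?thesis using assms powr_ge_zero[of s p] by (smt (verit) mult_nonneg_nonneg)
  qed
qed

section \<open>Interaction with the weak limit in the critical integral\<close>

context sobolev_domain
begin

text \<open>A bounded \<open>\<phi>\<close> leaves an integrand of subcritical degree
  \<open>p - 1\<close>, so the convergence of \<open>V\<close> in L2 suffices even though
  \<open>V\<close> need not vanish in the critical space.\<close>

lemma cutoff_integral_tendsto_0:
  assumes U: "\<And>n. U n \<in> H01 \<Omega>" and V: "\<And>n. V n \<in> H01 \<Omega>"
    and bd: "\<And>n. energy_norm (U n) + energy_norm (V n) \<le> K" and lim: "(\<lambda>n. L2_norm M (V n)) \<longlonglongrightarrow> 0"
    and \<phi>: "\<phi> \<in> test_functions \<Omega>"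
  shows "(\<lambda>n. LINT x|M. (\<bar>U n x\<bar> + \<bar>V n x\<bar>) powr (p - 2) * \<bar>\<phi> x\<bar> * \<bar>V n x\<bar>) \<longlonglongrightarrow> 0"
proof (rule LIMSEQ_I)
  fix e :: real assume e: "0 < e"
  obtain L where L: "0 \<le> L" "\<And>x. \<bar>\<phi> x\<bar> \<le> L" using C1c_bounds[OF test_C1c[OF \<phi>]] by metis
  define B where "B = (4 * emb * K) powr p + measure M \<Omega>"
  have B: "0 \<le> B" by (simp add: B_def)
  define X where "X = L * B + 1"
  have X: "0 < X" using L B by (simp add: X_def add_nonneg_pos)
  define \<epsilon> where "\<epsilon> = e / (2 * X)"
  have \<epsilon>: "0 < \<epsilon>" "L * (\<epsilon> * B) < e"
  proof -
    show "0 < \<epsilon>" using e X by (simp add: \<epsilon>_def)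
    have "\<epsilon> * X = e / 2" using X by (simp add: \<epsilon>_def)
    then have "L * (\<epsilon> * B) = e / 2 - \<epsilon>" by (simp add: X_def algebra_simps)
    then show "L * (\<epsilon> * B) < e" using \<open>0 < \<epsilon>\<close> e by linarith
  qed
  define C where "C = ((1 / \<epsilon>) powr (p - 2))\<^sup>2 / (4 * \<epsilon>)"
  let ?I = "\<lambda>n. LINT x|M. (\<bar>U n x\<bar> + \<bar>V n x\<bar>) powr (p - 2) * \<bar>\<phi> x\<bar> * \<bar>V n x\<bar>"
  have le: "?I n \<le> L * (\<epsilon> * B + C * (L2_norm M (V n))\<^sup>2)" for n
  proof -
    note T = trilinear_le(1)[OF U V test_H01[OF \<phi>] V]
    note P = integral_powr_sum_le[OF U V, of n n]
    have K: "0 \<le> K" using bd[of n] energy_norm_nonneg[of "U n"] energy_norm_nonneg[of "V n"] by linarith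
    let ?w = "\<lambda>x. L * (\<epsilon> * (\<bar>U n x\<bar> + \<bar>V n x\<bar>) powr p + \<epsilon> + C * (V n x)\<^sup>2)"
    have V2: "integrable M (\<lambda>x. (V n x)\<^sup>2)" using L2_integrable[OF H01_L2[OF V]] by simp
    have intw: "integrable M ?w" using P(1) V2 by simp
    have "?I n \<le> (LINT x|M. ?w x)"
    proof (rule integral_mono[OF T intw])
      fix x
      have "(\<bar>U n x\<bar> + \<bar>V n x\<bar>) powr (p - 2) * \<bar>\<phi> x\<bar> * \<bar>V n x\<bar> = \<bar>\<phi> x\<bar> * ((\<bar>U n x\<bar> + \<bar>V n x\<bar>) powr (p - 2) * \<bar>V n x\<bar>)"
        by (simp add: mult_ac)
      also have "\<dots> \<le> L * ((\<bar>U n x\<bar> + \<bar>V n x\<bar>) powr (p - 2) * \<bar>V n x\<bar>)" using L by (intro mult_right_mono) auto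
      also have "\<dots> \<le> ?w x"
        using powr_mult_cutoff_le[OF p_gt_2, of "\<bar>V n x\<bar>" "\<bar>U n x\<bar> + \<bar>V n x\<bar>" \<epsilon>] \<epsilon> L
        by (intro mult_left_mono) (auto simp: C_def)
      finally show "(\<bar>U n x\<bar> + \<bar>V n x\<bar>) powr (p - 2) * \<bar>\<phi> x\<bar> * \<bar>V n x\<bar> \<le> ?w x" .
    qed
    also have "\<dots> = L * (\<epsilon> * (LINT x|M. (\<bar>U n x\<bar> + \<bar>V n x\<bar>) powr p) + \<epsilon> * measure M \<Omega> + C * (LINT x|M. (V n x)\<^sup>2))"
      using P(1) V2 space_M by simp
    also have "\<dots> \<le> L * (\<epsilon> * (4 * emb * K) powr p + \<epsilon> * measure M \<Omega> + C * (L2_norm M (V n))\<^sup>2)"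
    proof (intro mult_left_mono add_mono)
      have "(4 * emb * (energy_norm (U n) + energy_norm (V n))) powr p \<le> (4 * emb * K) powr p"
        using bd[of n] emb_pos p_gt_2 by (intro powr_mono2 mult_left_mono) auto
      then show "(LINT x|M. (\<bar>U n x\<bar> + \<bar>V n x\<bar>) powr p) \<le> (4 * emb * K) powr p" using P(2) by linarith
    qed (use \<epsilon> L in \<open>auto simp: C_def L2_norm_sq\<close>)
    finally show ?thesis by (simp add: B_def algebra_simps)
  qed
  have "(\<lambda>n. L * (\<epsilon> * B + C * (L2_norm M (V n))\<^sup>2)) \<longlonglongrightarrow> L * (\<epsilon> * B + C * 0\<^sup>2)"
    by (intro tendsto_intros lim)
  then have "(\<lambda>n. L * (\<epsilon> * B + C * (L2_norm M (V n))\<^sup>2)) \<longlonglongrightarrow> L * (\<epsilon> * B)" by simp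
  then have "\<forall>\<^sub>F n in sequentially. L * (\<epsilon> * B + C * (L2_norm M (V n))\<^sup>2) < e"
    by (rule order_tendstoD(2)) (rule \<epsilon>)
  then have "\<forall>\<^sub>F n in sequentially. norm (?I n - 0) < e"
  proof eventually_elim
    case (elim n)
    have "0 \<le> ?I n" by (intro integral_nonneg_AE AE_I2) simp
    then show ?case using le[of n] elim by simp
  qed
  then show "\<exists>no. \<forall>n\<ge>no. norm (?I n - 0) < e" by (simp add: eventually_sequentially)
qed

text \<open>A general \<open>u\<close> may be unbounded; it is approximated in energy by a test
  function, and \<open>trilinear_le\<close> makes the error small uniformly in
  \<open>n\<close>.\<close>

lemma mixed_integral_tendsto_0:
  assumes U: "\<And>n. U n \<in> H01 \<Omega>" and V: "\<And>n. V n \<in> H01 \<Omega>"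
    and bd: "\<And>n. energy_norm (U n) + energy_norm (V n) \<le> K" and lim: "(\<lambda>n. L2_norm M (V n)) \<longlonglongrightarrow> 0"
    and u: "u \<in> H01 \<Omega>"
  shows "(\<lambda>n. LINT x|M. (\<bar>U n x\<bar> + \<bar>V n x\<bar>) powr (p - 2) * \<bar>u x\<bar> * \<bar>V n x\<bar>) \<longlonglongrightarrow> 0"
proof (rule LIMSEQ_I)
  fix e :: real assume e: "0 < e"
  have K: "0 \<le> K" using bd[of 0] energy_norm_nonneg[of "U 0"] energy_norm_nonneg[of "V 0"] by linarith
  define C where "C = tri_const * K powr (p - 2) * K"
  have C: "0 \<le> C" using tri_const_pos K by (simp add: C_def)
  define X where "X = C + 1"
  have X: "0 < X" using C by (simp add: X_def)
  define \<delta> where "\<delta> = e / (2 * X)"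
  have \<delta>: "0 < \<delta>" "C * \<delta> \<le> e / 2"
  proof -
    show "0 < \<delta>" using e X by (simp add: \<delta>_def)
    have "\<delta> * X = e / 2" using X by (simp add: \<delta>_def)
    then show "C * \<delta> \<le> e / 2" using \<open>0 < \<delta>\<close> by (simp add: X_def algebra_simps)
  qed
  obtain \<phi> where \<phi>: "\<phi> \<in> test_functions \<Omega>" "energy_norm (\<phi> - u) < \<delta>" using H01_close_test[OF u \<delta>(1)] by blast
  have du: "u - \<phi> \<in> H01 \<Omega>" by (intro H.mems u test_H01 \<phi>)
  have nd: "energy_norm (u - \<phi>) < \<delta>" using \<phi>(2) H.nrm_minus_commute[OF u test_H01[OF \<phi>(1)]] by simp
  let ?I = "\<lambda>w n. LINT x|M. (\<bar>U n x\<bar> + \<bar>V n x\<bar>) powr (p - 2) * \<bar>w x\<bar> * \<bar>V n x\<bar>"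
  have le: "?I u n \<le> ?I \<phi> n + e / 2" for n
  proof -
    note T = trilinear_le(1)[OF U V u V] trilinear_le(1)[OF U V test_H01[OF \<phi>(1)] V] 
    note Td = trilinear_le[OF U V du V]
    have "?I u n \<le> (LINT x|M. (\<bar>U n x\<bar> + \<bar>V n x\<bar>) powr (p - 2) * \<bar>\<phi> x\<bar> * \<bar>V n x\<bar> + (\<bar>U n x\<bar> + \<bar>V n x\<bar>) powr (p - 2) * \<bar>(u - \<phi>) x\<bar> * \<bar>V n x\<bar>)"
    proof (rule integral_mono)
      fix x
      have "\<bar>u x\<bar> \<le> \<bar>\<phi> x\<bar> + \<bar>(u - \<phi>) x\<bar>" by simp
      then have "(\<bar>U n x\<bar> + \<bar>V n x\<bar>) powr (p - 2) * \<bar>u x\<bar> * \<bar>V n x\<bar> \<le> (\<bar>U n x\<bar> + \<bar>V n x\<bar>) powr (p - 2) * (\<bar>\<phi> x\<bar> + \<bar>(u - \<phi>) x\<bar>) * \<bar>V n x\<bar>"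
        by (intro mult_right_mono mult_left_mono) auto
      then show "(\<bar>U n x\<bar> + \<bar>V n x\<bar>) powr (p - 2) * \<bar>u x\<bar> * \<bar>V n x\<bar> \<le>
        (\<bar>U n x\<bar> + \<bar>V n x\<bar>) powr (p - 2) * \<bar>\<phi> x\<bar> * \<bar>V n x\<bar> + (\<bar>U n x\<bar> + \<bar>V n x\<bar>) powr (p - 2) * \<bar>(u - \<phi>) x\<bar> * \<bar>V n x\<bar>"
        by (simp only: distrib_left distrib_right)
    qed (intro T Td(1) Bochner_Integration.integrable_add)+
    also have "\<dots> = ?I \<phi> n + ?I (u - \<phi>) n" by (rule Bochner_Integration.integral_add[OF T(2) Td(1)])
    also have "?I (u - \<phi>) n \<le> tri_const * (energy_norm (U n) + energy_norm (V n)) powr (p - 2) * energy_norm (u - \<phi>) * energy_norm (V n)"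
      by (rule Td(2))
    also have "\<dots> \<le> tri_const * K powr (p - 2) * \<delta> * K"
    proof (intro mult_mono powr_mono2)
      show "energy_norm (V n) \<le> K" using bd[of n] energy_norm_nonneg[of "U n"] by linarith
    qed (use bd[of n] p_gt_2 tri_const_pos nd \<delta> K in auto)
    also have "\<dots> \<le> e / 2" using \<delta>(2) by (simp add: C_def mult_ac)
    finally show ?thesis by simp
  qed
  have "\<forall>\<^sub>F n in sequentially. ?I \<phi> n < e / 2"
    by (rule order_tendstoD(2)[OF cutoff_integral_tendsto_0[OF U V bd lim \<phi>(1)]]) (use e in simp)
  then have "\<forall>\<^sub>F n in sequentially. norm (?I u n - 0) < e"
  proof eventually_elim
    case (elim n)
    have "0 \<le> ?I u n" by (intro integral_nonneg_AE AE_I2) simp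
    then show ?case using le[of n] elim by simp
  qed
  then show "\<exists>no. \<forall>n\<ge>no. norm (?I u n - 0) < e" by (simp add: eventually_sequentially)
qed

lemma N_self: "N u u = critical_integral \<Omega> u"
proof -
  have "signed_power (p - 2) s * s = \<bar>s\<bar> powr p" for s
    by (cases "s = 0") (auto simp: signed_power_def powr_diff power2_eq_square)
  then show ?thesis by (simp add: N_def critical_integral_eq)
qed

text \<open>A substitute for the Brezis--Lieb lemma.\<close>

lemma N_weak_limit:
  assumes U: "\<And>n. U n \<in> H01 \<Omega>" and u: "u \<in> H01 \<Omega>"
    and bd: "\<And>n. energy_norm (U n) \<le> K" and lim: "(\<lambda>n. L2_norm M (U n - u)) \<longlonglongrightarrow> 0"
  shows "(\<lambda>n. N (U n) (U n - u) - critical_integral \<Omega> (U n - u)) \<longlonglongrightarrow> 0"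
proof (rule Lim_null_comparison)
  define V where "V n = U n - u" for n
  have V: "V n \<in> H01 \<Omega>" for n unfolding V_def by (intro H.mems U u)
  have bd2: "energy_norm (U n) + energy_norm (V n) \<le> 2 * K + energy_norm u" for n
    using bd[of n] H.nrm_triangle_diff[OF U u, of n] by (simp add: V_def)
  let ?I = "\<lambda>n. LINT x|M. (\<bar>U n x\<bar> + \<bar>V n x\<bar>) powr (p - 2) * \<bar>u x\<bar> * \<bar>V n x\<bar>"
  have "norm (N (U n) (V n) - critical_integral \<Omega> (V n)) \<le> (p - 1) * ?I n" for n
  proof -
    note I = N_integrable[OF U V, of n n] N_integrable[OF V V, of n n]
    have "norm (N (U n) (V n) - critical_integral \<Omega> (V n)) = norm (LINT x|M. signed_power (p - 2) (U n x) * V n x - signed_power (p - 2) (V n x) * V n x)"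
      unfolding N_self[symmetric] N_def using I by simp
    also have "\<dots> \<le> (LINT x|M. norm (signed_power (p - 2) (U n x) * V n x - signed_power (p - 2) (V n x) * V n x))"
      by (rule integral_norm_bound)
    also have "\<dots> \<le> (LINT x|M. (p - 1) * ((\<bar>U n x\<bar> + \<bar>V n x\<bar>) powr (p - 2) * \<bar>u x\<bar> * \<bar>V n x\<bar>))"
    proof (rule integral_mono)
      fix x
      have "norm (signed_power (p - 2) (U n x) * V n x - signed_power (p - 2) (V n x) * V n x) =
        \<bar>signed_power (p - 2) (U n x) - signed_power (p - 2) (V n x)\<bar> * \<bar>V n x\<bar>"
        by (simp add: abs_mult left_diff_distrib[symmetric])
      also have "\<dots> \<le> ((p - 2 + 1) * (\<bar>U n x\<bar> + \<bar>V n x\<bar>) powr (p - 2) * \<bar>U n x - V n x\<bar>) * \<bar>V n x\<bar>"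
        using p_gt_2 by (intro mult_right_mono signed_power_diff_le) auto
      \<comment> \<open>The mean value estimate of the two nonlinearities leaves one factor
        \<open>\<bar>u\<bar>\<close> that is independent of \<open>n\<close>; the mixed integral
        with such a factor vanishes in the limit.\<close>
      also have "\<bar>U n x - V n x\<bar> = \<bar>u x\<bar>" by (simp add: V_def)
      finally show "norm (signed_power (p - 2) (U n x) * V n x - signed_power (p - 2) (V n x) * V n x) \<le> (p - 1) * ((\<bar>U n x\<bar> + \<bar>V n x\<bar>) powr (p - 2) * \<bar>u x\<bar> * \<bar>V n x\<bar>)"
        by (simp add: mult_ac)
    qed (intro integrable_norm Bochner_Integration.integrable_diff I integrable_mult_right trilinear_le(1)[OF U V u V])+
    finally show ?thesis by simp
  qed
  then show "\<forall>\<^sub>F n in sequentially. norm (N (U n) (U n - u) - critical_integral \<Omega> (U n - u)) \<le> (p - 1) * ?I n"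
    by (simp add: V_def)
  show "(\<lambda>n. (p - 1) * ?I n) \<longlonglongrightarrow> 0"
    by (rule tendsto_mult_right_zero[OF mixed_integral_tendsto_0[OF U V bd2 _ u]]) (use lim in \<open>simp add: V_def\<close>)
qed

end

context kirchhoff
begin

definition PS_seq :: "real \<Rightarrow> (nat \<Rightarrow> 'a \<Rightarrow> real) \<Rightarrow> bool" where
  "PS_seq c U \<longleftrightarrow> (\<forall>j. U j \<in> H01 \<Omega>) \<and> (\<lambda>j. J (U j)) \<longlonglongrightarrow> c \<and> (\<lambda>j. H01_dual_norm \<Omega> (J' (U j))) \<longlonglongrightarrow> 0"

lemma J'_tendsto_0:
  assumes U: "\<And>n. U n \<in> H01 \<Omega>" and dual: "(\<lambda>j. H01_dual_norm \<Omega> (J' (U j))) \<longlonglongrightarrow> 0"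
    and V: "\<And>n. V n \<in> H01 \<Omega>" "\<And>n. energy_norm (V n) \<le> K"
  shows "(\<lambda>n. J' (U n) (V n)) \<longlonglongrightarrow> 0"
proof (rule Lim_null_comparison)
  have "norm (J' (U n) (V n)) \<le> \<bar>H01_dual_norm \<Omega> (J' (U n))\<bar> * K" for n
  proof -
    have "\<bar>J' (U n) (V n)\<bar> \<le> H01_dual_norm \<Omega> (J' (U n)) * energy_norm (V n)"
      by (rule dual_norm_apply[OF J'_bounded_linear[OF U] V(1)])
    also have "\<dots> \<le> \<bar>H01_dual_norm \<Omega> (J' (U n))\<bar> * K" by (intro mult_mono V) auto
    finally show ?thesis by simp
  qed
  then show "\<forall>\<^sub>F n in sequentially. norm (J' (U n) (V n)) \<le> \<bar>H01_dual_norm \<Omega> (J' (U n))\<bar> * K" by simp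
  show "(\<lambda>n. \<bar>H01_dual_norm \<Omega> (J' (U n))\<bar> * K) \<longlonglongrightarrow> 0"
    using tendsto_mult_left_zero[OF tendsto_rabs_zero[OF dual]] .
qed

text \<open>Solved for the nonlinear term, the formula for \<open>J'\<close> gives the limits of
  \<open>N (U n) (V n)\<close> and of the critical integral of \<open>U n\<close> along the
  sequence. The level \<open>c\<close> therefore involves \<open>u\<close> only through its energy
  and its L2 norm.\<close>

lemma PS_limit:
  assumes PS: "PS_seq c U" and u: "u \<in> H01 \<Omega>" and bd: "\<And>n. energy_norm (U n) \<le> K"
    and weak: "(\<lambda>n. D (U n - u) u) \<longlonglongrightarrow> 0" and L2: "(\<lambda>n. L2_norm M (U n - u)) \<longlonglongrightarrow> 0"
    and \<tau>: "(\<lambda>n. (energy_norm (U n - u))\<^sup>2) \<longlonglongrightarrow> \<tau>"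
  defines "A \<equiv> \<tau> + (energy_norm u)\<^sup>2" and "Q \<equiv> (L2_norm M u)\<^sup>2"
  shows "(a + b * A) * \<tau> \<le> (\<tau> / S) powr (p / 2)"
    and "c = a / 2 * A + b / 4 * A\<^sup>2 - \<mu> / 2 * Q - 1 / p * ((a + b * A) * A - \<mu> * Q)"
proof -
  have U: "U n \<in> H01 \<Omega>" for n using PS by (simp add: PS_seq_def)
  have Jc: "(\<lambda>j. J (U j)) \<longlonglongrightarrow> c" and dual: "(\<lambda>j. H01_dual_norm \<Omega> (J' (U j))) \<longlonglongrightarrow> 0" using PS by (simp_all add: PS_seq_def)
  define V where "V n = U n - u" for n
  have V: "V n \<in> H01 \<Omega>" for n unfolding V_def by (intro H.mems U u)
  have UV: "U n = V n + u" for n by (simp add: V_def)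
  have Vbd: "energy_norm (V n) \<le> K + energy_norm u" for n
    using bd[of n] H.nrm_triangle_diff[OF U u, of n] by (simp add: V_def)
  have DV: "(\<lambda>n. D (V n) (V n)) \<longlonglongrightarrow> \<tau>" using \<tau> by (simp add: V_def D_self)
  have Dvu: "(\<lambda>n. D (V n) u) \<longlonglongrightarrow> 0" using weak by (simp add: V_def)
  have VL: "(\<lambda>n. L2_norm M (V n)) \<longlonglongrightarrow> 0" using L2 by (simp add: V_def)
  have EU: "(\<lambda>n. (energy_norm (U n))\<^sup>2) \<longlonglongrightarrow> A"
  proof -
    have "(energy_norm (U n))\<^sup>2 = D (V n) (V n) + 2 * D (V n) u + (energy_norm u)\<^sup>2" for n
      using H.quad_expand[OF V u, of n 1] by (simp add: UV D_self)
    moreover have "(\<lambda>n. D (V n) (V n) + 2 * D (V n) u + (energy_norm u)\<^sup>2) \<longlonglongrightarrow> \<tau> + 2 * 0 + (energy_norm u)\<^sup>2"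
      by (intro tendsto_intros DV Dvu)
    ultimately show ?thesis by (simp add: A_def)
  qed
  have QU: "(\<lambda>n. (L2_norm M (U n))\<^sup>2) \<longlonglongrightarrow> Q"
    unfolding Q_def by (intro tendsto_power L2.nrm_LIMSEQ[OF H01_L2[OF U] H01_L2[OF u] L2])
  have DUV: "(\<lambda>n. D (U n) (V n)) \<longlonglongrightarrow> \<tau>"
  proof -
    have "D (U n) (V n) = D (V n) (V n) + D (V n) u" for n
      using V[of n] u H.sym[OF u V[of n]] by (simp add: UV H.bilin)
    then show ?thesis using tendsto_add[OF DV Dvu] by simp
  qed
  have LUV: "(\<lambda>n. L2_inner M (U n) (V n)) \<longlonglongrightarrow> 0"
  proof (rule Lim_null_comparison)
    have "\<bar>L2_inner M (U n) (V n)\<bar> \<le> (poincare_const * K) * L2_norm M (V n)" for n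
    proof -
      have "\<bar>L2_inner M (U n) (V n)\<bar> \<le> L2_norm M (U n) * L2_norm M (V n)"
        by (rule L2.Cauchy_Schwarz[OF H01_L2[OF U] H01_L2[OF V]])
      also have "\<dots> \<le> (poincare_const * K) * L2_norm M (V n)"
        by (intro mult_right_mono order_trans[OF poincare[OF U] mult_left_mono[OF bd]] less_imp_le[OF poincare_const(1)]) simp
      finally show ?thesis .
    qed
    then show "\<forall>\<^sub>F n in sequentially. norm (L2_inner M (U n) (V n)) \<le> (poincare_const * K) * L2_norm M (V n)" by simp
    show "(\<lambda>n. (poincare_const * K) * L2_norm M (V n)) \<longlonglongrightarrow> 0" by (rule tendsto_mult_right_zero[OF VL])
  qed
  have NUV: "(\<lambda>n. N (U n) (V n)) \<longlonglongrightarrow> (a + b * A) * \<tau>"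
  proof -
    have "(\<lambda>n. (a + b * (energy_norm (U n))\<^sup>2) * D (U n) (V n) - \<mu> * L2_inner M (U n) (V n) - J' (U n) (V n))
        \<longlonglongrightarrow> (a + b * A) * \<tau> - \<mu> * 0 - 0"
      by (intro tendsto_intros EU DUV LUV J'_tendsto_0[OF U dual V Vbd])
    then show ?thesis by (simp add: J'_def)
  qed
  have CV: "(\<lambda>n. critical_integral \<Omega> (V n)) \<longlonglongrightarrow> (a + b * A) * \<tau>"
    using tendsto_diff[OF NUV N_weak_limit[OF U u bd L2]] by (simp add: V_def)
  have "(\<lambda>n. (D (V n) (V n) / S) powr (p / 2)) \<longlonglongrightarrow> (\<tau> / S) powr (p / 2)"
    using p_gt_2 sobolev_constant_pos DV by (intro tendsto_powr' tendsto_divide tendsto_const) (auto simp: H.nonneg[OF V])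
  then show "(a + b * A) * \<tau> \<le> (\<tau> / S) powr (p / 2)"
    by (rule LIMSEQ_le[OF CV]) (use sobolev_inequality[OF V] in \<open>auto simp: dirichlet_energy_eq D_self\<close>)
  have CU: "(\<lambda>n. critical_integral \<Omega> (U n)) \<longlonglongrightarrow> (a + b * A) * A - \<mu> * Q"
  proof -
    have "(\<lambda>n. (a + b * (energy_norm (U n))\<^sup>2) * (energy_norm (U n))\<^sup>2 - \<mu> * (L2_norm M (U n))\<^sup>2 - J' (U n) (U n))
        \<longlonglongrightarrow> (a + b * A) * A - \<mu> * Q - 0"
      by (intro tendsto_intros EU QU J'_tendsto_0[OF U dual U bd])
    then show ?thesis by (simp add: J'_def N_self D_self L2_inner_self L2_norm_sq)
  qed
  have "(\<lambda>n. J (U n)) \<longlonglongrightarrow> a / 2 * A + b / 4 * A\<^sup>2 - \<mu> / 2 * Q - 1 / p * ((a + b * A) * A - \<mu> * Q)"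
    unfolding J_eq by (intro tendsto_intros EU QU CU)
  then show "c = a / 2 * A + b / 4 * A\<^sup>2 - \<mu> / 2 * Q - 1 / p * ((a + b * A) * A - \<mu> * Q)"
    by (rule LIMSEQ_unique[OF Jc])
qed

lemma PS_seq_subseq:
  assumes "PS_seq c U" "strict_mono r"
  shows "PS_seq c (\<lambda>n. U (r n))"
  using assms LIMSEQ_subseq_LIMSEQ[OF _ assms(2), of "\<lambda>j. J (U j)" c]
    LIMSEQ_subseq_LIMSEQ[OF _ assms(2), of "\<lambda>j. H01_dual_norm \<Omega> (J' (U j))" 0]
  by (simp add: PS_seq_def o_def)

text \<open>Separates what depends on the dimension, boundedness and the exclusion of a positive
  loss \<open>\<tau>\<close>, from the extraction of subsequences; \<open>\<tau> = 0\<close> is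
  strong convergence. Three subsequences are composed: past the index where the bound starts, weakly
  convergent, and with convergent energies of the difference to \<open>u\<close>.\<close>

lemma satisfies_PS_I:
  assumes bounded: "\<And>U. PS_seq c U \<Longrightarrow> \<exists>K. \<forall>\<^sub>F n in sequentially. energy_norm (U n) \<le> K"
    and no_loss: "\<And>u \<tau> A Q. \<lbrakk>u \<in> H01 \<Omega>; 0 < \<tau>; A = \<tau> + (energy_norm u)\<^sup>2; Q = (L2_norm M u)\<^sup>2;
      (a + b * A) * \<tau> \<le> (\<tau> / S) powr (p / 2);
      c = a / 2 * A + b / 4 * A\<^sup>2 - \<mu> / 2 * Q - 1 / p * ((a + b * A) * A - \<mu> * Q)\<rbrakk> \<Longrightarrow> False"
  shows "satisfies_PS \<Omega> J c"
  unfolding satisfies_PS_def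
proof (intro exI[of _ J'] conjI J_C1 allI impI)
  fix U :: "nat \<Rightarrow> 'a \<Rightarrow> real"
  assume "(\<forall>j. U j \<in> H01 \<Omega>) \<and> (\<lambda>j. J (U j)) \<longlonglongrightarrow> c \<and> (\<lambda>j. H01_dual_norm \<Omega> (J' (U j))) \<longlonglongrightarrow> 0"
  then have PS0: "PS_seq c U" by (simp add: PS_seq_def)
  obtain K n0 where K: "\<And>n. n \<ge> n0 \<Longrightarrow> energy_norm (U n) \<le> K"
    using bounded[OF PS0] by (auto simp: eventually_sequentially)
  define r0 where "r0 n = n + n0" for n
  have r0: "strict_mono r0" by (simp add: r0_def strict_mono_def)
  have PS1: "PS_seq c (\<lambda>n. U (r0 n))" by (rule PS_seq_subseq[OF PS0 r0])
  have H1: "U (r0 n) \<in> H01 \<Omega>" and bd1: "energy_norm (U (r0 n)) \<le> K" for n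
    using PS1 K by (auto simp: PS_seq_def r0_def)
  obtain u r1 where u: "u \<in> H01 \<Omega>" and r1: "strict_mono (r1 :: nat \<Rightarrow> nat)"
    and weak: "\<And>w. w \<in> H01 \<Omega> \<Longrightarrow> (\<lambda>n. D (U (r0 (r1 n)) - u) w) \<longlonglongrightarrow> 0"
    and L2: "(\<lambda>n. L2_norm M (U (r0 (r1 n)) - u)) \<longlonglongrightarrow> 0"
    using weakly_convergent_subseq[of "\<lambda>n. U (r0 n)" K, OF H1 bd1] by metis
  let ?e = "\<lambda>n. (energy_norm (U (r0 (r1 n)) - u))\<^sup>2"
  have "\<bar>?e n\<bar> \<le> (K + energy_norm u)\<^sup>2" for n
    using H.nrm_triangle_diff[OF H1 u, of "r1 n"] bd1[of "r1 n"] by (simp add: power_mono)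
  then have "bounded (range ?e)" unfolding bounded_iff by (intro exI[of _ "(K + energy_norm u)\<^sup>2"]) auto
  from bounded_imp_convergent_subsequence[OF this]
  obtain \<tau> r2 where r2: "strict_mono (r2 :: nat \<Rightarrow> nat)" and \<tau>: "(?e \<circ> r2) \<longlonglongrightarrow> \<tau>" by auto
  define r where "r = r0 \<circ> r1 \<circ> r2"
  have r: "strict_mono r" unfolding r_def by (intro strict_mono_o r0 r1 r2)
  have \<tau>': "(\<lambda>n. (energy_norm (U (r n) - u))\<^sup>2) \<longlonglongrightarrow> \<tau>" using \<tau> by (simp add: r_def o_def)
  have PS: "PS_seq c (\<lambda>n. U (r n))" by (rule PS_seq_subseq[OF PS0 r])
  have bd: "energy_norm (U (r n)) \<le> K" for n using bd1 by (simp add: r_def)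
  have weak': "(\<lambda>n. D (U (r n) - u) u) \<longlonglongrightarrow> 0"
    using LIMSEQ_subseq_LIMSEQ[OF weak[OF u] r2] by (simp add: r_def o_def)
  have L2': "(\<lambda>n. L2_norm M (U (r n) - u)) \<longlonglongrightarrow> 0"
    using LIMSEQ_subseq_LIMSEQ[OF L2 r2] by (simp add: r_def o_def)
  have "0 \<le> \<tau>" by (rule LIMSEQ_le_const[OF \<tau>']) simp
  moreover have "\<not> 0 < \<tau>"
    using no_loss[OF u _ refl refl] PS_limit[OF PS u bd weak' L2' \<tau>'] by blast
  ultimately have "\<tau> = 0" by simp
  then have "(\<lambda>n. sqrt ((energy_norm (U (r n) - u))\<^sup>2)) \<longlonglongrightarrow> sqrt 0"
    using \<tau>' by (intro tendsto_real_sqrt) simp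
  then have "(\<lambda>n. energy_norm (U (r n) - u)) \<longlonglongrightarrow> 0" by simp
  then show "\<exists>u\<in>H01 \<Omega>. \<exists>r. strict_mono r \<and> (\<lambda>j. H01_norm \<Omega> (\<lambda>x. U (r j) x - u x)) \<longlonglongrightarrow> 0"
    using u r by (auto simp: H01_norm_eq fun_diff_def)
qed

lemma PS_seq_eventually:
  assumes "PS_seq c U"
  shows "\<forall>\<^sub>F n in sequentially. J (U n) \<le> \<bar>c\<bar> + 1 \<and> \<bar>J' (U n) (U n)\<bar> \<le> energy_norm (U n)"
proof -
  have U: "U n \<in> H01 \<Omega>" for n using assms by (simp add: PS_seq_def)
  have "\<forall>\<^sub>F n in sequentially. J (U n) < \<bar>c\<bar> + 1"
    by (rule order_tendstoD(2)) (use assms in \<open>auto simp: PS_seq_def\<close>)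
  moreover have "\<forall>\<^sub>F n in sequentially. H01_dual_norm \<Omega> (J' (U n)) < 1"
    by (rule order_tendstoD(2)) (use assms in \<open>auto simp: PS_seq_def\<close>)
  ultimately show ?thesis
  proof eventually_elim
    case (elim n)
    have "\<bar>J' (U n) (U n)\<bar> \<le> H01_dual_norm \<Omega> (J' (U n)) * energy_norm (U n)"
      by (rule dual_norm_apply[OF J'_bounded_linear[OF U] U])
    also have "\<dots> \<le> 1 * energy_norm (U n)" using elim by (intro mult_right_mono) auto
    finally show ?case using elim by simp
  qed
qed

text \<open>Far along the sequence \<open>J'\<close> has dual norm below 1, which gives the last
  premise of \<open>growth\<close>. The restriction to energy norm at least 1 lets each case bound
  lower powers by higher ones.\<close>

lemma PS_bounded_of_growth:
  assumes PS: "PS_seq c U" and q: "1 \<le> q" "q < s" and \<alpha>: "0 < \<alpha>" and \<beta>: "0 \<le> \<beta>"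
    and growth: "\<And>u. \<lbrakk>u \<in> H01 \<Omega>; 1 \<le> energy_norm u; J u \<le> \<bar>c\<bar> + 1; \<bar>J' u u\<bar> \<le> energy_norm u\<rbrakk>
      \<Longrightarrow> \<alpha> * energy_norm u powr s \<le> \<beta> * energy_norm u powr q"
  shows "\<exists>K. \<forall>\<^sub>F n in sequentially. energy_norm (U n) \<le> K"
proof -
  have "\<forall>\<^sub>F n in sequentially. energy_norm (U n) \<le> max 1 ((\<beta> / \<alpha>) powr (1 / (s - q)))"
    using PS_seq_eventually[OF PS]
  proof eventually_elim
    case (elim n)
    let ?e = "energy_norm (U n)"
    have U: "U n \<in> H01 \<Omega>" using PS by (simp add: PS_seq_def)
    show ?case
    proof (cases "1 \<le> ?e")
      case True
      have "\<alpha> * ?e powr s \<le> \<beta> * ?e powr q" using growth[OF U True] elim by simp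
      then have "?e powr (s - q) \<le> \<beta> / \<alpha>" using True \<alpha> by (simp add: powr_diff field_simps)
      then have "(?e powr (s - q)) powr (1 / (s - q)) \<le> (\<beta> / \<alpha>) powr (1 / (s - q))"
        using q by (intro powr_mono2) auto
      then show ?thesis using True q by (simp add: powr_powr)
    qed simp
  qed
  then show ?thesis by blast
qed

section \<open>The four cases of the theorem\<close>

lemma J'_self: "J' u u = (a + b * (energy_norm u)\<^sup>2) * (energy_norm u)\<^sup>2 - \<mu> * (L2_norm M u)\<^sup>2 - critical_integral \<Omega> u"
  by (simp add: J'_def N_self D_self L2_inner_self L2_norm_sq)

lemma poincare_sq: "u \<in> H01 \<Omega> \<Longrightarrow> (L2_norm M u)\<^sup>2 \<le> poincare_const\<^sup>2 * (energy_norm u)\<^sup>2"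
  using power_mono[OF poincare L2_norm_nonneg, of u 2] by (simp add: power_mult_distrib)

text \<open>Here \<open>p = 6\<close> and the loss inequality gives
  \<open>(a + b * \<tau>) * S^3 \<le> \<tau>^2\<close>, so \<open>\<tau>\<close> is at least the
  positive root \<open>\<tau>0\<close>. In \<open>J - J' / 6\<close> the critical term cancels and
  the coefficients \<open>a / 3\<close>, \<open>b / 12\<close> remain; the threshold is
  \<open>a / 3 * \<tau>0 + b / 12 * \<tau>0^2\<close>, and the eigenvalue condition makes the share
  of \<open>u\<close> nonnegative.\<close>

lemma PS_3:
  assumes N: "DIM('a) = 3" and \<mu>1: "\<mu> \<le> a * first_dirichlet_eigenvalue \<Omega>"
    and c: "c < 1/4 * a * b * S^3 + 1/24 * b^3 * S^6 + 1/24 * (4 * a * S + b^2 * S^4) powr (3/2)"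
  shows "satisfies_PS \<Omega> J c"
proof (rule satisfies_PS_I)
  have p6: "p = 6" using N by (simp add: p_eq critical_exponent_def)
  note S = sobolev_constant_pos
  show "\<exists>K. \<forall>\<^sub>F n in sequentially. energy_norm (U n) \<le> K" if PS: "PS_seq c U" for U
  proof (rule PS_bounded_of_growth[OF PS, where q = 2 and s = 4 and \<alpha> = "b / 12" and \<beta> = "\<bar>c\<bar> + 2 + \<mu> / 3 * poincare_const\<^sup>2"])
    fix u assume u: "u \<in> H01 \<Omega>" "1 \<le> energy_norm u" "J u \<le> \<bar>c\<bar> + 1" "\<bar>J' u u\<bar> \<le> energy_norm u"
    let ?e = "energy_norm u"
    have eq: "J u - 1 / 6 * J' u u = a / 3 * ?e\<^sup>2 + b / 12 * (?e\<^sup>2)\<^sup>2 - \<mu> / 3 * (L2_norm M u)\<^sup>2"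
      unfolding J_eq J'_self by (simp add: p6 algebra_simps power2_eq_square)
    have "\<mu> / 3 * (L2_norm M u)\<^sup>2 \<le> \<mu> / 3 * (poincare_const\<^sup>2 * ?e\<^sup>2)" using poincare_sq[OF u(1)] \<mu> by simp
    moreover have "0 \<le> a / 3 * ?e\<^sup>2" using a by simp
    moreover have e1: "1 \<le> ?e\<^sup>2" "?e \<le> ?e\<^sup>2" using u(2) by (auto intro: one_le_power self_le_power)
    ultimately have "b / 12 * (?e\<^sup>2)\<^sup>2 \<le> \<bar>c\<bar> + 1 + 1 / 6 * ?e + \<mu> / 3 * (poincare_const\<^sup>2 * ?e\<^sup>2)"
      using eq u(3,4) by (simp add: abs_le_iff)
    also have "\<dots> \<le> (\<bar>c\<bar> + 1) * ?e\<^sup>2 + ?e\<^sup>2 + \<mu> / 3 * (poincare_const\<^sup>2 * ?e\<^sup>2)"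
    proof -
      have "(\<bar>c\<bar> + 1) * 1 \<le> (\<bar>c\<bar> + 1) * ?e\<^sup>2" by (rule mult_left_mono[OF e1(1)]) simp
      moreover have "1 / 6 * ?e \<le> ?e\<^sup>2" using e1(2) u(2) by linarith
      ultimately show ?thesis by (intro add_mono) (simp_all only: mult_1_right order_refl)
    qed
    also have "\<dots> = (\<bar>c\<bar> + 2 + \<mu> / 3 * poincare_const\<^sup>2) * ?e\<^sup>2" by (simp add: algebra_simps)
    finally show "b / 12 * ?e powr 4 \<le> (\<bar>c\<bar> + 2 + \<mu> / 3 * poincare_const\<^sup>2) * ?e powr 2"
      using u(2) by simp
  qed (use b \<mu> in auto)
next
  have p6: "p = 6" using N by (simp add: p_eq critical_exponent_def)
  note S = sobolev_constant_pos
  fix u \<tau> A Q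
  assume u: "u \<in> H01 \<Omega>" and \<tau>: "0 < \<tau>" and A: "A = \<tau> + (energy_norm u)\<^sup>2" and Q: "Q = (L2_norm M u)\<^sup>2"
    and le: "(a + b * A) * \<tau> \<le> (\<tau> / S) powr (p / 2)"
    and ceq: "c = a / 2 * A + b / 4 * A\<^sup>2 - \<mu> / 2 * Q - 1 / p * ((a + b * A) * A - \<mu> * Q)"
  define E where "E = (energy_norm u)\<^sup>2"
  have E: "0 \<le> E" "A = \<tau> + E" by (auto simp: E_def A)
  have \<mu>Q: "\<mu> * Q \<le> a * E"
  proof -
    have "\<mu> * Q \<le> a * first_dirichlet_eigenvalue \<Omega> * Q" using \<mu>1 by (intro mult_right_mono) (auto simp: Q)
    also have "\<dots> \<le> a * E"
      using first_dirichlet_eigenvalue_le[OF u] a by (simp add: E_def Q mult.assoc mult_left_mono)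
    finally show ?thesis .
  qed
  have "(\<tau> / S) powr (p / 2) = \<tau> ^ 3 / S ^ 3" using \<tau> S by (simp add: p6 power_divide)
  then have "(a + b * A) * \<tau> \<le> \<tau> ^ 3 / S ^ 3" using le by (simp only:)
  then have "(a + b * A) * \<tau> * S ^ 3 \<le> \<tau> ^ 3" using S by (simp only: pos_le_divide_eq zero_less_power)
  then have "\<tau> * ((a + b * A) * S ^ 3) \<le> \<tau> * \<tau>\<^sup>2" by (simp add: power2_eq_square power3_eq_cube algebra_simps)
  then have "(a + b * A) * S ^ 3 \<le> \<tau>\<^sup>2" using \<tau> by simp
  moreover have "(a + b * \<tau>) * S ^ 3 \<le> (a + b * A) * S ^ 3" using E b S by (intro mult_right_mono) auto
  ultimately have quad: "(a + b * \<tau>) * S ^ 3 \<le> \<tau>\<^sup>2" by linarith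
  define w where "w = sqrt (4 * a * S + b\<^sup>2 * S ^ 4)"
  have w: "0 \<le> w" "w\<^sup>2 = 4 * a * S + b\<^sup>2 * S ^ 4" using a b S by (auto simp: w_def)
  have w3: "(4 * a * S + b\<^sup>2 * S ^ 4) powr (3/2) = w ^ 3"
  proof -
    have pos: "0 < 4 * a * S + b\<^sup>2 * S ^ 4" using a b S by (simp add: add_nonneg_pos)
    then have "w = (4 * a * S + b\<^sup>2 * S ^ 4) powr (1/2)" by (simp add: w_def powr_half_sqrt)
    moreover have "w ^ 3 = w powr 3" using pos by (simp add: w_def)
    ultimately show ?thesis by (simp add: powr_powr)
  qed
  define \<tau>0 where "\<tau>0 = (b * S ^ 3 + S * w) / 2"
  have "\<tau>0 \<le> \<tau>"
  proof -
    \<comment> \<open>The squared inequality below selects the larger root only once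
      \<open>2 * \<tau> - b * S ^ 3\<close> is known to be nonnegative.\<close>
    have "b * S ^ 3 \<le> \<tau>"
    proof -
      have "\<tau> * (b * S ^ 3) \<le> (a + b * \<tau>) * S ^ 3" using a S by (simp add: algebra_simps)
      then have "\<tau> * (b * S ^ 3) \<le> \<tau> * \<tau>" using quad by (simp add: power2_eq_square)
      then show ?thesis using \<tau> by simp
    qed
    then have pos: "0 \<le> 2 * \<tau> - b * S ^ 3" using \<tau> by linarith
    have "(S * w)\<^sup>2 = S\<^sup>2 * (4 * a * S + b\<^sup>2 * S ^ 4)" by (simp only: power_mult_distrib w(2))
    also have "\<dots> = 4 * a * S ^ 3 + b\<^sup>2 * S ^ 6"
      by (simp add: power2_eq_square power_numeral_reduce algebra_simps)
    also have "\<dots> \<le> (2 * \<tau> - b * S ^ 3)\<^sup>2"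
      using quad by (simp add: power2_eq_square power_numeral_reduce algebra_simps)
    finally have "S * w \<le> 2 * \<tau> - b * S ^ 3" using pos by (rule power2_le_imp_le)
    then show ?thesis by (simp add: \<tau>0_def)
  qed
  moreover have "0 \<le> \<tau>0" using b S w by (simp add: \<tau>0_def)
  ultimately have mono: "a / 3 * \<tau>0 + b / 12 * \<tau>0\<^sup>2 \<le> a / 3 * \<tau> + b / 12 * \<tau>\<^sup>2"
    using a b by (intro add_mono mult_left_mono power_mono) auto
  \<comment> \<open>The factor 48 clears all denominators. The value of \<open>w\<^sup>2\<close> is
    then used in both directions: to expand the last summand, and to collect the terms linear in
    \<open>w\<close> into \<open>w ^ 3\<close>.\<close>
  have "48 * (a / 3 * \<tau>0 + b / 12 * \<tau>0\<^sup>2) = 8 * a * b * S ^ 3 + 8 * a * S * w + b ^ 3 * S ^ 6 + 2 * b\<^sup>2 * S ^ 4 * w + b * S\<^sup>2 * w\<^sup>2"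
    by (simp add: \<tau>0_def power2_eq_square power_numeral_reduce field_simps)
  also have "\<dots> = 12 * a * b * S ^ 3 + 2 * b ^ 3 * S ^ 6 + 2 * (w\<^sup>2 * w)"
    unfolding w(2) by (simp add: power2_eq_square power_numeral_reduce algebra_simps)
  also have "w\<^sup>2 * w = w ^ 3" by (simp add: power2_eq_square power3_eq_cube)
  finally have "48 * (a / 3 * \<tau>0 + b / 12 * \<tau>0\<^sup>2) = 48 * (1/4 * a * b * S^3 + 1/24 * b^3 * S^6 + 1/24 * w ^ 3)"
    by (simp only: distrib_left mult.assoc[symmetric])
  then have "a / 3 * \<tau>0 + b / 12 * \<tau>0\<^sup>2 = 1/4 * a * b * S^3 + 1/24 * b^3 * S^6 + 1/24 * w ^ 3"
    by (subst (asm) mult_left_cancel) simp_all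
  then have "c < a / 3 * \<tau>0 + b / 12 * \<tau>0\<^sup>2" using c w3 by (simp only:)
  moreover have "c = a / 3 * \<tau> + b / 12 * \<tau>\<^sup>2 + ((a * E - \<mu> * Q) / 3 + b / 12 * (E\<^sup>2 + 2 * \<tau> * E))"
    by (simp add: ceq E p6 power2_eq_square field_simps)
  moreover have "0 \<le> (a * E - \<mu> * Q) / 3 + b / 12 * (E\<^sup>2 + 2 * \<tau> * E)" using \<mu>Q b E \<tau> by simp
  ultimately show False using mono by linarith
qed

text \<open>For \<open>p = 4\<close> both quartic terms cancel. Boundedness has to come from the
  quadratic part, which explains the strict inequality between \<open>\<mu>\<close> and the
  eigenvalue term in this case.\<close>

lemma PS_4_identity:
  assumes "p = 4" "u \<in> H01 \<Omega>"
  shows "J u - 1 / 4 * J' u u = a / 4 * (energy_norm u)\<^sup>2 - \<mu> / 4 * (L2_norm M u)\<^sup>2"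
  unfolding J_eq J'_self using assms by (simp add: algebra_simps power2_eq_square)

text \<open>Both sides of the loss inequality are now of degree two: after division by
  \<open>\<tau>\<close> it yields \<open>a \<le> \<tau> * (S powi (-2) - b)\<close>, a lower bound
  for \<open>\<tau>\<close>. The level is at least \<open>a / 4 * \<tau>\<close>, which gives the
  threshold.\<close>

lemma PS_4_subcritical:
  assumes N: "DIM('a) = 4" and a0: "0 < a" and bS: "b < S powi (-2)"
    and \<mu>1: "\<mu> < a * first_dirichlet_eigenvalue \<Omega>" and c: "c < a\<^sup>2 / (4 * (S powi (-2) - b))"
  shows "satisfies_PS \<Omega> J c"
proof (rule satisfies_PS_I)
  have p4: "p = 4" using N by (simp add: p_eq critical_exponent_def)
  let ?l = "first_dirichlet_eigenvalue \<Omega>"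
  have l: "0 < ?l" using \<mu>1 \<mu> a0 by (smt (verit) mult_nonneg_nonpos)
  \<comment> \<open>A quarter of what the eigenvalue term leaves of \<open>a\<close> in
    \<open>PS_4_identity\<close>; the strict hypothesis on \<open>\<mu>\<close> makes it
    positive.\<close>
  define \<kappa> where "\<kappa> = (a - \<mu> / ?l) / 4"
  have \<kappa>: "0 < \<kappa>" using \<mu>1 l by (simp add: \<kappa>_def field_simps)
  show "\<exists>K. \<forall>\<^sub>F n in sequentially. energy_norm (U n) \<le> K" if PS: "PS_seq c U" for U
  proof (rule PS_bounded_of_growth[OF PS, where q = 1 and s = 2 and \<alpha> = \<kappa> and \<beta> = "\<bar>c\<bar> + 2"])
    fix u assume u: "u \<in> H01 \<Omega>" "1 \<le> energy_norm u" "J u \<le> \<bar>c\<bar> + 1" "\<bar>J' u u\<bar> \<le> energy_norm u"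
    let ?e = "energy_norm u"
    have "(L2_norm M u)\<^sup>2 \<le> ?e\<^sup>2 / ?l" using first_dirichlet_eigenvalue_le[OF u(1)] l by (simp add: field_simps)
    then have "\<mu> / 4 * (L2_norm M u)\<^sup>2 \<le> \<mu> / 4 * (?e\<^sup>2 / ?l)" using \<mu> by (intro mult_left_mono) auto
    then have "\<kappa> * ?e\<^sup>2 \<le> a / 4 * ?e\<^sup>2 - \<mu> / 4 * (L2_norm M u)\<^sup>2" by (simp add: \<kappa>_def algebra_simps diff_divide_distrib)
    also have "\<dots> \<le> \<bar>c\<bar> + 1 + 1 / 4 * ?e" unfolding PS_4_identity[OF p4 u(1), symmetric] using u(3,4) by (simp add: abs_le_iff)
    also have "\<dots> \<le> (\<bar>c\<bar> + 1) * ?e + ?e" using mult_left_mono[OF u(2), of "\<bar>c\<bar> + 1"] u(2) by simp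
    also have "\<dots> = (\<bar>c\<bar> + 2) * ?e" by (simp add: algebra_simps)
    finally show "\<kappa> * ?e powr 2 \<le> (\<bar>c\<bar> + 2) * ?e powr 1" using u(2) by simp
  qed (use \<kappa> in auto)
next
  have p4: "p = 4" using N by (simp add: p_eq critical_exponent_def)
  note S = sobolev_constant_pos
  have S2: "S powi (-2) = 1 / S\<^sup>2" by (simp add: power_int_minus divide_inverse)
  fix u \<tau> A Q
  assume u: "u \<in> H01 \<Omega>" and \<tau>: "0 < \<tau>" and A: "A = \<tau> + (energy_norm u)\<^sup>2" and Q: "Q = (L2_norm M u)\<^sup>2"
    and le: "(a + b * A) * \<tau> \<le> (\<tau> / S) powr (p / 2)"
    and ceq: "c = a / 2 * A + b / 4 * A\<^sup>2 - \<mu> / 2 * Q - 1 / p * ((a + b * A) * A - \<mu> * Q)"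
  define E where "E = (energy_norm u)\<^sup>2"
  have E: "0 \<le> E" "A = \<tau> + E" by (auto simp: E_def A)
  have \<mu>Q: "\<mu> * Q \<le> a * E"
  proof -
    have "\<mu> * Q \<le> a * first_dirichlet_eigenvalue \<Omega> * Q" using \<mu>1 by (intro mult_right_mono) (auto simp: Q)
    also have "\<dots> \<le> a * E"
      using first_dirichlet_eigenvalue_le[OF u] a by (simp add: E_def Q mult.assoc mult_left_mono)
    finally show ?thesis .
  qed
  have "(\<tau> / S) powr (p / 2) = \<tau> * (\<tau> * (1 / S\<^sup>2))" using \<tau> S by (simp add: p4 power2_eq_square)
  then have "\<tau> * (a + b * A) \<le> \<tau> * (\<tau> * S powi (-2))" using le S2 by (simp add: mult.commute)
  then have "a + b * A \<le> \<tau> * S powi (-2)" using \<tau> by (rule mult_left_le_imp_le)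
  moreover have "b * \<tau> \<le> b * A" using E b by simp
  ultimately have "a \<le> \<tau> * (S powi (-2) - b)" by (simp add: algebra_simps)
  then have "a / (S powi (-2) - b) \<le> \<tau>" using bS by (simp add: pos_divide_le_eq)
  then have "a / 4 * (a / (S powi (-2) - b)) \<le> a / 4 * \<tau>" using a0 by (intro mult_left_mono) auto
  moreover have "a / 4 * (a / (S powi (-2) - b)) = a\<^sup>2 / (4 * (S powi (-2) - b))" by (simp add: power2_eq_square)
  ultimately have "c < a / 4 * \<tau>" using c by (simp only:)
  moreover have "c = a / 4 * \<tau> + (a * E - \<mu> * Q) / 4" by (simp add: ceq E p4 power2_eq_square field_simps)
  ultimately show False using \<mu>Q by simp
qed

text \<open>The upper bound on \<open>J\<close> alone gives this, without the derivative. It serves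
  the two cases in which the fourth power of the energy norm dominates the critical
  integral.\<close>

lemma coercive_bound:
  assumes u: "u \<in> H01 \<Omega>" and Ju: "J u \<le> \<bar>c\<bar> + 1" and e1: "1 \<le> energy_norm u"
  shows "b / 4 * energy_norm u powr 4 \<le> (\<bar>c\<bar> + 1 + \<mu> / 2 * poincare_const\<^sup>2) * energy_norm u powr 2 + 1 / p * critical_integral \<Omega> u"
proof -
  let ?e = "energy_norm u"
  have "1 \<le> ?e\<^sup>2" using e1 by (simp add: one_le_power)
  then have "\<bar>c\<bar> + 1 \<le> (\<bar>c\<bar> + 1) * ?e\<^sup>2" using mult_left_mono[of 1 "?e\<^sup>2" "\<bar>c\<bar> + 1"] by simp
  moreover have "\<mu> / 2 * (L2_norm M u)\<^sup>2 \<le> \<mu> / 2 * (poincare_const\<^sup>2 * ?e\<^sup>2)" using poincare_sq[OF u] \<mu> by simp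
  moreover have "0 \<le> a / 2 * ?e\<^sup>2" using a by simp
  ultimately have "b / 4 * (?e\<^sup>2)\<^sup>2 \<le> (\<bar>c\<bar> + 1) * ?e\<^sup>2 + \<mu> / 2 * (poincare_const\<^sup>2 * ?e\<^sup>2) + 1 / p * critical_integral \<Omega> u"
    using Ju unfolding J_eq by linarith
  then show ?thesis using e1 by (simp add: algebra_simps)
qed

text \<open>By Sobolev the critical integral is at most \<open>S powi (-2)\<close> times the fourth
  power of the energy norm, so the surplus of \<open>b\<close> gives boundedness. The same surplus
  contradicts \<open>a + b * A \<le> \<tau> * S powi (-2)\<close>, because
  \<open>\<tau> \<le> A\<close>.\<close>

lemma PS_4_supercritical:
  assumes N: "DIM('a) = 4" and bS: "S powi (-2) < b"
  shows "satisfies_PS \<Omega> J c"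
proof (rule satisfies_PS_I)
  have p4: "p = 4" using N by (simp add: p_eq critical_exponent_def)
  note S = sobolev_constant_pos
  have S2: "S powi (-2) = 1 / S\<^sup>2" by (simp add: power_int_minus divide_inverse)
  show "\<exists>K. \<forall>\<^sub>F n in sequentially. energy_norm (U n) \<le> K" if PS: "PS_seq c U" for U
  proof (rule PS_bounded_of_growth[OF PS, where q = 2 and s = 4 and \<alpha> = "(b - S powi (-2)) / 4" and \<beta> = "\<bar>c\<bar> + 1 + \<mu> / 2 * poincare_const\<^sup>2"])
    fix u assume u: "u \<in> H01 \<Omega>" "1 \<le> energy_norm u" "J u \<le> \<bar>c\<bar> + 1"
    let ?e = "energy_norm u"
    have "critical_integral \<Omega> u \<le> (?e\<^sup>2 / S)\<^sup>2"
      using sobolev_inequality[OF u(1)] S u(2) by (simp add: p4 dirichlet_energy_eq)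
    also have "\<dots> = S powi (-2) * ?e powr 4" using u(2) by (simp add: S2 power_divide)
    finally have "1 / p * critical_integral \<Omega> u \<le> 1 / 4 * (S powi (-2) * ?e powr 4)" by (simp add: p4)
    then show "(b - S powi (-2)) / 4 * ?e powr 4 \<le> (\<bar>c\<bar> + 1 + \<mu> / 2 * poincare_const\<^sup>2) * ?e powr 2"
      using coercive_bound[OF u(1,3,2)] by (simp add: algebra_simps diff_divide_distrib)
  qed (use bS \<mu> in auto)
next
  have p4: "p = 4" using N by (simp add: p_eq critical_exponent_def)
  note S = sobolev_constant_pos
  have S2: "S powi (-2) = 1 / S\<^sup>2" by (simp add: power_int_minus divide_inverse)
  fix u \<tau> A Q
  assume \<tau>: "0 < \<tau>" and A: "A = \<tau> + (energy_norm u)\<^sup>2" and le: "(a + b * A) * \<tau> \<le> (\<tau> / S) powr (p / 2)"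
  have "(\<tau> / S) powr (p / 2) = \<tau> * (\<tau> * (1 / S\<^sup>2))" using \<tau> S by (simp add: p4 power2_eq_square)
  then have "\<tau> * (a + b * A) \<le> \<tau> * (\<tau> * S powi (-2))" using le S2 by (simp add: mult.commute)
  then have "a + b * A \<le> \<tau> * S powi (-2)" using \<tau> by (rule mult_left_le_imp_le)
  moreover have "\<tau> * b \<le> b * A" using A b by (simp add: algebra_simps)
  moreover have "\<tau> * S powi (-2) < \<tau> * b" using bS \<tau> by (rule mult_strict_left_mono)
  ultimately show False using a by linarith
qed

text \<open>Weighted arithmetic-geometric mean with weights \<open>k\<close> and 2: divide by the
  mean \<open>w\<close> and use \<open>ln x \<le> x - 1\<close>, whose right sides then sum to
  0.\<close>

lemma weighted_mean_power_le:
  fixes x y :: real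
  assumes x: "0 < x" and y: "0 < y"
  shows "x ^ k * y\<^sup>2 \<le> ((real k * x + 2 * y) / real (k + 2)) ^ (k + 2)"
proof -
  define w where "w = (real k * x + 2 * y) / real (k + 2)"
  have "0 < real k * x + 2 * y" using x y add_nonneg_pos[of "real k * x" "2 * y"] by simp
  then have w: "0 < w" "real k * x + 2 * y = real (k + 2) * w" by (auto simp: w_def)
  have "ln ((x / w) ^ k * (y / w)\<^sup>2) = real k * ln (x / w) + 2 * ln (y / w)"
    using x y w by (simp add: ln_mult ln_realpow)
  also have "\<dots> \<le> real k * (x / w - 1) + 2 * (y / w - 1)"
    using x y w by (intro add_mono mult_left_mono ln_le_minus_one) auto
  also have "\<dots> = (real k * x + 2 * y) / w - real (k + 2)"
    using w(1) by (simp add: field_simps)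
  also have "\<dots> = 0" unfolding w(2) using w(1) by simp
  finally have "(x / w) ^ k * (y / w)\<^sup>2 \<le> 1" using x y w by (subst (asm) ln_le_zero_iff) auto
  then have "x ^ k * y\<^sup>2 \<le> w ^ k * w\<^sup>2" using w by (simp add: power_divide divide_le_eq)
  then show ?thesis unfolding w_def[symmetric] by (simp only: power_add)
qed

text \<open>With \<open>k = N - 4\<close> the loss inequality, raised to the power
  \<open>N - 2\<close>, gives \<open>(a + b * \<tau>)^(k + 2) \<le> \<tau>^2 / S^N\<close>. The
  weighted mean inequality bounds the left side below by a multiple of
  \<open>a^k * b^2 * \<tau>^2\<close>; \<open>\<tau>\<close> drops out, and the result contradicts
  the hypothesis. Boundedness comes from \<open>p < 4\<close>.\<close>

lemma PS_high_dim:
  assumes N: "5 \<le> DIM('a)"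
    and ab: "4 * real (DIM('a) - 4) ^ (DIM('a) - 4) / real (DIM('a) - 2) ^ (DIM('a) - 2) * S powi (- int DIM('a))
      < a ^ (DIM('a) - 4) * b\<^sup>2"
  shows "satisfies_PS \<Omega> J c"
proof (rule satisfies_PS_I)
  note S = sobolev_constant_pos
  have p4: "p < 4" using N by (simp add: p_eq critical_exponent_def field_simps)
  show "\<exists>K. \<forall>\<^sub>F n in sequentially. energy_norm (U n) \<le> K" if PS: "PS_seq c U" for U
  proof (rule PS_bounded_of_growth[OF PS, where q = p and s = 4 and \<alpha> = "b / 4" and \<beta> = "\<bar>c\<bar> + 1 + \<mu> / 2 * poincare_const\<^sup>2 + 1 / p * emb powr p"])
    fix u assume u: "u \<in> H01 \<Omega>" "1 \<le> energy_norm u" "J u \<le> \<bar>c\<bar> + 1"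
    let ?e = "energy_norm u"
    have "critical_integral \<Omega> u \<le> emb powr p * ?e powr p"
      using integral_powr_le[OF u(1)] emb_pos by (simp add: critical_integral_eq powr_mult)
    then have "1 / p * critical_integral \<Omega> u \<le> 1 / p * (emb powr p * ?e powr p)" using p_gt_2 by (intro mult_left_mono) auto
    moreover have "(\<bar>c\<bar> + 1 + \<mu> / 2 * poincare_const\<^sup>2) * ?e powr 2 \<le> (\<bar>c\<bar> + 1 + \<mu> / 2 * poincare_const\<^sup>2) * ?e powr p"
      using u(2) p_gt_2 \<mu> by (intro mult_left_mono powr_mono) auto
    ultimately have "b / 4 * ?e powr 4 \<le> (\<bar>c\<bar> + 1 + \<mu> / 2 * poincare_const\<^sup>2) * ?e powr p + 1 / p * (emb powr p * ?e powr p)"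
      using coercive_bound[OF u(1,3,2)] by linarith
    also have "\<dots> = (\<bar>c\<bar> + 1 + \<mu> / 2 * poincare_const\<^sup>2 + 1 / p * emb powr p) * ?e powr p"
      by (simp add: distrib_right)
    finally show "b / 4 * ?e powr 4 \<le> (\<bar>c\<bar> + 1 + \<mu> / 2 * poincare_const\<^sup>2 + 1 / p * emb powr p) * ?e powr p" .
  qed (use b \<mu> p4 p_gt_2 in auto)
next
  note S = sobolev_constant_pos
  define k where "k = DIM('a) - 4"
  have k: "1 \<le> k" "DIM('a) = k + 4" "DIM('a) - 2 = k + 2" using N by (auto simp: k_def)
  have p2: "p / 2 = 1 + 2 / real (k + 2)" by (simp add: p_eq critical_exponent_def k(2) field_simps)
  fix u \<tau> A Q
  assume \<tau>: "0 < \<tau>" and A: "A = \<tau> + (energy_norm u)\<^sup>2" and le: "(a + b * A) * \<tau> \<le> (\<tau> / S) powr (p / 2)"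
  \<comment> \<open>The smaller side of the strict hypothesis is nonnegative, so the larger one is
    positive and \<open>a\<close> cannot vanish, since \<open>k \<ge> 1\<close>.\<close>
  have lhs0: "0 < a ^ k * b\<^sup>2" using ab S by (intro le_less_trans[OF _ ab[folded k_def]]) simp
  then have a0: "0 < a" using a k(1) by (cases "a = 0") (auto simp: power_0_left)
  have "\<tau> * (a + b * \<tau>) \<le> \<tau> * (a + b * A)" using \<tau> A b by simp
  also have "\<dots> \<le> (\<tau> / S) powr (p / 2)" using le by (simp add: mult.commute)
  finally have "\<tau> * (a + b * \<tau>) \<le> (\<tau> / S) powr (p / 2)" .
  then have "(\<tau> * (a + b * \<tau>)) ^ (k + 2) \<le> ((\<tau> / S) powr (p / 2)) ^ (k + 2)"
    using \<tau> a0 b by (intro power_mono) auto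
  also have "\<dots> = ((\<tau> / S) powr (p / 2)) powr real (k + 2)" using \<tau> S by (intro powr_realpow[symmetric]) simp
  also have "\<dots> = (\<tau> / S) powr (p / 2 * real (k + 2))" by (rule powr_powr)
  also have "p / 2 * real (k + 2) = real (k + 4)" by (simp add: p2 field_simps)
  also have "(\<tau> / S) powr real (k + 4) = \<tau> ^ (k + 2) * (\<tau>\<^sup>2 / S ^ (k + 4))"
    using \<tau> S by (subst powr_realpow) (auto simp: power_divide power_add power2_eq_square power_numeral_reduce)
  finally have "\<tau> ^ (k + 2) * (a + b * \<tau>) ^ (k + 2) \<le> \<tau> ^ (k + 2) * (\<tau>\<^sup>2 / S ^ (k + 4))" by (simp only: power_mult_distrib)
  then have up: "(a + b * \<tau>) ^ (k + 2) \<le> \<tau>\<^sup>2 / S ^ (k + 4)" by (rule mult_left_le_imp_le) (rule zero_less_power[OF \<tau>])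
  define m where "m = real (k + 2)"
  have m: "0 < m" "0 < real k" using k by (auto simp: m_def)
  \<comment> \<open>The two entries are chosen with weighted mean \<open>a + b * \<tau>\<close>; the
    factor \<open>m^(k + 2) / (4 * k^k)\<close> that appears is the reciprocal of the constant in
    the hypothesis.\<close>
  have "(m * a / real k) ^ k * (m * (b * \<tau>) / 2)\<^sup>2 \<le> ((real k * (m * a / real k) + 2 * (m * (b * \<tau>) / 2)) / m) ^ (k + 2)"
    unfolding m_def by (rule weighted_mean_power_le) (use m a0 b \<tau> in \<open>auto simp: m_def\<close>)
  also have "(real k * (m * a / real k) + 2 * (m * (b * \<tau>) / 2)) / m = a + b * \<tau>"
    using m by (simp add: field_simps)
  finally have "(m * a / real k) ^ k * (m * (b * \<tau>) / 2)\<^sup>2 \<le> \<tau>\<^sup>2 / S ^ (k + 4)" using up by linarith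
  moreover have "(m * a / real k) ^ k * (m * (b * \<tau>) / 2)\<^sup>2 = \<tau>\<^sup>2 * (a ^ k * b\<^sup>2 * (m ^ (k + 2) / (4 * real k ^ k)))"
    by (simp add: power_divide power_mult_distrib power_add power2_eq_square mult_ac)
  ultimately have "\<tau>\<^sup>2 * (a ^ k * b\<^sup>2 * (m ^ (k + 2) / (4 * real k ^ k))) \<le> \<tau>\<^sup>2 * (1 / S ^ (k + 4))" by simp
  then have "a ^ k * b\<^sup>2 * (m ^ (k + 2) / (4 * real k ^ k)) \<le> 1 / S ^ (k + 4)"
    by (rule mult_left_le_imp_le) (rule zero_less_power[OF \<tau>])
  moreover have "0 < m ^ (k + 2) / (4 * real k ^ k)" using m by (intro divide_pos_pos) simp_all
  ultimately have "a ^ k * b\<^sup>2 \<le> 1 / S ^ (k + 4) / (m ^ (k + 2) / (4 * real k ^ k))"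
    by (simp only: pos_le_divide_eq)
  also have "\<dots> = 4 * real k ^ k / m ^ (k + 2) * (1 / S ^ (k + 4))" by (simp add: mult.commute)
  finally have "a ^ k * b\<^sup>2 \<le> 4 * real k ^ k / m ^ (k + 2) * (1 / S ^ (k + 4))" .
  moreover have "S powi (- int DIM('a)) = 1 / S ^ (k + 4)"
    by (simp only: power_int_minus power_int_of_nat k(2) divide_inverse mult_1)
  ultimately show False using ab unfolding k_def[symmetric] k(3) m_def by simp
qed

end

theorem corollary1p4:
  fixes \<Omega> :: "'a::euclidean_space set" and a b \<mu> :: real
  defines "N \<equiv> DIM('a)"
    and "S \<equiv> sobolev_constant \<Omega>"
    and "\<mu>\<^sub>1 \<equiv> first_dirichlet_eigenvalue \<Omega>"
    and "J \<equiv> kirchhoff_functional \<Omega> a b \<mu>"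
  assumes "N \<ge> 3"
    and "open \<Omega>" "connected \<Omega>" "bounded \<Omega>" "\<Omega> \<noteq> {}"
    and "a \<ge> 0" "b > 0" "\<mu> > 0"
  shows
    "(N = 3 \<and> a > 0 \<and> \<mu> \<le> a * \<mu>\<^sub>1 \<longrightarrow>
        (\<forall>c < 1/4 * a * b * S^3 + 1/24 * b^3 * S^6 + 1/24 * (4 * a * S + b^2 * S^4) powr (3/2).
           satisfies_PS \<Omega> J c)) \<and>
     (N = 4 \<and> a > 0 \<and> b < S powi (-2) \<and> \<mu> < a * \<mu>\<^sub>1 \<longrightarrow>
        (\<forall>c < a^2 / (4 * (S powi (-2) - b)). satisfies_PS \<Omega> J c)) \<and>
     (N = 4 \<and> b > S powi (-2) \<longrightarrow> (\<forall>c. satisfies_PS \<Omega> J c)) \<and>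
     (N \<ge> 5 \<and> a ^ (N - 4) * b^2 >
          4 * real (N - 4) ^ (N - 4) / real (N - 2) ^ (N - 2) * S powi (- int N) \<longrightarrow>
        (\<forall>c. satisfies_PS \<Omega> J c))"
proof -
  interpret kirchhoff \<Omega> "critical_exponent TYPE('a)" a b \<mu>
    by unfold_locales (use assms in auto)
  show ?thesis
    unfolding assms(1-4)
  proof (intro conjI impI allI)
    fix c
    show "satisfies_PS \<Omega> (kirchhoff_functional \<Omega> a b \<mu>) c"
      if "DIM('a) = 3 \<and> a > 0 \<and> \<mu> \<le> a * first_dirichlet_eigenvalue \<Omega>"
        "c < 1/4 * a * b * sobolev_constant \<Omega> ^ 3 + 1/24 * b^3 * sobolev_constant \<Omega> ^ 6
          + 1/24 * (4 * a * sobolev_constant \<Omega> + b^2 * sobolev_constant \<Omega> ^ 4) powr (3/2)"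
      by (rule PS_3[OF _ _ that(2)]) (use that(1) in blast)+
    show "satisfies_PS \<Omega> (kirchhoff_functional \<Omega> a b \<mu>) c"
      if "DIM('a) = 4 \<and> a > 0 \<and> b < sobolev_constant \<Omega> powi (-2) \<and> \<mu> < a * first_dirichlet_eigenvalue \<Omega>"
        "c < a^2 / (4 * (sobolev_constant \<Omega> powi (-2) - b))"
      by (rule PS_4_subcritical[OF _ _ _ _ that(2)]) (use that(1) in blast)+
    show "satisfies_PS \<Omega> (kirchhoff_functional \<Omega> a b \<mu>) c"
      if "DIM('a) = 4 \<and> b > sobolev_constant \<Omega> powi (-2)"
      by (rule PS_4_supercritical) (use that in blast)+
    show "satisfies_PS \<Omega> (kirchhoff_functional \<Omega> a b \<mu>) c"
      if "DIM('a) \<ge> 5 \<and> a ^ (DIM('a) - 4) * b^2 > 4 * real (DIM('a) - 4) ^ (DIM('a) - 4)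
        / real (DIM('a) - 2) ^ (DIM('a) - 2) * sobolev_constant \<Omega> powi (- int DIM('a))"
      by (rule PS_high_dim) (use that in blast)+
  qed
qed

end
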